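(* Let $n\ge 3$ and let $\boldsymbol d=(d_1,\dots,d_n)$ with $2\le d_1\le\cdots\le d_n$ and $d_n-1\le\sum_{i=1}^{n-1}(d_i-1)$. Let $E=\bigoplus_{i=1}^n\mathcal O(\mathbf 1_i)^{\oplus(d_i-1)}$ on $\mathbb P^{\boldsymbol d}$ and let $\Delta(E)$ be its discriminant. Then the real part of $\Delta(E)$ has codimension one in the real vector space of global sections of $E$ with real coefficients. In particular, $\operatorname{codim}\Delta(E)=1$.
   Context: $\mathbb P^{\boldsymbol d}=\prod_{i=1}^n\mathbb P^{d_i-1}$ (over $\mathbb C$); $\mathbf 1_i\in\mathbb Z^n$ has $0$ in position $i$ and $1$ elsewhere; $\mathcal O(\boldsymbol\alpha)$ is the line bundle of multidegree $\boldsymbol\alpha$. $\mathcal Z(f)$ is the zero scheme of a global section $f$. The discriminant of $E$ is $\Delta(E)=\mathbb P H^0(\mathbb P^{\boldsymbol d},E)\setminus\{[f] : \mathcal Z(f)\text{ is reduced of dimension }0\}$. Its real part is the set of its points represented by sections with real coefficients. *)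

theory Defs
  imports "HOL-Analysis.Analysis"
begin

text \<open>Factors are indexed 0..n-1 (the paper uses 1..n). The i-th factor is P^(d i - 1),
 with homogeneous coordinates x i a, a < d i.\<close>

definition cone_pts :: "nat \<Rightarrow> (nat \<Rightarrow> nat) \<Rightarrow> (nat \<Rightarrow> nat \<Rightarrow> complex) set" where
  "cone_pts n d = {x. (\<forall>j<n. \<exists>a<d j. x j a \<noteq> 0) \<and> (\<forall>j a. (n \<le> j \<or> d j \<le> a) \<longrightarrow> x j a = 0)}"

definition tan_vecs :: "nat \<Rightarrow> (nat \<Rightarrow> nat) \<Rightarrow> (nat \<Rightarrow> nat \<Rightarrow> complex) set" where
  "tan_vecs n d = {v. \<forall>j a. (n \<le> j \<or> d j \<le> a) \<longrightarrow> v j a = 0}"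

definition proj_rel :: "nat \<Rightarrow> (nat \<Rightarrow> nat) \<Rightarrow> ((nat \<Rightarrow> nat \<Rightarrow> complex) \<times> (nat \<Rightarrow> nat \<Rightarrow> complex)) set" where
  "proj_rel n d = {(x, y). x \<in> cone_pts n d \<and> y \<in> cone_pts n d \<and>
      (\<exists>c. (\<forall>j<n. c j \<noteq> 0) \<and> (\<forall>j<n. \<forall>a. x j a = c j * y j a))}"

text \<open>Multi-indices of the monomials of multidegree 1_i (linear in every x_j, j \<noteq> i).\<close>
definition multi_idx :: "nat \<Rightarrow> (nat \<Rightarrow> nat) \<Rightarrow> nat \<Rightarrow> (nat \<Rightarrow> nat) set" where
  "multi_idx n d i = {idx. (\<forall>j<n. j \<noteq> i \<longrightarrow> idx j < d j) \<and> idx i = 0 \<and> (\<forall>j\<ge>n. idx j = 0)}"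

text \<open>Coordinates of H^0(E), E = direct sum over i of O(1_i)^(d_i - 1): the coefficient of
 the monomial idx in the k-th copy of O(1_i) is f (i, k, idx).\<close>
definition sec_idx :: "nat \<Rightarrow> (nat \<Rightarrow> nat) \<Rightarrow> (nat \<times> nat \<times> (nat \<Rightarrow> nat)) set" where
  "sec_idx n d = {(i, k, idx). i < n \<and> k < d i - 1 \<and> idx \<in> multi_idx n d i}"

definition sections :: "nat \<Rightarrow> (nat \<Rightarrow> nat) \<Rightarrow> ((nat \<times> nat \<times> (nat \<Rightarrow> nat)) \<Rightarrow> 'a::zero) set" where
  "sections n d = {f. \<forall>p. p \<notin> sec_idx n d \<longrightarrow> f p = 0}"

definition sec_eval :: "nat \<Rightarrow> (nat \<Rightarrow> nat) \<Rightarrow> (nat \<times> nat \<times> (nat \<Rightarrow> nat) \<Rightarrow> complex)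
    \<Rightarrow> (nat \<Rightarrow> nat \<Rightarrow> complex) \<Rightarrow> nat \<Rightarrow> nat \<Rightarrow> complex" where
  "sec_eval n d f x i k = (\<Sum>idx\<in>multi_idx n d i. f (i, k, idx) * (\<Prod>j\<in>{..<n} - {i}. x j (idx j)))"

definition sec_deriv :: "nat \<Rightarrow> (nat \<Rightarrow> nat) \<Rightarrow> (nat \<times> nat \<times> (nat \<Rightarrow> nat) \<Rightarrow> complex)
    \<Rightarrow> (nat \<Rightarrow> nat \<Rightarrow> complex) \<Rightarrow> (nat \<Rightarrow> nat \<Rightarrow> complex) \<Rightarrow> nat \<Rightarrow> nat \<Rightarrow> complex" where
  "sec_deriv n d f x v i k = (\<Sum>idx\<in>multi_idx n d i. f (i, k, idx) *
      (\<Sum>m\<in>{..<n} - {i}. v m (idx m) * (\<Prod>j\<in>{..<n} - {i, m}. x j (idx j))))"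

definition zero_set :: "nat \<Rightarrow> (nat \<Rightarrow> nat) \<Rightarrow> (nat \<times> nat \<times> (nat \<Rightarrow> nat) \<Rightarrow> complex)
    \<Rightarrow> (nat \<Rightarrow> nat \<Rightarrow> complex) set" where
  "zero_set n d f = {x \<in> cone_pts n d. \<forall>i<n. \<forall>k<d i - 1. sec_eval n d f x i k = 0}"

text \<open>Z(f) is reduced of dimension 0: nonempty, finitely many points of P^d, and at each point
 the Zariski tangent space of Z(f) vanishes, i.e. the kernel of the differential of the
 section on the affine cone is spanned by the Euler directions (0,..,x_j,..,0).\<close>
definition reduced_dim0 :: "nat \<Rightarrow> (nat \<Rightarrow> nat) \<Rightarrow> (nat \<times> nat \<times> (nat \<Rightarrow> nat) \<Rightarrow> complex) \<Rightarrow> bool" where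
  "reduced_dim0 n d f \<longleftrightarrow>
     zero_set n d f \<noteq> {} \<and> finite (zero_set n d f // proj_rel n d) \<and>
     (\<forall>x\<in>zero_set n d f. \<forall>v\<in>tan_vecs n d.
        (\<forall>i<n. \<forall>k<d i - 1. sec_deriv n d f x v i k = 0) \<longrightarrow>
        (\<exists>c. \<forall>j<n. \<forall>a. v j a = c j * x j a))"

definition discr_cone :: "nat \<Rightarrow> (nat \<Rightarrow> nat) \<Rightarrow> (nat \<times> nat \<times> (nat \<Rightarrow> nat) \<Rightarrow> complex) set" where
  "discr_cone n d = {f \<in> sections n d. (\<exists>p. f p \<noteq> 0) \<and> \<not> reduced_dim0 n d f}"

definition real_discr_cone :: "nat \<Rightarrow> (nat \<Rightarrow> nat) \<Rightarrow> (nat \<times> nat \<times> (nat \<Rightarrow> nat) \<Rightarrow> real) set" where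
  "real_discr_cone n d = {g \<in> sections n d. (\<lambda>p. complex_of_real (g p)) \<in> discr_cone n d}"

text \<open>Dimension: R^k is realised as the coordinate subspace of nat => real (product topology).
 A set S "contains a k-cell" if some nonempty open subset of R^k maps continuously and
 injectively into S; the (topological = semialgebraic) dimension of S is the largest such k.\<close>
definition euclid :: "nat \<Rightarrow> (nat \<Rightarrow> real) set" where
  "euclid k = {v. \<forall>j\<ge>k. v j = 0}"

definition contains_cell :: "nat \<Rightarrow> 'b::topological_space set \<Rightarrow> bool" where
  "contains_cell k S \<longleftrightarrow> (\<exists>U g. openin (top_of_set (euclid k)) U \<and> U \<noteq> {} \<and>
      continuous_on U g \<and> inj_on g U \<and> g ` U \<subseteq> S)"

definition has_dim :: "'b::topological_space set \<Rightarrow> nat \<Rightarrow> bool" where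
  "has_dim S m \<longleftrightarrow> contains_cell m S \<and> \<not> contains_cell (Suc m) S"

end

theory Submission
  imports Defs "HOL-Homology.Invariance_of_Domain" "HOL-Computational_Algebra.Polynomial"
begin

text \<open>Call a section degenerate if at some zero its differential has a kernel beyond the Euler
  directions. Counting parameters, every degenerate section is a rational function of fewer
  coordinates than there are coefficients (the balance condition on \<open>d\<close> is what makes this work for
  kernel vectors supported in a single factor), so the degenerate sections satisfy a nonzero polynomial
  equation \<open>P = 0\<close>. Every section has a zero: on the connected set \<open>P \<noteq> 0\<close> having a zero is an open
  condition (zeros are nondegenerate) and a closed one (compactness), and it is satisfied near a
  section whose linear part at the origin of a chart is a permutation matrix.
  Together with compactness, the discriminant is therefore the set of nonzero degenerate sections. It
  contains no cell of larger dimension, because \<open>P\<close> does not vanish on an open set of real points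
  and a complex hypersurface contains no cell of codimension one; and it
  contains a cell of the asserted dimension around a section with a fold, i.e. a zero of
  corank one whose second derivative is nondegenerate in the kernel direction, near which the degenerate section
  determines its degenerate zero and kernel vector.\<close>

text \<open>Equations and affine coordinates are equal in number,
  \<open>S = (\<Sum>j<n. d j - 1)\<close>. The hypothesis on the largest \<open>d\<close> is used in
  the form \<open>2 * (d i - 1) \<le> S\<close> for every \<open>i\<close>. A kernel vector
  supported in factor \<open>m\<close> is invisible to the rows of that factor: after scaling it has
  \<open>d m - 2\<close> free coordinates, against \<open>S - (d m - 1)\<close> derivative equations
  in the other rows. The same inequality lets rows and columns be matched so that no row meets a
  column of its own factor, which is the constraint on the linear part of a section. The third
  factor is there for the fold: its quadratic monomial joins two factors, both different from that
  of its row. Elimination is done by linear algebra on a large grid. The implicit function theorem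
  is replaced by invariance of domain: the coordinates of a zero are written into coefficient slots
  that the equations determine, and the resulting self-map of the space of sections need only be
  injective to be open. The map parametrising degenerate sections is given by rational formulas with
  real coefficients, so one map serves both cells.\<close>

section \<open>Polynomial functions with a degree bound\<close>

text \<open>\<open>m\<close> bounds the total degree. Polynomials are kept as functions with a
  certificate of how they are built, because the index type is arbitrary and the facts needed are
  inductions on that certificate.\<close>

inductive polyfn :: "'p set \<Rightarrow> nat \<Rightarrow> (('p \<Rightarrow> complex) \<Rightarrow> complex) \<Rightarrow> bool" for V where
  polyfn_const: "polyfn V m (\<lambda>_. c)"
| polyfn_add: "polyfn V m f \<Longrightarrow> polyfn V m g \<Longrightarrow> polyfn V m (\<lambda>z. f z + g z)"
| polyfn_var_times: "p \<in> V \<Longrightarrow> polyfn V m f \<Longrightarrow> polyfn V (Suc m) (\<lambda>z. z p * f z)"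

lemma polyfn_Suc: "polyfn V m f \<Longrightarrow> polyfn V (Suc m) f"
  by (induction rule: polyfn.induct) (auto intro: polyfn.intros)

lemma polyfn_mono:
  assumes "polyfn V m f" "m \<le> m'" shows "polyfn V m' f"
  using assms(2,1) by (induction m' rule: dec_induct) (auto intro: polyfn_Suc)

lemma polyfn_scale: "polyfn V m f \<Longrightarrow> polyfn V m (\<lambda>z. c * f z)"
proof (induction rule: polyfn.induct)
  case (polyfn_const m c') show ?case by (rule polyfn.polyfn_const)
next
  case (polyfn_add m f g) then show ?case by (simp add: distrib_left polyfn.polyfn_add)
next
  case (polyfn_var_times p m f)
  then have "polyfn V (Suc m) (\<lambda>z. z p * (c * f z))" by (intro polyfn.polyfn_var_times)
  then show ?case by (simp add: mult.left_commute)
qed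

lemma polyfn_mult: "polyfn V m f \<Longrightarrow> polyfn V k g \<Longrightarrow> polyfn V (m + k) (\<lambda>z. f z * g z)"
proof (induction rule: polyfn.induct)
  case (polyfn_const m c)
  then show ?case by (intro polyfn_scale) (auto intro: polyfn_mono)
next
  case (polyfn_add m f g) then show ?case by (simp add: distrib_right polyfn.polyfn_add)
next
  case (polyfn_var_times p m f) 
  then have "polyfn V (Suc (m + k)) (\<lambda>z. z p * (f z * g z))" by (intro polyfn.polyfn_var_times) auto
  then show ?case by (simp add: mult.assoc)
qed

lemma polyfn_var: "p \<in> V \<Longrightarrow> polyfn V (Suc 0) (\<lambda>z. z p)"
  using polyfn_var_times[OF _ polyfn_const[of V 0 1], of p] by simp

lemma polyfn_prod:
  assumes "finite A" "\<And>i. i \<in> A \<Longrightarrow> polyfn V m (f i)"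
  shows "polyfn V (card A * m) (\<lambda>z. \<Prod>i\<in>A. f i z)"
  using assms by (induction A rule: finite_induct) (auto intro: polyfn_const polyfn_mult)

lemma continuous_on_polyfn: "polyfn V m f \<Longrightarrow> continuous_on UNIV f"
  by (induction rule: polyfn.induct) (auto intro!: continuous_intros)

lemma polyfn_cong_supp: "polyfn V m f \<Longrightarrow> (\<And>p. p \<in> V \<Longrightarrow> z p = z' p) \<Longrightarrow> f z = f z'"
  by (induction rule: polyfn.induct) auto

definition polynomial_fn :: "'p set \<Rightarrow> (('p \<Rightarrow> complex) \<Rightarrow> complex) \<Rightarrow> bool" where
  "polynomial_fn V f \<longleftrightarrow> (\<exists>m. polyfn V m f)"

lemma polynomial_fn_const [intro]: "polynomial_fn V (\<lambda>_. c)"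
  by (auto simp: polynomial_fn_def intro: polyfn_const)

lemma polynomial_fn_var [intro]: "p \<in> V \<Longrightarrow> polynomial_fn V (\<lambda>z. z p)"
  by (auto simp: polynomial_fn_def intro: polyfn_var)

lemma polynomial_fn_add [intro]:
  assumes "polynomial_fn V f" "polynomial_fn V g" shows "polynomial_fn V (\<lambda>z. f z + g z)"
proof -
  obtain m k where "polyfn V m f" "polyfn V k g" using assms by (auto simp: polynomial_fn_def)
  then have "polyfn V (m + k) f" "polyfn V (m + k) g" by (auto intro: polyfn_mono)
  then show ?thesis by (auto simp: polynomial_fn_def intro: polyfn_add)
qed

lemma polynomial_fn_mult [intro]:
  "polynomial_fn V f \<Longrightarrow> polynomial_fn V g \<Longrightarrow> polynomial_fn V (\<lambda>z. f z * g z)"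
  by (auto simp: polynomial_fn_def intro: polyfn_mult)

lemma polynomial_fn_sum [intro]:
  "(\<And>i. i \<in> A \<Longrightarrow> polynomial_fn V (f i)) \<Longrightarrow> polynomial_fn V (\<lambda>z. \<Sum>i\<in>A. f i z)"
  by (induction A rule: infinite_finite_induct) auto

lemma polynomial_fn_prod [intro]:
  "(\<And>i. i \<in> A \<Longrightarrow> polynomial_fn V (f i)) \<Longrightarrow> polynomial_fn V (\<lambda>z. \<Prod>i\<in>A. f i z)"
  by (induction A rule: infinite_finite_induct) auto

subsection \<open>Annihilating polynomials\<close>

text \<open>Gaussian elimination, one row at a time: a zero row imposes nothing; otherwise a pivot
  column is cleared from the other rows, and its coordinate is solved for at the end.\<close>

lemma wide_matrix_kernel:
  fixes M :: "'r \<Rightarrow> 'c \<Rightarrow> 'a::field"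
  assumes "finite R" "finite C" "card R < card C"
  shows "\<exists>c. (\<exists>j\<in>C. c j \<noteq> 0) \<and> (\<forall>r\<in>R. (\<Sum>j\<in>C. M r j * c j) = 0)"
  using assms
proof (induction R arbitrary: C M rule: finite_induct)
  case empty
  then obtain j where "j \<in> C" by fastforce
  then show ?case by (intro exI[of _ "\<lambda>_. 1"]) auto
next
  case (insert r R)
  show ?case
  proof (cases "\<forall>j\<in>C. M r j = 0")
    case True
    from insert.IH[of C M] insert.prems insert.hyps obtain c where
      "\<exists>j\<in>C. c j \<noteq> 0" "\<forall>r\<in>R. (\<Sum>j\<in>C. M r j * c j) = 0" by auto
    then show ?thesis using True by (intro exI[of _ c]) auto
  next
    case False
    then obtain j0 where j0: "j0 \<in> C" "M r j0 \<noteq> 0" by auto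
    define M' where "M' q j = M q j - M q j0 * M r j / M r j0" for q j
    have "card R < card (C - {j0})" "finite (C - {j0})" using insert.prems insert.hyps j0 by auto
    from insert.IH[OF this(2,1), of M'] obtain c where
      c: "\<exists>j\<in>C - {j0}. c j \<noteq> 0" "\<forall>q\<in>R. (\<Sum>j\<in>C - {j0}. M' q j * c j) = 0" by auto
    define c' where "c' j = (if j = j0 then - (\<Sum>j\<in>C - {j0}. M r j * c j) / M r j0 else c j)" for j
    have split: "(\<Sum>j\<in>C. M q j * c' j)
        = M q j0 * (- (\<Sum>j\<in>C - {j0}. M r j * c j) / M r j0) + (\<Sum>j\<in>C - {j0}. M q j * c j)" for q
    proof -
      have "(\<Sum>j\<in>C. M q j * c' j) = M q j0 * c' j0 + (\<Sum>j\<in>C - {j0}. M q j * c' j)"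
        using insert.prems j0 by (simp add: sum.remove)
      also have "(\<Sum>j\<in>C - {j0}. M q j * c' j) = (\<Sum>j\<in>C - {j0}. M q j * c j)"
        by (rule sum.cong) (auto simp: c'_def)
      finally show ?thesis by (simp add: c'_def)
    qed
    have "(\<Sum>j\<in>C. M q j * c' j) = (\<Sum>j\<in>C - {j0}. M' q j * c j)" for q
    proof -
      have "(\<Sum>j\<in>C - {j0}. M' q j * c j)
          = (\<Sum>j\<in>C - {j0}. M q j * c j) - (\<Sum>j\<in>C - {j0}. (M q j0 / M r j0) * (M r j * c j))"
        unfolding sum_subtractf[symmetric]
        by (rule sum.cong) (auto simp: M'_def algebra_simps)
      also have "(\<Sum>j\<in>C - {j0}. (M q j0 / M r j0) * (M r j * c j)) 
          = (M q j0 / M r j0) * (\<Sum>j\<in>C - {j0}. M r j * c j)"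
        by (simp add: sum_distrib_left)
      finally show ?thesis unfolding split by simp
    qed
    moreover have "(\<Sum>j\<in>C. M r j * c' j) = 0"
      unfolding split using j0 by simp
    moreover have "\<exists>j\<in>C. c' j \<noteq> 0" using c(1) by (auto simp: c'_def)
    ultimately show ?thesis using c(2) by (intro exI[of _ c']) auto
  qed
qed

section \<open>Linear spans and monomials\<close>

text \<open>The coefficients are indexed by the functions themselves, so monomials that coincide as
  functions are counted once.\<close>

definition spanned :: "('z \<Rightarrow> complex) set \<Rightarrow> ('z \<Rightarrow> complex) \<Rightarrow> bool" where
  "spanned B f \<longleftrightarrow> (\<exists>c. \<forall>z. f z = (\<Sum>b\<in>B. c b * b z))"

lemma spanned_add: "spanned B f \<Longrightarrow> spanned B g \<Longrightarrow> spanned B (\<lambda>z. f z + g z)"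
proof -
  assume "spanned B f" "spanned B g"
  then obtain c c' where "\<forall>z. f z = (\<Sum>b\<in>B. c b * b z)" "\<forall>z. g z = (\<Sum>b\<in>B. c' b * b z)"
    by (auto simp: spanned_def)
  then show ?thesis unfolding spanned_def
    by (intro exI[of _ "\<lambda>b. c b + c' b"]) (simp add: sum.distrib distrib_right)
qed

lemma spanned_scale: "spanned B f \<Longrightarrow> spanned B (\<lambda>z. k * f z)"
proof -
  assume "spanned B f"
  then obtain c where "\<forall>z. f z = (\<Sum>b\<in>B. c b * b z)" by (auto simp: spanned_def)
  then show ?thesis unfolding spanned_def
    by (intro exI[of _ "\<lambda>b. k * c b"]) (simp add: sum_distrib_left mult.assoc)
qed

lemma spanned_base: "finite B \<Longrightarrow> b \<in> B \<Longrightarrow> spanned B b"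
  unfolding spanned_def
  by (intro exI[of _ "\<lambda>b'. if b' = b then 1 else 0"]) (simp add: if_distrib[of "\<lambda>x. x * _"] sum.delta cong: if_cong)

lemma spanned_sum: "(\<And>i. i \<in> A \<Longrightarrow> spanned B (f i)) \<Longrightarrow> spanned B (\<lambda>z. \<Sum>i\<in>A. f i z)"
proof (induction A rule: infinite_finite_induct)
  case (insert x F) then show ?case by (simp add: spanned_add)
qed (auto simp: spanned_def intro!: exI[of _ "\<lambda>_. 0"])

text \<open>Every exponent is bounded separately. The resulting box contains all monomials of total
  degree at most \<open>m\<close> and is counted by a plain power.\<close>

definition monomials :: "'p set \<Rightarrow> nat \<Rightarrow> (('p \<Rightarrow> complex) \<Rightarrow> complex) set" where
  "monomials V m = (\<lambda>e z. \<Prod>v\<in>V. z v ^ e v) ` PiE V (\<lambda>_. {..m})"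

lemma finite_monomials: "finite V \<Longrightarrow> finite (monomials V m)"
  by (auto simp: monomials_def intro!: finite_PiE)

lemma card_monomials: "finite V \<Longrightarrow> card (monomials V m) \<le> Suc m ^ card V"
  unfolding monomials_def
  by (rule order_trans[OF card_image_le]) (auto intro!: finite_PiE simp: card_PiE)

lemma spanned_monomials:
  assumes "finite V" "polyfn V m f"
  shows "spanned (monomials V m) f"
  using assms(2)
proof (induction rule: polyfn.induct)
  case (polyfn_const m c)
  have "(\<lambda>z. \<Prod>v\<in>V. z v ^ (\<lambda>v\<in>V. 0) v) \<in> monomials V m"
    unfolding monomials_def by (rule imageI) auto
  from spanned_scale[OF spanned_base[OF finite_monomials[OF assms(1)] this], of c]
  show ?case by simp
next
  case (polyfn_add m f g) then show ?case by (simp add: spanned_add)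
next
  case (polyfn_var_times p m f)
  then obtain c where c: "\<forall>z. f z = (\<Sum>b\<in>monomials V m. c b * b z)" by (auto simp: spanned_def)
  have *: "(\<lambda>z. z p * b z) \<in> monomials V (Suc m)" if "b \<in> monomials V m" for b
  proof -
    from that obtain e where e: "e \<in> PiE V (\<lambda>_. {..m})" "b = (\<lambda>z. \<Prod>v\<in>V. z v ^ e v)"
      by (auto simp: monomials_def)
    define e' where "e' = e(p := Suc (e p))"
    have "e' \<in> PiE V (\<lambda>_. {..Suc m})" using e polyfn_var_times.hyps
      by (auto simp: e'_def PiE_iff extensional_def)
    moreover have "z p * b z = (\<Prod>v\<in>V. z v ^ e' v)" for z
      using polyfn_var_times.hyps assms(1)
      by (simp add: e(2) e'_def prod.remove[of V p] mult.assoc) 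
    ultimately show ?thesis unfolding monomials_def by (auto intro!: image_eqI[of _ _ e'])
  qed
  have "spanned (monomials V (Suc m)) (\<lambda>z. \<Sum>b\<in>monomials V m. c b * (z p * b z))"
    using * by (intro spanned_sum spanned_scale spanned_base finite_monomials assms) auto
  then show ?case using c by (simp add: sum_distrib_left mult.left_commute)
qed

section \<open>Rational functions on a set\<close>

text \<open>\<open>f\<close> is the quotient of \<open>a\<close> by \<open>q\<close> on
  \<open>\<Omega>\<close> only; elsewhere it is arbitrary. No structure is asked of
  \<open>\<Omega>\<close>, so it can be a set cut out by the degeneracy conditions.\<close>

definition rational_on :: "'p set \<Rightarrow> ('p \<Rightarrow> complex) set \<Rightarrow> (('p \<Rightarrow> complex) \<Rightarrow> complex) \<Rightarrow> bool" where
  "rational_on V \<Omega> f \<longleftrightarrow> (\<exists>q a. polynomial_fn V q \<and> polynomial_fn V a \<and> (\<forall>z\<in>\<Omega>. q z \<noteq> 0 \<and> q z * f z = a z))"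

lemma rational_on_poly: "polynomial_fn V f \<Longrightarrow> rational_on V \<Omega> f"
  unfolding rational_on_def by (intro exI[of _ "\<lambda>_. 1"] exI[of _ f]) auto

lemma rational_on_var: "p \<in> V \<Longrightarrow> rational_on V \<Omega> (\<lambda>z. z p)"
  by (auto intro: rational_on_poly)

lemma rational_on_const: "rational_on V \<Omega> (\<lambda>z. c)"
  by (auto intro: rational_on_poly)

lemma rational_on_cong: "(\<And>z. z \<in> \<Omega> \<Longrightarrow> f z = g z) \<Longrightarrow> rational_on V \<Omega> f \<longleftrightarrow> rational_on V \<Omega> g"
  by (auto simp: rational_on_def)

lemma rational_on_add:
  assumes "rational_on V \<Omega> f" "rational_on V \<Omega> g" shows "rational_on V \<Omega> (\<lambda>z. f z + g z)"
proof -
  obtain q a q' a' where *: "polynomial_fn V q" "polynomial_fn V a" "\<forall>z\<in>\<Omega>. q z \<noteq> 0 \<and> q z * f z = a z"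
    "polynomial_fn V q'" "polynomial_fn V a'" "\<forall>z\<in>\<Omega>. q' z \<noteq> 0 \<and> q' z * g z = a' z"
    using assms by (auto simp: rational_on_def)
  have "(q z * q' z) * (f z + g z) = a z * q' z + q z * a' z" if "z \<in> \<Omega>" for z
    using * that by (auto simp: algebra_simps)
  then show ?thesis unfolding rational_on_def using *
    by (intro exI[of _ "\<lambda>z. q z * q' z"] exI[of _ "\<lambda>z. a z * q' z + q z * a' z"]) auto
qed

lemma rational_on_mult:
  assumes "rational_on V \<Omega> f" "rational_on V \<Omega> g" shows "rational_on V \<Omega> (\<lambda>z. f z * g z)"
proof -
  obtain q a q' a' where *: "polynomial_fn V q" "polynomial_fn V a" "\<forall>z\<in>\<Omega>. q z \<noteq> 0 \<and> q z * f z = a z"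
    "polynomial_fn V q'" "polynomial_fn V a'" "\<forall>z\<in>\<Omega>. q' z \<noteq> 0 \<and> q' z * g z = a' z"
    using assms by (auto simp: rational_on_def)
  have "(q z * q' z) * (f z * g z) = a z * a' z" if "z \<in> \<Omega>" for z
    using * that by (metis mult.assoc mult.left_commute)
  then show ?thesis unfolding rational_on_def using *
    by (intro exI[of _ "\<lambda>z. q z * q' z"] exI[of _ "\<lambda>z. a z * a' z"]) auto
qed

lemma rational_on_divide:
  assumes "rational_on V \<Omega> f" "rational_on V \<Omega> g" "\<And>z. z \<in> \<Omega> \<Longrightarrow> g z \<noteq> 0"
  shows "rational_on V \<Omega> (\<lambda>z. f z / g z)"
proof -
  obtain q a q' a' where *: "polynomial_fn V q" "polynomial_fn V a" "\<forall>z\<in>\<Omega>. q z \<noteq> 0 \<and> q z * f z = a z"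
    "polynomial_fn V q'" "polynomial_fn V a'" "\<forall>z\<in>\<Omega>. q' z \<noteq> 0 \<and> q' z * g z = a' z"
    using assms by (auto simp: rational_on_def)
  have "q z * a' z \<noteq> 0 \<and> (q z * a' z) * (f z / g z) = a z * q' z" if "z \<in> \<Omega>" for z
  proof -
    have "a z = q z * f z" "a' z = q' z * g z" "q z \<noteq> 0" "q' z \<noteq> 0" "g z \<noteq> 0" using * that assms(3) by auto
    then show ?thesis by simp
  qed
  then show ?thesis unfolding rational_on_def using *
    by (intro exI[of _ "\<lambda>z. q z * a' z"] exI[of _ "\<lambda>z. a z * q' z"]) auto
qed

lemma rational_on_sum:
  "(\<And>i. i \<in> A \<Longrightarrow> rational_on V \<Omega> (f i)) \<Longrightarrow> rational_on V \<Omega> (\<lambda>z. \<Sum>i\<in>A. f i z)"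
  by (induction A rule: infinite_finite_induct) (auto intro: rational_on_const rational_on_add)

lemma rational_on_prod:
  "(\<And>i. i \<in> A \<Longrightarrow> rational_on V \<Omega> (f i)) \<Longrightarrow> rational_on V \<Omega> (\<lambda>z. \<Prod>i\<in>A. f i z)"
  by (induction A rule: infinite_finite_induct) (auto intro: rational_on_const rational_on_mult)

text \<open>With one denominator and one degree bound for all coordinates, a polynomial expression
  in the \<open>\<phi> i\<close> is cleared by a single power of \<open>q\<close>.\<close>

lemma rational_on_common_denominator:
  assumes "finite I" "\<And>i. i \<in> I \<Longrightarrow> rational_on V \<Omega> (\<phi> i)"
  shows "\<exists>q a m. polyfn V m q \<and> (\<forall>i\<in>I. polyfn V m (a i)) \<and> (\<forall>z\<in>\<Omega>. q z \<noteq> 0 \<and> (\<forall>i\<in>I. q z * \<phi> i z = a i z))"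
  using assms
proof (induction I rule: finite_induct)
  case empty
  show ?case by (rule exI[of _ "\<lambda>_. 1"]) (auto intro: polyfn_const)
next
  case (insert j I)
  then obtain q a m where 1: "polyfn V m q" "\<forall>i\<in>I. polyfn V m (a i)"
    "\<forall>z\<in>\<Omega>. q z \<noteq> 0 \<and> (\<forall>i\<in>I. q z * \<phi> i z = a i z)" by blast
  from insert.prems[of j] obtain q' a' k k' where 2: "polyfn V k q'" "polyfn V k' a'" "\<forall>z\<in>\<Omega>. q' z \<noteq> 0 \<and> q' z * \<phi> j z = a' z"
    by (auto simp: rational_on_def polynomial_fn_def)
  define M where "M = m + k + k'"
  have M: "polyfn V M q" "\<forall>i\<in>I. polyfn V M (a i)" "polyfn V M q'" "polyfn V M a'"
    using 1 2 by (auto simp: M_def intro: polyfn_mono)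
  define b where "b i = (if i = j then (\<lambda>z. q z * a' z) else (\<lambda>z. q' z * a i z))" for i
  have "polyfn V (M+M) (\<lambda>z. q z * q' z)" "\<forall>i\<in>insert j I. polyfn V (M+M) (b i)"
    using M insert.hyps by (auto simp: b_def intro!: polyfn_mult)
  moreover have "\<forall>z\<in>\<Omega>. q z * q' z \<noteq> 0 \<and> (\<forall>i\<in>insert j I. (q z * q' z) * \<phi> i z = b i z)"
    using 1 2 insert.hyps by (auto simp: b_def mult.assoc mult.left_commute)
  ultimately show ?case by blast
qed

text \<open>The Lagrange basis polynomial of the grid point \<open>g\<close>, left unnormalised
  since only nonvanishing at \<open>g\<close> matters.\<close>

definition lagrange :: "'i set \<Rightarrow> nat \<Rightarrow> ('i \<Rightarrow> nat) \<Rightarrow> ('i \<Rightarrow> complex) \<Rightarrow> complex" where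
  "lagrange I s g x = (\<Prod>i\<in>I. \<Prod>m\<in>{..s} - {g i}. x i - of_nat m)"

lemma lagrange_eq_0:
  assumes "finite I" "g \<in> PiE I (\<lambda>_. {..s})" "h \<in> PiE I (\<lambda>_. {..s})" "g \<noteq> h"
  shows "lagrange I s g (\<lambda>i. of_nat (h i)) = 0"
proof -
  obtain i where "i \<in> I" "g i \<noteq> h i" using assms by (meson PiE_ext)
  then show ?thesis unfolding lagrange_def using assms
    by (auto intro!: prod_zero bexI[of _ i] bexI[of _ "h i"])
qed

lemma lagrange_neq_0:
  assumes "finite I" shows "lagrange I s g (\<lambda>i. of_nat (g i)) \<noteq> 0"
  using assms by (auto simp: lagrange_def)

lemma polynomial_fn_lagrange: "polynomial_fn I (lagrange I s g)"
proof -
  have "polynomial_fn I (\<lambda>x. x i - of_nat m)" if "i \<in> I" for i m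
    using polynomial_fn_add[OF polynomial_fn_var[OF that] polynomial_fn_const[of I "- of_nat m"]] by simp
  then have "polynomial_fn I (\<lambda>x. \<Prod>i\<in>I. \<Prod>m\<in>{..s} - {g i}. x i - of_nat m)"
    by (intro polynomial_fn_prod)
  then show ?thesis by (simp add: lagrange_def[abs_def])
qed

text \<open>The \<open>(s+1)^|I|\<close> Lagrange polynomials of the grid \<open>{0..s}^I\<close> outnumber, for large \<open>s\<close>, the
  monomials needed to express their composites with \<open>\<phi>\<close>, so some combination of them vanishes
  along \<open>\<phi>\<close>; it is nonzero because they are dual to the grid points.\<close>

theorem annihilating_polynomial:
  fixes V :: "'p set" and I :: "'i set"
  assumes "finite V" "finite I" "card V < card I"
    and rat: "\<And>i. i \<in> I \<Longrightarrow> rational_on V \<Omega> (\<phi> i)"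
  shows "\<exists>P. polynomial_fn I P \<and> (\<exists>x. P x \<noteq> 0) \<and> (\<forall>z\<in>\<Omega>. P (\<lambda>i. \<phi> i z) = 0)"
proof -
  obtain q a \<delta> where q: "polyfn V \<delta> q" and a: "\<And>i. i \<in> I \<Longrightarrow> polyfn V \<delta> (a i)"
    and qa: "\<And>z. z \<in> \<Omega> \<Longrightarrow> q z \<noteq> 0" "\<And>z i. z \<in> \<Omega> \<Longrightarrow> i \<in> I \<Longrightarrow> q z * \<phi> i z = a i z"
    using rational_on_common_denominator[OF assms(2), of V \<Omega> \<phi>] rat by metis
  define N where "N = card I"
  define M where "M = card V"
  \<comment> \<open>With \<open>D = N * s * \<delta>\<close> one has
    \<open>D + 1 \<le> (N * \<delta> + 1) * (s + 1)\<close>. This \<open>s\<close> absorbs the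
    \<open>M\<close>-th power of the constant factor, and \<open>M < N\<close> leaves one spare
    factor \<open>s + 1\<close> to pay for it.\<close>
  define s where "s = (N * \<delta> + 1) ^ M"
  define G where "G = PiE I (\<lambda>_. {..s})"
  have finG: "finite G" using assms by (auto simp: G_def intro: finite_PiE)
  have cardG: "card G = Suc s ^ N" using assms by (simp add: G_def card_PiE N_def)
  define D where "D = N * (s * \<delta>)"
  have card_lt: "card (monomials V D) < card G"
  proof -
    have "Suc D \<le> (N * \<delta> + 1) * Suc s" by (simp add: D_def algebra_simps)
    then have "Suc D ^ M \<le> ((N * \<delta> + 1) * Suc s) ^ M" by (rule power_mono) simp
    also have "\<dots> = (N * \<delta> + 1) ^ M * Suc s ^ M" by (rule power_mult_distrib)
    also have "\<dots> = s * Suc s ^ M" unfolding s_def ..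
    also have "\<dots> < Suc s * Suc s ^ M" by simp
    also have "\<dots> = Suc s ^ Suc M" by simp
    also have "\<dots> \<le> Suc s ^ N" using assms(3) by (intro power_increasing) (auto simp: M_def N_def)
    finally show ?thesis using card_monomials[OF assms(1), of D] cardG by (simp add: M_def)
  qed
  \<comment> \<open>\<open>B g\<close> is the Lagrange polynomial of \<open>g\<close> composed with
    \<open>\<phi>\<close> and multiplied by \<open>q ^ (s * N)\<close>: a genuine polynomial in the
    parameters.\<close>
  define B where "B g z = (\<Prod>i\<in>I. \<Prod>m\<in>{..s} - {g i}. a i z - of_nat m * q z)" for g z
  have polyB: "polyfn V D (B g)" if "g \<in> G" for g
  proof -
    have "polyfn V \<delta> (\<lambda>z. a i z + (- of_nat m) * q z)" if "i \<in> I" for i m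
      using polyfn_add[OF a[OF that] polyfn_scale[OF q, of "- of_nat m"]] .
    then have "polyfn V \<delta> (\<lambda>z. a i z - of_nat m * q z)" if "i \<in> I" for i m using that by simp
    then have "polyfn V (card ({..s} - {g i}) * \<delta>) (\<lambda>z. \<Prod>m\<in>{..s} - {g i}. a i z - of_nat m * q z)"
      if "i \<in> I" for i using that by (intro polyfn_prod) auto
    moreover have "card ({..s} - {g i}) = s" if "i \<in> I" for i
      using \<open>g \<in> G\<close> that by (auto simp: G_def PiE_iff)
    ultimately have "polyfn V (card I * (s * \<delta>)) (\<lambda>z. \<Prod>i\<in>I. \<Prod>m\<in>{..s} - {g i}. a i z - of_nat m * q z)"
      using assms(2) by (intro polyfn_prod) auto
    then show ?thesis by (simp add: B_def[abs_def] D_def N_def)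
  qed
  have "\<forall>g\<in>G. \<exists>c. \<forall>z. B g z = (\<Sum>b\<in>monomials V D. c b * b z)"
    using spanned_monomials[OF assms(1) polyB] unfolding spanned_def by blast
  then obtain C where C: "\<And>g z. g \<in> G \<Longrightarrow> B g z = (\<Sum>b\<in>monomials V D. C g b * b z)" by metis
  obtain c where c: "\<exists>g\<in>G. c g \<noteq> 0" "\<forall>b\<in>monomials V D. (\<Sum>g\<in>G. C g b * c g) = 0"
    using wide_matrix_kernel[OF finite_monomials[OF assms(1)] finG card_lt, of "\<lambda>b g. C g b"] by blast
  have B0: "(\<Sum>g\<in>G. c g * B g z) = 0" for z
  proof -
    have "(\<Sum>g\<in>G. c g * B g z) = (\<Sum>g\<in>G. \<Sum>b\<in>monomials V D. (C g b * c g) * b z)"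
      by (intro sum.cong refl) (simp add: C sum_distrib_left mult.commute mult.left_commute)
    also have "\<dots> = (\<Sum>b\<in>monomials V D. (\<Sum>g\<in>G. C g b * c g) * b z)"
      by (subst sum.swap) (simp add: sum_distrib_right)
    finally show ?thesis using c(2) by simp
  qed
  define P where "P x = (\<Sum>g\<in>G. c g * lagrange I s g x)" for x
  have "polynomial_fn I P"
    unfolding P_def[abs_def] by (intro polynomial_fn_sum polynomial_fn_mult polynomial_fn_lagrange polynomial_fn_const)
  moreover have "\<exists>x. P x \<noteq> 0"
  proof -
    obtain h where h: "h \<in> G" "c h \<noteq> 0" using c(1) by blast
    have "P (\<lambda>i. of_nat (h i)) = (\<Sum>g\<in>G. if g = h then c h * lagrange I s h (\<lambda>i. of_nat (h i)) else 0)"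
      unfolding P_def using lagrange_eq_0[OF assms(2)] h by (intro sum.cong) (auto simp: G_def)
    also have "\<dots> \<noteq> 0" using h finG lagrange_neq_0[OF assms(2)] by simp
    finally show ?thesis by blast
  qed
  moreover have "P (\<lambda>i. \<phi> i z) = 0" if z: "z \<in> \<Omega>" for z
  proof -
    have L: "q z ^ (s * N) * lagrange I s g (\<lambda>i. \<phi> i z) = B g z" if g: "g \<in> G" for g
    proof -
      have "B g z = (\<Prod>i\<in>I. \<Prod>m\<in>{..s} - {g i}. q z * (\<phi> i z - of_nat m))"
        unfolding B_def by (intro prod.cong refl) (simp add: qa(2)[OF z, symmetric] algebra_simps)
      also have "\<dots> = (\<Prod>i\<in>I. q z ^ s * (\<Prod>m\<in>{..s} - {g i}. \<phi> i z - of_nat m))"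
        using g by (intro prod.cong refl) (auto simp: prod.distrib G_def PiE_iff)
      also have "\<dots> = (q z ^ s) ^ N * lagrange I s g (\<lambda>i. \<phi> i z)"
        by (simp add: prod.distrib lagrange_def N_def)
      finally show ?thesis by (simp add: power_mult)
    qed
    have "q z ^ (s * N) * P (\<lambda>i. \<phi> i z) = (\<Sum>g\<in>G. c g * B g z)"
      unfolding P_def sum_distrib_left by (intro sum.cong refl) (simp add: L[symmetric])
    then show ?thesis using B0 qa(1)[OF z] by simp
  qed
  ultimately show ?thesis by blast
qed

subsection \<open>Restriction of polynomials to lines\<close>

lemma polynomial_fn_line:
  assumes "polynomial_fn V f"
  shows "\<exists>p. \<forall>t. f (\<lambda>i. x i + t * y i) = poly p t"
proof -
  obtain m where "polyfn V m f" using assms by (auto simp: polynomial_fn_def)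
  then show ?thesis
  proof (induction rule: polyfn.induct)
    case (polyfn_const m c)
    then show ?case by (intro exI[of _ "[:c:]"]) simp
  next
    case (polyfn_add m f g)
    then obtain p q where "\<forall>t. f (\<lambda>i. x i + t * y i) = poly p t" "\<forall>t. g (\<lambda>i. x i + t * y i) = poly q t" by blast
    then show ?case by (intro exI[of _ "p + q"]) simp
  next
    case (polyfn_var_times i m f)
    then obtain p where "\<forall>t. f (\<lambda>i. x i + t * y i) = poly p t" by blast
    then show ?case by (intro exI[of _ "[:x i, y i:] * p"]) (simp add: algebra_simps)
  qed
qed

lemma finite_zeros_line:
  assumes "polynomial_fn V f" "f (\<lambda>i. x i + t0 * y i) \<noteq> 0"
  shows "finite {t. f (\<lambda>i. x i + t * y i) = 0}"
proof -
  obtain p where p: "\<forall>t. f (\<lambda>i. x i + t * y i) = poly p t" using polynomial_fn_line[OF assms(1)] by blast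
  then have "p \<noteq> 0" using assms(2) by auto
  then show ?thesis using p poly_roots_finite[of p] by simp
qed

lemma infinite_of_real_image: "infinite A \<Longrightarrow> infinite (complex_of_real ` A)"
  by (simp add: finite_image_iff inj_on_def)

text \<open>On the line joining \<open>x\<close> and \<open>y\<close> neither function vanishes
  identically, so each has finitely many zeros there.\<close>

lemma polynomial_fn_no_zero_divisors:
  assumes "polynomial_fn V f" "polynomial_fn V g" "f x \<noteq> 0" "g y \<noteq> 0"
  shows "\<exists>z. f z * g z \<noteq> 0"
proof -
  define l where "l t = (\<lambda>i. x i + t * (y i - x i))" for t
  have "finite {t. f (l t) = 0}" unfolding l_def
    by (rule finite_zeros_line[OF assms(1), of _ 0]) (use assms in simp)
  moreover have "finite {t. g (l t) = 0}" unfolding l_def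
    by (rule finite_zeros_line[OF assms(2), of _ 1]) (use assms in simp)
  ultimately have "finite ({t. f (l t) = 0} \<union> {t. g (l t) = 0})" by blast
  then obtain t where "t \<notin> {t. f (l t) = 0} \<union> {t. g (l t) = 0}"
    using ex_new_if_finite infinite_UNIV_char_0 by blast
  then show ?thesis by (intro exI[of _ "l t"]) auto
qed

lemma common_annihilating_polynomial:
  assumes "finite A" "\<And>a. a \<in> A \<Longrightarrow> \<exists>P. polynomial_fn I P \<and> (\<exists>x. P x \<noteq> 0) \<and> (\<forall>z\<in>D a. P z = 0)"
  shows "\<exists>P. polynomial_fn I P \<and> (\<exists>x. P x \<noteq> 0) \<and> (\<forall>z\<in>\<Union>(D ` A). P z = 0)"
  using assms
proof (induction A rule: finite_induct)
  case empty
  show ?case by (intro exI[of _ "\<lambda>_. 1"]) auto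
next
  case (insert a A)
  then obtain P where P: "polynomial_fn I P" "\<exists>x. P x \<noteq> 0" "\<forall>z\<in>\<Union>(D ` A). P z = 0" by blast
  obtain Q where Q: "polynomial_fn I Q" "\<exists>x. Q x \<noteq> 0" "\<forall>z\<in>D a. Q z = 0" using insert.prems[of a] by blast
  have "\<exists>x. P x * Q x \<noteq> 0" using polynomial_fn_no_zero_divisors[OF P(1) Q(1)] P(2) Q(2) by blast
  then show ?case using P Q by (intro exI[of _ "\<lambda>x. P x * Q x"]) auto
qed

text \<open>The coordinates are made real one after the other; at each stage a nonzero polynomial in
  one variable cannot vanish on the whole real line.\<close>

lemma polynomial_fn_nonzero_real:
  assumes "finite V" "polynomial_fn V f" "f z \<noteq> 0"
  shows "\<exists>x. f (\<lambda>i. complex_of_real (x i)) \<noteq> 0"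
proof -
  have "\<exists>x. f (\<lambda>i. if i \<in> A then complex_of_real (x i) else z i) \<noteq> 0" if "finite A" for A
    using that
  proof (induction A rule: finite_induct)
    case empty
    then show ?case using assms(3) by simp
  next
    case (insert j A)
    then obtain x where x: "f (\<lambda>i. if i \<in> A then complex_of_real (x i) else z i) \<noteq> 0" by blast
    define w where "w = (\<lambda>i. if i \<in> A then complex_of_real (x i) else z i)"
    define u where "u = w(j := 0)"
    define e where "e = (\<lambda>i. if i = j then 1::complex else 0)"
    have "(\<lambda>i. u i + z j * e i) = w" using insert.hyps by (auto simp: u_def e_def w_def)
    then have "finite {t. f (\<lambda>i. u i + t * e i) = 0}"
      using x by (intro finite_zeros_line[OF assms(2), of _ "z j"]) (simp add: w_def)
    then have "\<not> range complex_of_real \<subseteq> {t. f (\<lambda>i. u i + t * e i) = 0}"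
      using infinite_of_real_image[of UNIV] finite_subset infinite_UNIV_char_0 by metis
    then obtain t where t: "f (\<lambda>i. u i + complex_of_real t * e i) \<noteq> 0" by blast
    have "(\<lambda>i. u i + complex_of_real t * e i) = (\<lambda>i. if i \<in> insert j A then complex_of_real ((x(j := t)) i) else z i)"
      using insert.hyps by (auto simp: u_def e_def w_def)
    then show ?case using t by (intro exI[of _ "x(j := t)"]) simp
  qed
  from this[OF assms(1)] obtain x where "f (\<lambda>i. if i \<in> V then complex_of_real (x i) else z i) \<noteq> 0" by blast
  moreover obtain m where "polyfn V m f" using assms by (auto simp: polynomial_fn_def)
  ultimately show ?thesis using polyfn_cong_supp[of V m f "\<lambda>i. if i \<in> V then complex_of_real (x i) else z i" "\<lambda>i. complex_of_real (x i)"] by auto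
qed

subsection \<open>Spaces of finitely supported functions\<close>

definition supported :: "'i set \<Rightarrow> ('i \<Rightarrow> 'a::zero) set" where
  "supported I = {z. \<forall>p. p \<notin> I \<longrightarrow> z p = 0}"

text \<open>A homeomorphism with \<open>euclid k\<close> whose two directions are restrictions of
  maps continuous on the ambient function spaces, so that they compose without subspace
  topologies.\<close>

definition euclidean_coords :: "nat \<Rightarrow> 'b::topological_space set \<Rightarrow> bool" where
  "euclidean_coords k S \<longleftrightarrow> (\<exists>enc dec. continuous_on UNIV enc \<and> continuous_on UNIV dec \<and>
     (\<forall>z\<in>S. enc z \<in> euclid k \<and> dec (enc z) = z) \<and> (\<forall>u\<in>euclid k. dec u \<in> S \<and> enc (dec u) = u))"

lemma continuous_on_coordinate: "continuous_on A (\<lambda>z. z p :: 'a::topological_space)"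
  by (rule continuous_on_subset[OF continuous_on_product_coordinates]) simp

lemma euclidean_coords_real:
  assumes "finite (I :: 'i set)"
  shows "euclidean_coords (card I) (supported I :: ('i \<Rightarrow> real) set)"
proof -
  obtain b where b: "bij_betw b {..<card I} I"
    using assms ex_bij_betw_nat_finite lessThan_atLeast0 by metis
  define b' where "b' = the_inv_into {..<card I} b"
  have bb: "b' (b m) = m" if "m < card I" for m 
    using that b by (auto simp: b'_def bij_betw_def the_inv_into_f_f)
  have bI: "b m \<in> I" if "m < card I" for m using that b by (auto simp: bij_betw_def)
  have b'b: "b (b' i) = i \<and> b' i < card I" if "i \<in> I" for i
  proof -
    have "i \<in> b ` {..<card I}" using that b by (simp add: bij_betw_def)
    then obtain m where "m < card I" "i = b m" by blast
    then show ?thesis using bb by simp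
  qed
  define enc :: "('i \<Rightarrow> real) \<Rightarrow> nat \<Rightarrow> real" where "enc z m = (if m < card I then z (b m) else 0)" for z m
  define dec :: "(nat \<Rightarrow> real) \<Rightarrow> 'i \<Rightarrow> real" where "dec u i = (if i \<in> I then u (b' i) else 0)" for u i
  have "continuous_on UNIV (\<lambda>z. enc z m)" for m
    by (cases "m < card I") (auto simp: enc_def intro!: continuous_on_coordinate continuous_intros)
  then have 1: "continuous_on UNIV enc" by (rule continuous_on_coordinatewise_then_product)
  have "continuous_on UNIV (\<lambda>u. dec u i)" for i
    by (cases "i \<in> I") (auto simp: dec_def intro!: continuous_on_coordinate continuous_intros)
  then have 2: "continuous_on UNIV dec" by (rule continuous_on_coordinatewise_then_product)
  have 3: "enc z \<in> euclid (card I) \<and> dec (enc z) = z" if "z \<in> supported I" for z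
    using that b'b by (auto simp: enc_def dec_def euclid_def supported_def fun_eq_iff)
  have 4: "dec u \<in> supported I \<and> enc (dec u) = u" if "u \<in> euclid (card I)" for u
    using that bb bI by (auto simp: enc_def dec_def euclid_def supported_def fun_eq_iff)
  show ?thesis unfolding euclidean_coords_def using 1 2 3 4 by blast
qed

lemma euclidean_coords_complex:
  assumes "finite (I :: 'i set)"
  shows "euclidean_coords (2 * card I) (supported I :: ('i \<Rightarrow> complex) set)"
proof -
  define J where "J = I \<times> (UNIV :: bool set)"
  have card: "card J = 2 * card I" by (simp add: J_def card_cartesian_product)
  have "finite J" using assms by (simp add: J_def)
  from euclidean_coords_real[OF this] obtain enc :: "('i \<times> bool \<Rightarrow> real) \<Rightarrow> nat \<Rightarrow> real" and dec where
    *: "continuous_on UNIV enc" "continuous_on UNIV dec"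
     "\<forall>z\<in>supported J. enc z \<in> euclid (card J) \<and> dec (enc z) = z"
     "\<forall>u\<in>euclid (card J). dec u \<in> supported J \<and> enc (dec u) = u" by (auto simp: euclidean_coords_def)
  define s :: "('i \<Rightarrow> complex) \<Rightarrow> ('i \<times> bool \<Rightarrow> real)" where "s z = (\<lambda>(i, c). if c then Re (z i) else Im (z i))" for z
  define r :: "('i \<times> bool \<Rightarrow> real) \<Rightarrow> ('i \<Rightarrow> complex)" where "r w = (\<lambda>i. Complex (w (i, True)) (w (i, False)))" for w
  have "continuous_on UNIV (\<lambda>z. s z p)" for p
    by (cases p; cases "snd p") (auto simp: s_def intro!: continuous_intros continuous_on_coordinate)
  then have 1: "continuous_on UNIV s" by (rule continuous_on_coordinatewise_then_product)
  have "continuous_on UNIV (\<lambda>z. r z p)" for p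
    unfolding r_def Complex_eq by (auto intro!: continuous_intros continuous_on_coordinate)
  then have 2: "continuous_on UNIV r" by (rule continuous_on_coordinatewise_then_product)
  have rs: "r (s z) = z" "s (r w) = w" for z w by (auto simp: r_def s_def fun_eq_iff complex_eq_iff)
  have sr: "s z \<in> supported J" if "z \<in> supported I" for z using that by (auto simp: s_def supported_def J_def)
  have rr: "r w \<in> supported I" if "w \<in> supported J" for w using that by (auto simp: r_def supported_def J_def complex_eq_iff)
  have "continuous_on UNIV (enc \<circ> s)"
    using 1 continuous_on_subset[OF *(1), of "range s"] by (intro continuous_on_compose) auto
  moreover have "continuous_on UNIV (r \<circ> dec)"
    using *(2) continuous_on_subset[OF 2, of "range dec"] by (intro continuous_on_compose) auto
  moreover have "\<forall>z\<in>supported I. (enc \<circ> s) z \<in> euclid (card J) \<and> (r \<circ> dec) ((enc \<circ> s) z) = z"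
    using *(3) sr rs(1) by simp
  moreover have "\<forall>u\<in>euclid (card J). (r \<circ> dec) u \<in> supported I \<and> (enc \<circ> s) ((r \<circ> dec) u) = u"
    using *(4) rr rs(2) by simp
  ultimately show ?thesis unfolding euclidean_coords_def card[symmetric] by blast
qed

section \<open>Invariance of domain in finitely supported coordinates\<close>

lemma top_of_set_euclid: "top_of_set (euclid k) = Euclidean_space k"
  by (simp add: Euclidean_space_def euclid_def euclidean_product_topology)

lemma euclid_mono: "k \<le> m \<Longrightarrow> euclid k \<subseteq> euclid m"
  by (auto simp: euclid_def)

lemma invariance_of_domain_euclid:
  assumes "k \<le> m" "openin (top_of_set (euclid m)) U" "continuous_on U f" "inj_on f U" "f ` U \<subseteq> euclid k"
  shows "openin (top_of_set (euclid k)) (f ` U)"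
proof -
  have U: "U \<subseteq> euclid m" using assms(2) openin_imp_subset by blast
  have "continuous_map (subtopology (Euclidean_space m) U) (Euclidean_space k) f"
    using assms U unfolding top_of_set_euclid[symmetric]
    by (auto simp: subtopology_subtopology inf.absorb2 continuous_map_in_subtopology)
  from invariance_of_domain_Euclidean_space_gen[OF assms(1) _ this] assms
  show ?thesis by (simp add: top_of_set_euclid)
qed

text \<open>The image would be open in \<open>euclid m\<close>, yet coordinate \<open>k\<close>
  vanishes on all of it; moving that coordinate slightly leaves the image.\<close>

lemma no_injection_into_lower_euclid:
  assumes "k < m" "openin (top_of_set (euclid m)) U" "continuous_on U f" "inj_on f U" "f ` U \<subseteq> euclid k"
  shows "U = {}"
proof (rule ccontr)
  assume "U \<noteq> {}"
  then obtain x where x: "x \<in> f ` U" by blast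
  have "openin (top_of_set (euclid m)) (f ` U)"
    using assms euclid_mono[of k m] by (intro invariance_of_domain_euclid[of m m]) auto
  then obtain W where W: "open W" "f ` U = euclid m \<inter> W" by (auto simp: openin_open)
  define l where "l t = x(k := t)" for t :: real
  have "continuous_on UNIV (\<lambda>t. l t i)" for i
    by (cases "i = k") (auto simp: l_def)
  then have "continuous_on UNIV l" by (rule continuous_on_coordinatewise_then_product)
  then have "open (l -` W)" using W(1) by (simp add: open_vimage)
  moreover have xk: "x \<in> euclid k" using x assms by auto
  then have "l 0 = x" by (auto simp: l_def euclid_def fun_eq_iff)
  then have "0 \<in> l -` W" using x W by auto
  ultimately obtain e where e: "e > 0" "ball 0 e \<subseteq> l -` W" by (meson open_contains_ball)
  then have "l (e/2) \<in> W" by (auto simp: subset_eq)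
  moreover have "l (e/2) \<in> euclid m" using xk assms(1) by (auto simp: l_def euclid_def)
  ultimately have "l (e/2) \<in> euclid k" using W assms(5) by blast
  then show False using e by (auto simp: l_def euclid_def)
qed

text \<open>The source of every openness statement about sections with zeros: it asks for continuity
  and injectivity and for no derivative.\<close>

lemma invariance_of_domain_coords:
  assumes S: "euclidean_coords k S" and T: "euclidean_coords k T" and "open X"
    and F: "continuous_on (S \<inter> X) F" "inj_on F (S \<inter> X)" "F ` (S \<inter> X) \<subseteq> T"
  shows "\<exists>Y. open Y \<and> F ` (S \<inter> X) = T \<inter> Y"
proof -
  obtain enc dec where S: "continuous_on UNIV enc" "continuous_on UNIV dec"
    "\<And>z. z \<in> S \<Longrightarrow> enc z \<in> euclid k \<and> dec (enc z) = z" "\<And>u. u \<in> euclid k \<Longrightarrow> dec u \<in> S \<and> enc (dec u) = u"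
    using S by (auto simp: euclidean_coords_def)
  obtain enc' dec' where T: "continuous_on UNIV enc'" "continuous_on UNIV dec'"
    "\<And>z. z \<in> T \<Longrightarrow> enc' z \<in> euclid k \<and> dec' (enc' z) = z" "\<And>u. u \<in> euclid k \<Longrightarrow> dec' u \<in> T \<and> enc' (dec' u) = u"
    using T by (auto simp: euclidean_coords_def)
  define U where "U = euclid k \<inter> dec -` X"
  have U: "openin (top_of_set (euclid k)) U"
    unfolding U_def using open_vimage[OF \<open>open X\<close> S(2)] by (auto simp: openin_open)
  define f where "f u = enc' (F (dec u))" for u
  have dU: "dec ` U \<subseteq> S \<inter> X" using S by (auto simp: U_def)
  have "continuous_on U (F \<circ> dec)"
    by (intro continuous_on_compose continuous_on_subset[OF S(2)] continuous_on_subset[OF F(1) dU]) auto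
  from continuous_on_compose[OF this continuous_on_subset[OF T(1) subset_UNIV]]
  have "continuous_on U (enc' \<circ> (F \<circ> dec))" .
  then have cf: "continuous_on U f" by (simp add: f_def[abs_def] comp_def)
  have TU: "F (dec u) \<in> T" if "u \<in> U" for u using that dU F(3) by blast
  have "inj_on f U"
  proof (rule inj_onI)
    fix u v assume *: "u \<in> U" "v \<in> U" "f u = f v"
    then have "dec' (enc' (F (dec u))) = dec' (enc' (F (dec v)))" by (simp add: f_def)
    then have "F (dec u) = F (dec v)" using T(3) TU * by simp
    moreover have "dec u \<in> S \<inter> X" "dec v \<in> S \<inter> X" using * dU by blast+
    ultimately have "dec u = dec v" using F(2) by (simp add: inj_on_def)
    then have "enc (dec u) = enc (dec v)" by simp
    then show "u = v" using * S(4) unfolding U_def by simp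
  qed
  moreover have "f ` U \<subseteq> euclid k" using T(3) TU by (auto simp: f_def)
  ultimately have "openin (top_of_set (euclid k)) (f ` U)"
    by (intro invariance_of_domain_euclid[OF order_refl U cf])
  then obtain V where V: "open V" "f ` U = euclid k \<inter> V" by (auto simp: openin_open)
  have "F ` (S \<inter> X) = T \<inter> enc' -` V"
  proof (intro subset_antisym subsetI)
    fix y assume "y \<in> F ` (S \<inter> X)"
    then obtain z where z: "z \<in> S" "z \<in> X" "y = F z" by blast
    then have "enc z \<in> U" "f (enc z) = enc' y" using S by (auto simp: U_def f_def)
    then have "enc' y \<in> f ` U" by (metis imageI)
    then have "enc' y \<in> V" using V by simp
    moreover have "y \<in> T" using z F(3) by auto
    ultimately show "y \<in> T \<inter> enc' -` V" by simp
  next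
    fix y assume y: "y \<in> T \<inter> enc' -` V"
    then have "enc' y \<in> f ` U" using V T by auto
    then obtain u where u: "u \<in> U" "enc' y = enc' (F (dec u))" by (auto simp: f_def)
    then have "dec' (enc' y) = dec' (enc' (F (dec u)))" by simp
    moreover have "dec' (enc' y) = y" using y T(3) by simp
    moreover have "dec' (enc' (F (dec u))) = F (dec u)" using T(3) TU u(1) by simp
    ultimately have "y = F (dec u)" by simp
    then show "y \<in> F ` (S \<inter> X)" using u dU by blast
  qed
  then show ?thesis using open_vimage[OF V(1) T(1)] by blast
qed

section \<open>Upper bounds for cells and a criterion for their existence\<close>

lemma contains_cell_dim_le:
  assumes "contains_cell m S" "S \<subseteq> T" "euclidean_coords k T"
  shows "m \<le> k"
proof (rule ccontr)
  assume "\<not> m \<le> k"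
  obtain U g where U: "openin (top_of_set (euclid m)) U" "U \<noteq> {}" "continuous_on U g" "inj_on g U" "g ` U \<subseteq> S"
    using assms(1) by (auto simp: contains_cell_def)
  obtain enc dec where T: "continuous_on UNIV enc" "continuous_on UNIV dec"
    "\<And>z. z \<in> T \<Longrightarrow> enc z \<in> euclid k \<and> dec (enc z) = z"
    using assms(3) by (auto simp: euclidean_coords_def)
  have "continuous_on U (enc \<circ> g)" using U T by (intro continuous_on_compose) (auto intro: continuous_on_subset)
  moreover have "inj_on (enc \<circ> g) U"
  proof (rule comp_inj_on[OF U(4)])
    show "inj_on enc (g ` U)" using T(3) U(5) assms(2) by (intro inj_on_inverseI[of _ dec]) blast
  qed
  moreover have "(enc \<circ> g) ` U \<subseteq> euclid k" using U T assms(2) by auto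
  ultimately show False using no_injection_into_lower_euclid[of k m U "enc \<circ> g"] U \<open>\<not> m \<le> k\<close> by auto
qed

text \<open>By invariance of domain the image of a cell of full dimension is itself relatively open
  in \<open>T\<close>.\<close>

lemma contains_cell_top_dim:
  assumes "contains_cell k S" "S \<subseteq> T" "euclidean_coords k T"
  shows "\<exists>X. open X \<and> X \<inter> T \<noteq> {} \<and> X \<inter> T \<subseteq> S"
proof -
  obtain U g where U: "openin (top_of_set (euclid k)) U" "U \<noteq> {}" "continuous_on U g" "inj_on g U" "g ` U \<subseteq> S"
    using assms(1) by (auto simp: contains_cell_def)
  obtain X where X: "open X" "U = euclid k \<inter> X" using U(1) by (auto simp: openin_open)
  have "euclidean_coords k (euclid k)" unfolding euclidean_coords_def
    by (intro exI[of _ id]) auto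
  from invariance_of_domain_coords[OF this assms(3) X(1), of g] U(3-5) X(2) assms(2)
  obtain Y where "open Y" "g ` U = T \<inter> Y" by (metis subset_trans)
  moreover have "g ` U \<noteq> {}" using U(2) by simp
  ultimately show ?thesis using U(5) by (intro exI[of _ Y]) (simp add: Int_commute)
qed

lemma contains_cellI:
  assumes "euclidean_coords k T" "open X" "X \<inter> T \<noteq> {}" "continuous_on (X \<inter> T) g" "inj_on g (X \<inter> T)"
    "g ` (X \<inter> T) \<subseteq> S"
  shows "contains_cell k S"
proof -
  obtain enc dec where T: "continuous_on UNIV enc" "continuous_on UNIV dec"
    "\<And>z. z \<in> T \<Longrightarrow> enc z \<in> euclid k \<and> dec (enc z) = z" "\<And>u. u \<in> euclid k \<Longrightarrow> dec u \<in> T \<and> enc (dec u) = u"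
    using assms(1) by (auto simp: euclidean_coords_def)
  define U where "U = euclid k \<inter> dec -` X"
  have "openin (top_of_set (euclid k)) U"
    unfolding U_def using open_vimage[OF \<open>open X\<close> T(2)] by (auto simp: openin_open)
  moreover have "U \<noteq> {}" using assms(3) T(3) by (fastforce simp: U_def)
  moreover have dU: "dec ` U \<subseteq> X \<inter> T" using T by (auto simp: U_def)
  have "continuous_on U (g \<circ> dec)"
    by (intro continuous_on_compose continuous_on_subset[OF T(2)] continuous_on_subset[OF assms(4) dU]) auto
  moreover have "inj_on dec U" using T(4) by (metis IntD1 U_def inj_onI)
  then have "inj_on (g \<circ> dec) U" using assms(5) dU by (intro comp_inj_on) (auto intro: inj_on_subset)
  moreover have "(g \<circ> dec) ` U \<subseteq> S" using dU assms(6) by (auto simp: subset_eq)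
  ultimately show ?thesis unfolding contains_cell_def by blast
qed

subsection \<open>Cells in hypersurfaces\<close>

lemma continuous_on_split_comp:
  assumes "continuous_on UNIV (\<lambda>(z, t). q z t)" "continuous_on A f" "continuous_on A g"
  shows "continuous_on A (\<lambda>x. q (f x) (g x))"
proof -
  have "continuous_on A ((\<lambda>(z, t). q z t) \<circ> (\<lambda>x. (f x, g x)))"
    by (intro continuous_on_compose continuous_on_Pair assms continuous_on_subset[OF assms(1)]) auto
  then show ?thesis by (simp add: comp_def)
qed

lemma continuous_on_fun_upd:
  assumes "continuous_on A f" "continuous_on A g"
  shows "continuous_on A (\<lambda>x. (f x)(p := g x))"
proof (rule continuous_on_coordinatewise_then_product)
  fix i show "continuous_on A (\<lambda>x. ((f x)(p := g x)) i)"
    using assms by (cases "i = p") (auto intro: continuous_on_product_then_coordinatewise)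
qed

text \<open>\<open>q\<close> is the divided difference in the coordinate \<open>p\<close>; on the
  diagonal \<open>t = z p\<close> it is the partial derivative, of lower degree. The clause for
  \<open>m = 0\<close> is needed because \<open>m - 1\<close> is then no decrease.\<close>

lemma polyfn_partial_quotient:
  assumes "polyfn V m f"
  shows "\<exists>q. (\<forall>z t. f (z(p := t)) - f z = (t - z p) * q z t) \<and> continuous_on UNIV (\<lambda>(z, t). q z t) \<and>
    polyfn V (m - 1) (\<lambda>z. q z (z p)) \<and> (m = 0 \<longrightarrow> (\<forall>z t. q z t = 0))"
  using assms
proof (induction rule: polyfn.induct)
  case (polyfn_const m c)
  show ?case by (intro exI[of _ "\<lambda>_ _. 0"]) (auto intro: polyfn.polyfn_const)
next
  case (polyfn_add m f g)
  then obtain q r where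
    q: "\<forall>z t. f (z(p := t)) - f z = (t - z p) * q z t" "continuous_on UNIV (\<lambda>(z, t). q z t)"
    "polyfn V (m - 1) (\<lambda>z. q z (z p))" "m = 0 \<longrightarrow> (\<forall>z t. q z t = 0)" and
    r: "\<forall>z t. g (z(p := t)) - g z = (t - z p) * r z t" "continuous_on UNIV (\<lambda>(z, t). r z t)"
    "polyfn V (m - 1) (\<lambda>z. r z (z p))" "m = 0 \<longrightarrow> (\<forall>z t. r z t = 0)" by blast
  show ?case
  proof (intro exI[of _ "\<lambda>z t. q z t + r z t"] conjI)
    show "\<forall>z t. f (z(p := t)) + g (z(p := t)) - (f z + g z) = (t - z p) * (q z t + r z t)"
      using q(1) r(1) by (metis add_diff_add distrib_left)
    show "continuous_on UNIV (\<lambda>(z, t). q z t + r z t)"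
      using continuous_on_add[OF q(2) r(2)] by (simp add: case_prod_unfold)
  qed (use q r in \<open>auto intro: polyfn.polyfn_add\<close>)
next
  case (polyfn_var_times j m f)
  then obtain q where
    q: "\<forall>z t. f (z(p := t)) - f z = (t - z p) * q z t" "continuous_on UNIV (\<lambda>(z, t). q z t)"
    "polyfn V (m - 1) (\<lambda>z. q z (z p))" "m = 0 \<longrightarrow> (\<forall>z t. q z t = 0)" by blast
  have poly: "polyfn V m (\<lambda>z. z j * q z (z p))"
  proof (cases m)
    case 0 then show ?thesis using q(4) polyfn.polyfn_const[of V 0 0] by simp
  next
    case (Suc m') then show ?thesis using q(3) polyfn.polyfn_var_times[OF polyfn_var_times.hyps(1)] by simp
  qed
  have cf: "continuous_on UNIV f" using continuous_on_polyfn[OF polyfn_var_times.hyps(2)] .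
  have c1: "continuous_on UNIV (\<lambda>x. fst x j * q (fst x) (snd x))"
    by (intro continuous_intros continuous_on_split_comp[OF q(2)] continuous_on_product_then_coordinatewise[of _ fst])
  show ?case
  proof (cases "j = p")
    case False
    have "(z(p := t)) j * f (z(p := t)) - z j * f z = (t - z p) * (z j * q z t)" for z t
    proof -
      have "(z(p := t)) j * f (z(p := t)) - z j * f z = z j * (f (z(p := t)) - f z)"
        using False by (simp add: right_diff_distrib)
      then show ?thesis using q(1) by simp
    qed
    then show ?thesis
      by (intro exI[of _ "\<lambda>z t. z j * q z t"] conjI) (use q(4) c1 poly in \<open>auto simp: case_prod_unfold simp del: fun_upd_apply\<close>)
  next
    case True
    have c2: "continuous_on UNIV (\<lambda>x. f ((fst x)(p := snd x)))"
      by (rule continuous_on_compose2[OF cf]) (intro continuous_on_fun_upd continuous_on_fst continuous_on_snd continuous_on_id, simp)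
    show ?thesis
    proof (intro exI[of _ "\<lambda>z t. f (z(p := t)) + z p * q z t"] conjI allI)
      fix z t
      have "f (z(p := t)) - f z = (t - z p) * q z t" using q(1) by blast
      then have "f (z(p := t)) = f z + (t - z p) * q z t" by (simp add: algebra_simps)
      then show "(z(p := t)) j * f (z(p := t)) - z j * f z = (t - z p) * (f (z(p := t)) + z p * q z t)"
        unfolding True fun_upd_same by (simp only:) (simp add: algebra_simps)
    next
      show "continuous_on UNIV (\<lambda>(z, t). f (z(p := t)) + z p * q z t)"
        using continuous_on_add[OF c2 c1] True by (simp add: case_prod_unfold)
      show "polyfn V (Suc m - 1) (\<lambda>z. f (z(p := z p)) + z p * q z (z p))"
        using poly True polyfn_var_times.hyps(2) by (auto intro: polyfn.polyfn_add)
    qed auto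
  qed
qed

text \<open>The divided difference is Caratheodory's slope function, so the derivative in each
  coordinate of \<open>V\<close> is zero; \<open>x\<close> is turned into \<open>y\<close> by
  changing these coordinates one by one.\<close>

lemma polyfn_constant_if_partials_vanish:
  assumes "finite V" "polyfn V m f"
    and q: "\<And>p. p \<in> V \<Longrightarrow> (\<forall>z t. f (z(p := t)) - f z = (t - z p) * q p z t) \<and>
       continuous_on UNIV (\<lambda>(z, t). q p z t) \<and> (\<forall>z. q p z (z p) = 0)"
  shows "f x = f y"
proof -
  have upd: "f (z(p := t)) = f z" if p: "p \<in> V" for p z t
  proof -
    have "((\<lambda>s. f (z(p := s))) has_field_derivative 0) (at s)" for s
    proof -
      let ?g = "\<lambda>u. q p (z(p := s)) u"
      have "continuous_on UNIV ?g" using q[OF p]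
        by (intro continuous_on_split_comp[of "q p"]) auto
      then have "isCont ?g s" by (simp add: continuous_on_eq_continuous_at)
      moreover have "f (z(p := u)) - f (z(p := s)) = ?g u * (u - s)" for u
        using q[OF p] by (metis fun_upd_same fun_upd_upd mult.commute)
      moreover have "?g s = 0" using q[OF p] by (metis fun_upd_same)
      ultimately show ?thesis unfolding CARAT_DERIV by blast
    qed
    then have "\<exists>c. \<forall>s\<in>UNIV. f (z(p := s)) = c"
      by (intro has_field_derivative_zero_constant) auto
    then have "f (z(p := t)) = f (z(p := z p))" by (metis UNIV_I)
    then show ?thesis by simp
  qed
  have "f (\<lambda>i. if i \<in> A then y i else x i) = f x" if "finite A" "A \<subseteq> V" for A
    using that
  proof (induction A rule: finite_induct)
    case (insert p A)
    have "(\<lambda>i. if i \<in> insert p A then y i else x i) = (\<lambda>i. if i \<in> A then y i else x i)(p := y p)" by auto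
    then show ?case using upd[of p] insert by simp
  qed simp
  from this[OF assms(1)] have "f (\<lambda>i. if i \<in> V then y i else x i) = f x" by simp
  moreover have "f (\<lambda>i. if i \<in> V then y i else x i) = f y"
    by (rule polyfn_cong_supp[OF assms(2)]) auto
  ultimately show ?thesis by simp
qed

text \<open>Where some partial derivative of \<open>P\<close> is nonzero, forgetting that coordinate is locally
  injective on the zero set; otherwise the cell lies in the zero set of a partial derivative, of lower degree.\<close>

theorem cell_in_hypersurface_dim:
  assumes "finite I" "polynomial_fn I P" "P x \<noteq> 0" "contains_cell m {z \<in> supported I. P z = 0}"
  shows "m + 2 \<le> 2 * card I"
proof -
  obtain k where "polyfn I k P" using assms by (auto simp: polynomial_fn_def)
  then show ?thesis using assms(3,4)
  proof (induction k arbitrary: P x rule: less_induct)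
    case (less k)
    note P = less.prems
    obtain U g where U: "openin (top_of_set (euclid m)) U" "U \<noteq> {}" "continuous_on U g" "inj_on g U"
      and gU: "\<And>u. u \<in> U \<Longrightarrow> g u \<in> supported I \<and> P (g u) = 0"
      using P(3) by (auto simp: contains_cell_def image_subset_iff)
    have "\<forall>p. \<exists>q. (\<forall>z t. P (z(p := t)) - P z = (t - z p) * q z t) \<and> continuous_on UNIV (\<lambda>(z, t). q z t) \<and>
      polyfn I (k - 1) (\<lambda>z. q z (z p)) \<and> (k = 0 \<longrightarrow> (\<forall>z t. q z t = 0))"
      using polyfn_partial_quotient[OF P(1)] by blast
    from choice[OF this] obtain q where "\<forall>p. (\<forall>z t. P (z(p := t)) - P z = (t - z p) * q p z t) \<and> continuous_on UNIV (\<lambda>(z, t). q p z t) \<and>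
      polyfn I (k - 1) (\<lambda>z. q p z (z p)) \<and> (k = 0 \<longrightarrow> (\<forall>z t. q p z t = 0))" by blast
    then have q: "\<And>p z t. P (z(p := t)) - P z = (t - z p) * q p z t"
      "\<And>p. continuous_on UNIV (\<lambda>(z, t). q p z t)" "\<And>p. polyfn I (k - 1) (\<lambda>z. q p z (z p))"
      "\<And>p z t. k = 0 \<Longrightarrow> q p z t = 0" by blast+
    consider (regular) p u where "p \<in> I" "u \<in> U" "q p (g u) (g u p) \<noteq> 0"
      | (singular) p z where "\<And>u. u \<in> U \<Longrightarrow> q p (g u) (g u p) = 0" "p \<in> I" "q p z (z p) \<noteq> 0"
      | (const) "\<And>p z. p \<in> I \<Longrightarrow> q p z (z p) = 0" by blast
    then show "m + 2 \<le> 2 * card I"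
    proof cases
      case const
      have "P x = P (g (SOME u. u \<in> U))"
        by (rule polyfn_constant_if_partials_vanish[OF assms(1) P(1), of q]) (use q const in \<open>auto simp del: fun_upd_apply\<close>)
      then show ?thesis using gU P(2) some_in_eq U(2) by metis
    next
      case singular
      then have "contains_cell m {z \<in> supported I. q p z (z p) = 0}"
        unfolding contains_cell_def using U gU by (intro exI[of _ U] exI[of _ g]) auto
      moreover have "k \<noteq> 0" using q(4) singular(3) by blast
      ultimately show ?thesis using less.IH[of "k - 1" "\<lambda>z. q p z (z p)" z] q(3) singular by auto
    next
      case regular
      have "open ((\<lambda>(z, t). q p z t) -` (- {0}))" using q(2) by (intro open_vimage) auto
      moreover have "(g u, g u p) \<in> (\<lambda>(z, t). q p z t) -` (- {0})" using regular by auto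
      ultimately obtain A B where AB: "open A" "open B" "g u \<in> A" "g u p \<in> B" 
        "A \<times> B \<subseteq> (\<lambda>(z, t). q p z t) -` (- {0})" using open_prod_elim by (metis mem_Sigma_iff)
      \<comment> \<open>On \<open>W\<close> the divided difference is nonzero at every pair of
        points, not just on the diagonal. Hence two zeros of \<open>P\<close> in \<open>W\<close>
        that differ at most in coordinate \<open>p\<close> are equal.\<close>
      define W where "W = A \<inter> (\<lambda>z. z p) -` B"
      have W: "open W" unfolding W_def using AB by (intro open_Int open_vimage) auto
      have Wq: "q p z (z' p) \<noteq> 0" if "z \<in> W" "z' \<in> W" for z z' using AB(5) that by (auto simp: W_def subset_eq)
      define U' where "U' = U \<inter> g -` W"
      have U': "openin (top_of_set (euclid m)) U'"
        unfolding U'_def using U(1,3) W continuous_openin_preimage_gen openin_trans by blast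
      have "u \<in> U'" using AB regular by (auto simp: U'_def W_def)
      define h where "h u = (g u)(p := 0)" for u
      have "continuous_on U' h" unfolding h_def U'_def
        by (intro continuous_on_fun_upd continuous_on_subset[OF U(3)]) auto
      moreover have "inj_on h U'"
      proof (rule inj_onI)
        fix u v assume *: "u \<in> U'" "v \<in> U'" "h u = h v"
        then have gv: "g v = (g u)(p := g v p)" unfolding h_def
          by (metis fun_upd_triv fun_upd_upd)
        have "P (g v) - P (g u) = (g v p - g u p) * q p (g u) (g v p)"
          using q(1)[of "g u" p "g v p"] gv by simp
        moreover have "P (g v) = 0" "P (g u) = 0" "q p (g u) (g v p) \<noteq> 0"
          using gU * Wq by (auto simp: U'_def)
        ultimately have "g v p = g u p" by simp
        then have "g u = g v" using gv by simp
        then show "u = v" using * U(4) by (auto simp: U'_def inj_on_def)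
      qed
      moreover have "h ` U' \<subseteq> supported (I - {p})" using gU by (auto simp: h_def U'_def supported_def)
      ultimately have "contains_cell m (supported (I - {p}) :: ('a \<Rightarrow> complex) set)"
        unfolding contains_cell_def using U' \<open>u \<in> U'\<close> by blast
      \<comment> \<open>One forgotten complex coordinate is two real dimensions, which is the
        \<open>2\<close> in the bound.\<close>
      then have "m \<le> 2 * card (I - {p})"
        by (rule contains_cell_dim_le) (use assms euclidean_coords_complex in auto)
      moreover have "card I = Suc (card (I - {p}))" using assms(1) regular(1) by (rule card.remove)
      ultimately show ?thesis by simp
    qed
  qed
qed

subsection \<open>The complement of a hypersurface\<close>

text \<open>The parameter is real so that the nearby point is again real when both \<open>z\<close>
  and \<open>x\<close> are.\<close>

lemma polynomial_fn_nonzero_nearby: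
  assumes "polynomial_fn V P" "P x \<noteq> 0" "open X" "z \<in> X"
  shows "\<exists>t::real. (\<lambda>i. z i + of_real t * (x i - z i)) \<in> X \<and> P (\<lambda>i. z i + of_real t * (x i - z i)) \<noteq> 0"
proof -
  define l where "l t = (\<lambda>i. z i + t * (x i - z i))" for t :: complex
  have "continuous_on UNIV (\<lambda>t::real. l (of_real t))"
    unfolding l_def by (intro continuous_on_coordinatewise_then_product continuous_intros)
  then have "open ((\<lambda>t::real. l (of_real t)) -` X)" using assms(3) by (intro open_vimage)
  moreover have "0 \<in> (\<lambda>t::real. l (of_real t)) -` X" using assms(4) by (simp add: l_def)
  ultimately have "infinite ((\<lambda>t::real. l (of_real t)) -` X)" using finite_imp_not_open by blast
  then have "infinite (complex_of_real ` ((\<lambda>t::real. l (of_real t)) -` X))" by (rule infinite_of_real_image)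
  moreover have "finite {t. P (l t) = 0}" unfolding l_def
    by (rule finite_zeros_line[OF assms(1), of _ 1]) (use assms in simp)
  ultimately have "\<not> complex_of_real ` ((\<lambda>t::real. l (of_real t)) -` X) \<subseteq> {t. P (l t) = 0}"
    using finite_subset by blast
  then show ?thesis unfolding l_def by blast
qed

text \<open>The complex line through two points meets the zero set in finitely many parameters, and
  the complex plane without finitely many points is path connected.\<close>

lemma connected_nonvanishing:
  assumes "polynomial_fn V P"
  shows "connected {z \<in> supported I. P z \<noteq> 0}"
  unfolding connected_iff_connected_component
proof (intro ballI)
  fix x y assume xy: "x \<in> {z \<in> supported I. P z \<noteq> 0}" "y \<in> {z \<in> supported I. P z \<noteq> 0}"
  define l where "l t = (\<lambda>i. x i + t * (y i - x i))" for t :: complex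
  have l: "continuous_on UNIV l"
    unfolding l_def by (intro continuous_on_coordinatewise_then_product continuous_intros)
  have "finite {t. P (l t) = 0}" unfolding l_def
    by (rule finite_zeros_line[OF assms(1), of _ 0]) (use xy in simp)
  then have "connected (- {t. P (l t) = 0})"
    by (intro path_connected_imp_connected path_connected_complement_countable) (auto simp: countable_finite)
  then have "connected (l ` (- {t. P (l t) = 0}))"
    by (intro connected_continuous_image continuous_on_subset[OF l]) auto
  moreover have "l 0 = x" "l 1 = y" by (auto simp: l_def)
  then have "x \<in> l ` (- {t. P (l t) = 0})" "y \<in> l ` (- {t. P (l t) = 0})"
    using xy by (metis (mono_tags, lifting) ComplI image_eqI mem_Collect_eq)+
  moreover have "l ` (- {t. P (l t) = 0}) \<subseteq> {z \<in> supported I. P z \<noteq> 0}"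
    using xy by (auto simp: l_def supported_def)
  ultimately show "connected_component {z \<in> supported I. P z \<noteq> 0} x y"
    unfolding connected_component_def by blast
qed

subsection \<open>Local injectivity of polynomial maps\<close>

text \<open>Hadamard's factorisation: on the diagonal \<open>L p z z\<close> is the partial
  derivative in direction \<open>p\<close>.\<close>

lemma polyfn_difference:
  assumes "finite V" "polyfn V m f"
  shows "\<exists>L. (\<forall>p. continuous_on UNIV (\<lambda>(z, z'). L p z z')) \<and>
    (\<forall>z z'. f z - f z' = (\<Sum>p\<in>V. (z p - z' p) * L p z z'))"
  using assms(2)
proof (induction rule: polyfn.induct)
  case (polyfn_const m c)
  show ?case by (intro exI[of _ "\<lambda>_ _ _. 0"]) auto
next
  case (polyfn_add m f g)
  then obtain L M where *: "\<forall>p. continuous_on UNIV (\<lambda>(z, z'). L p z z')" "\<forall>z z'. f z - f z' = (\<Sum>p\<in>V. (z p - z' p) * L p z z')"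
    "\<forall>p. continuous_on UNIV (\<lambda>(z, z'). M p z z')" "\<forall>z z'. g z - g z' = (\<Sum>p\<in>V. (z p - z' p) * M p z z')" by blast
  have "continuous_on UNIV (\<lambda>(z, z'). L p z z' + M p z z')" for p
    using continuous_on_add[of UNIV "\<lambda>(z, z'). L p z z'" "\<lambda>(z, z'). M p z z'"] * by (simp add: case_prod_unfold)
  moreover have "f z + g z - (f z' + g z') = (\<Sum>p\<in>V. (z p - z' p) * (L p z z' + M p z z'))" for z z'
    using * by (simp add: distrib_left sum.distrib add_diff_add)
  ultimately show ?case by (intro exI[of _ "\<lambda>p z z'. L p z z' + M p z z'"]) blast
next
  case (polyfn_var_times j m f)
  then obtain L where *: "\<forall>p. continuous_on UNIV (\<lambda>(z, z'). L p z z')"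
    "\<forall>z z'. f z - f z' = (\<Sum>p\<in>V. (z p - z' p) * L p z z')" by blast
  define L' where "L' p z z' = (if p = j then f z else 0) + z' j * L p z z'" for p z z'
  have cf: "continuous_on UNIV (\<lambda>x. f (fst x))"
    by (rule continuous_on_compose2[OF continuous_on_polyfn[OF polyfn_var_times.hyps(2)]]) (intro continuous_on_fst continuous_on_id, simp)
  have "continuous_on UNIV (\<lambda>x. L' p (fst x) (snd x))" for p
  proof -
    have "continuous_on UNIV (\<lambda>x. if p = j then f (fst x) else 0)" using cf by (cases "p = j") auto
    moreover have "continuous_on UNIV (\<lambda>x. snd x j * L p (fst x) (snd x))"
      using *(1) by (intro continuous_on_mult continuous_on_split_comp[of "L p"] continuous_on_fst continuous_on_snd
        continuous_on_id continuous_on_product_then_coordinatewise[of _ snd]) auto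
    ultimately show ?thesis unfolding L'_def by (rule continuous_on_add)
  qed
  moreover have "z j * f z - z' j * f z' = (\<Sum>p\<in>V. (z p - z' p) * L' p z z')" for z z'
  proof -
    have "(\<Sum>p\<in>V. (z p - z' p) * L' p z z') = (\<Sum>p\<in>V. if p = j then (z j - z' j) * f z else 0) + z' j * (\<Sum>p\<in>V. (z p - z' p) * L p z z')"
      unfolding sum_distrib_left sum.distrib[symmetric] L'_def by (intro sum.cong) (auto simp: algebra_simps)
    also have "\<dots> = (z j - z' j) * f z + z' j * (f z - f z')" using assms(1) polyfn_var_times.hyps(1) *(2) by simp
    finally show ?thesis by (simp add: algebra_simps)
  qed
  ultimately show ?case by (intro exI[of _ L']) (simp add: case_prod_unfold)
qed

lemma compact_product:
  assumes "\<And>p. compact (B p :: 'a::topological_space set)"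
  shows "compact {w. \<forall>p. w p \<in> B p}"
proof -
  have "compactin (product_topology (\<lambda>_. euclidean) UNIV) (PiE UNIV B)"
    using assms by (subst compactin_PiE) auto
  moreover have "PiE UNIV B = {w. \<forall>p. w p \<in> B p}" by (auto simp: PiE_iff)
  ultimately show ?thesis by (simp add: euclidean_product_topology)
qed

lemma finite_attains_max:
  fixes f :: "'a \<Rightarrow> real"
  assumes "finite C" "p0 \<in> C"
  shows "\<exists>c\<in>C. \<forall>p\<in>C. f p \<le> f c"
proof -
  have "Max (f ` C) \<in> f ` C" using assms by (intro Max_in) auto
  then obtain c where "c \<in> C" "f c = Max (f ` C)" by auto
  then show ?thesis using assms by (intro bexI[of _ c]) auto
qed

text \<open>Coordinates outside \<open>C\<close> are shared parameters. Two points with equal values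
  give, through Hadamard's factorisation, a normalised direction annihilated by all the
  \<open>L r\<close>. At \<open>z0\<close> no direction is, by \<open>ker\<close>; since the
  directions form a compact set, the tube lemma extends this to a neighbourhood.\<close>

theorem polynomial_map_locally_injective:
  fixes F :: "'r \<Rightarrow> ('p \<Rightarrow> complex) \<Rightarrow> complex"
  assumes "finite V" "C \<subseteq> V" "\<And>r. r \<in> R \<Longrightarrow> polynomial_fn V (F r)"
    and ker: "\<And>w. w \<in> supported C \<Longrightarrow>
      (\<And>r. r \<in> R \<Longrightarrow> ((\<lambda>t. F r (\<lambda>p. z0 p + t * w p)) has_field_derivative 0) (at 0)) \<Longrightarrow> w = (\<lambda>_. 0)"
  shows "\<exists>W. open W \<and> z0 \<in> W \<and> (\<forall>z\<in>W. \<forall>z'\<in>W. (\<forall>p. p \<notin> C \<longrightarrow> z p = z' p) \<longrightarrow> (\<forall>r\<in>R. F r z = F r z') \<longrightarrow> z = z')"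
proof -
  have finC: "finite C" using assms finite_subset by blast
  have "\<forall>r\<in>R. \<exists>L. (\<forall>p. continuous_on UNIV (\<lambda>(z, z'). L p z z')) \<and>
    (\<forall>z z'. F r z - F r z' = (\<Sum>p\<in>V. (z p - z' p) * L p z z'))"
    using polyfn_difference[OF assms(1)] assms(3) unfolding polynomial_fn_def by blast
  from bchoice[OF this] obtain L where
    "\<forall>r\<in>R. (\<forall>p. continuous_on UNIV (\<lambda>(z, z'). L r p z z')) \<and>
      (\<forall>z z'. F r z - F r z' = (\<Sum>p\<in>V. (z p - z' p) * L r p z z'))" by blast
  then have L: "\<And>r p. r \<in> R \<Longrightarrow> continuous_on UNIV (\<lambda>(z, z'). L r p z z')"
    "\<And>r z z'. r \<in> R \<Longrightarrow> F r z - F r z' = (\<Sum>p\<in>V. (z p - z' p) * L r p z z')" by blast+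
  have deriv: "((\<lambda>t. F r (\<lambda>p. z0 p + t * w p)) has_field_derivative (\<Sum>p\<in>C. w p * L r p z0 z0)) (at 0)"
    if r: "r \<in> R" and w: "w \<in> supported C" for r w
  proof -
    define g where "g t = (\<Sum>p\<in>V. w p * L r p (\<lambda>p. z0 p + t * w p) z0)" for t
    have "continuous_on UNIV g" unfolding g_def
      by (intro continuous_intros continuous_on_split_comp[OF L(1)[OF r]] continuous_on_coordinatewise_then_product)
    then have "isCont g 0" by (simp add: continuous_on_eq_continuous_at)
    moreover have "F r (\<lambda>p. z0 p + t * w p) - F r (\<lambda>p. z0 p + 0 * w p) = g t * (t - 0)" for t
      using L(2)[OF r, of "\<lambda>p. z0 p + t * w p" z0] by (simp add: g_def sum_distrib_left mult.assoc mult.commute mult.left_commute)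
    moreover have "g 0 = (\<Sum>p\<in>C. w p * L r p z0 z0)"
      unfolding g_def using w assms(1,2) by (auto simp: supported_def intro!: sum.mono_neutral_right)
    ultimately show ?thesis unfolding CARAT_DERIV by blast
  qed
  \<comment> \<open>Directions supported in \<open>C\<close>, scaled so that a coordinate of largest
    modulus is 1. As a finite union of products of compact sets this is compact, without reference
    to a norm.\<close>
  define K where "K = (\<Union>c\<in>C. {w. \<forall>p. w p \<in> (if p = c then {1} else if p \<in> C then cball 0 1 else {0::complex})})"
  have K: "compact K" unfolding K_def using finC by (intro compact_UN compact_product) auto
  define O' where "O' = (\<Union>r\<in>R. (\<lambda>((z, z'), w). \<Sum>p\<in>C. w p * L r p z z') -` (- {0}))"
  have "continuous_on UNIV (\<lambda>x. \<Sum>p\<in>C. snd x p * L r p (fst (fst x)) (snd (fst x)))" if "r \<in> R" for r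
    by (intro continuous_intros continuous_on_split_comp[OF L(1)[OF that]] continuous_on_product_then_coordinatewise[of _ snd])
  then have O': "open O'" unfolding O'_def by (intro open_UN ballI open_vimage) (auto simp: case_prod_unfold)
  have "{(z0, z0)} \<times> K \<subseteq> O'"
  proof (clarify, rule ccontr)
    fix w assume w: "w \<in> K" "((z0, z0), w) \<notin> O'"
    then have ws: "w \<in> supported C" by (auto simp: K_def supported_def split: if_splits)
    have 0: "(\<Sum>p\<in>C. w p * L r p z0 z0) = 0" if "r \<in> R" for r using w(2) that by (auto simp: O'_def)
    have "w = (\<lambda>_. 0)" using deriv[OF _ ws] by (intro ker[OF ws]) (simp add: 0)
    moreover obtain c where "w c = 1" using w(1) by (auto simp: K_def split: if_splits)
    ultimately show False by simp
  qed
  from Elementary_Topology.tube_lemma[OF K O' this] obtain X where X: "(z0, z0) \<in> X" "open X" "X \<times> K \<subseteq> O'" by blast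
  then obtain A B where AB: "open A" "open B" "z0 \<in> A" "z0 \<in> B" "A \<times> B \<subseteq> X"
    using open_prod_elim by (metis mem_Sigma_iff)
  show ?thesis
  proof (intro exI[of _ "A \<inter> B"] conjI ballI impI)
    fix z z' assume z: "z \<in> A \<inter> B" "z' \<in> A \<inter> B" "\<forall>p. p \<notin> C \<longrightarrow> z p = z' p" "\<forall>r\<in>R. F r z = F r z'"
    show "z = z'"
    proof (rule ccontr)
      assume "z \<noteq> z'"
      then obtain p0 where p0: "z p0 \<noteq> z' p0" by blast
      then have "p0 \<in> C" using z by auto
      have "\<exists>c\<in>C. \<forall>p\<in>C. cmod (z p - z' p) \<le> cmod (z c - z' c)"
        using finite_attains_max[OF finC \<open>p0 \<in> C\<close>] .
      then obtain c where c: "c \<in> C" "\<And>p. p \<in> C \<Longrightarrow> cmod (z p - z' p) \<le> cmod (z c - z' c)" by blast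
      have nz: "z c - z' c \<noteq> 0" using c(2)[OF \<open>p0 \<in> C\<close>] p0 by auto
      define w where "w p = (z p - z' p) / (z c - z' c)" for p
      have "w \<in> K" unfolding K_def using c nz z(3)
        by (auto simp: w_def norm_divide divide_le_eq_1 intro!: bexI[of _ c])
      then have "((z, z'), w) \<in> O'" using X AB z by blast
      then obtain r where r: "r \<in> R" "(\<Sum>p\<in>C. w p * L r p z z') \<noteq> 0" by (auto simp: O'_def)
      have "0 = (\<Sum>p\<in>V. (z p - z' p) * L r p z z')" using L(2)[OF r(1), of z z'] z(4) r(1) by simp
      also have "\<dots> = (\<Sum>p\<in>C. (z p - z' p) * L r p z z')"
        using assms(1,2) z(3) by (intro sum.mono_neutral_right) auto
      also have "\<dots> = (z c - z' c) * (\<Sum>p\<in>C. w p * L r p z z')"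
        unfolding sum_distrib_left using nz by (intro sum.cong) (auto simp: w_def)
      finally show False using r nz by simp
    qed
  qed (use AB in auto)
qed

subsection \<open>Sections and their differentials\<close>

definition mono_at :: "nat \<Rightarrow> nat \<Rightarrow> (nat \<Rightarrow> nat \<Rightarrow> complex) \<Rightarrow> (nat \<Rightarrow> nat) \<Rightarrow> complex" where
  "mono_at n i x idx = (\<Prod>j\<in>{..<n} - {i}. x j (idx j))"

definition dmono_at :: "nat \<Rightarrow> nat \<Rightarrow> (nat \<Rightarrow> nat \<Rightarrow> complex) \<Rightarrow> (nat \<Rightarrow> nat \<Rightarrow> complex) \<Rightarrow> (nat \<Rightarrow> nat) \<Rightarrow> complex" where
  "dmono_at n i x v idx = (\<Sum>m\<in>{..<n} - {i}. v m (idx m) * (\<Prod>j\<in>{..<n} - {i, m}. x j (idx j)))"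

lemma sec_eval_mono_at: "sec_eval n d f x i k = (\<Sum>idx\<in>multi_idx n d i. f (i, k, idx) * mono_at n i x idx)"
  by (simp add: sec_eval_def mono_at_def)

lemma sec_deriv_dmono_at: "sec_deriv n d f x v i k = (\<Sum>idx\<in>multi_idx n d i. f (i, k, idx) * dmono_at n i x v idx)"
  by (simp add: sec_deriv_def dmono_at_def)

lemma Diff_insert_single: "A - {i, m} = A - {i} - {m}"
  by blast

lemma mono_at_scale: "mono_at n i (\<lambda>j b. c j * x j b) idx = (\<Prod>j\<in>{..<n} - {i}. c j) * mono_at n i x idx"
  by (simp add: mono_at_def prod.distrib)

lemma dmono_at_scale:
  "dmono_at n i (\<lambda>j b. c j * x j b) (\<lambda>j b. c j * v j b) idx = (\<Prod>j\<in>{..<n} - {i}. c j) * dmono_at n i x v idx"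
  unfolding dmono_at_def sum_distrib_left
proof (rule sum.cong[OF refl])
  fix m assume m: "m \<in> {..<n} - {i}"
  show "c m * v m (idx m) * (\<Prod>j\<in>{..<n} - {i, m}. c j * x j (idx j)) =
    (\<Prod>j\<in>{..<n} - {i}. c j) * (v m (idx m) * (\<Prod>j\<in>{..<n} - {i, m}. x j (idx j)))"
    unfolding prod.remove[OF _ m, of c, simplified] Diff_insert_single by (simp add: prod.distrib)
qed

text \<open>Euler's formula in each factor: the monomial is linear in every \<open>x j\<close> with
  \<open>j \<noteq> i\<close>, so its derivative along \<open>x j\<close> is the monomial itself. At
  a zero of a section the Euler directions therefore lie in the kernel.\<close>

lemma dmono_at_euler:
  "dmono_at n i x (\<lambda>j b. v j b - c j * x j b) idx = dmono_at n i x v idx - (\<Sum>j\<in>{..<n} - {i}. c j) * mono_at n i x idx"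
proof -
  have "c m * mono_at n i x idx = c m * x m (idx m) * (\<Prod>j\<in>{..<n} - {i, m}. x j (idx j))" if "m \<in> {..<n} - {i}" for m
    unfolding mono_at_def prod.remove[OF _ that, of "\<lambda>j. x j (idx j)", simplified] Diff_insert_single by simp
  then show ?thesis unfolding dmono_at_def sum_distrib_right sum_subtractf[symmetric]
    by (intro sum.cong) (auto simp: algebra_simps)
qed

lemma dmono_at_scale_vec: "dmono_at n i x (\<lambda>j b. s * v j b) idx = s * dmono_at n i x v idx"
  by (simp add: dmono_at_def sum_distrib_left mult.assoc)

lemma sec_eval_scale:
  "sec_eval n d f (\<lambda>j b. c j * x j b) i k = (\<Prod>j\<in>{..<n} - {i}. c j) * sec_eval n d f x i k"
  by (simp add: sec_eval_mono_at mono_at_scale sum_distrib_left mult.left_commute)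

lemma sec_deriv_scale:
  "sec_deriv n d f (\<lambda>j b. c j * x j b) (\<lambda>j b. c j * v j b) i k = (\<Prod>j\<in>{..<n} - {i}. c j) * sec_deriv n d f x v i k"
  by (simp add: sec_deriv_dmono_at dmono_at_scale sum_distrib_left mult.left_commute)

lemma sec_deriv_scale_vec: "sec_deriv n d f x (\<lambda>j b. s * v j b) i k = s * sec_deriv n d f x v i k"
  by (simp add: sec_deriv_dmono_at dmono_at_scale_vec sum_distrib_left mult.left_commute)

lemma sec_deriv_euler:
  "sec_deriv n d f x (\<lambda>j b. v j b - c j * x j b) i k =
   sec_deriv n d f x v i k - (\<Sum>j\<in>{..<n} - {i}. c j) * sec_eval n d f x i k"
  by (simp add: sec_deriv_dmono_at sec_eval_mono_at dmono_at_euler right_diff_distrib sum_subtractf sum_distrib_left mult.left_commute)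

lemma has_field_derivative_sec_eval:
  "((\<lambda>t. sec_eval n d f (\<lambda>j b. x j b + t * v j b) i k) has_field_derivative sec_deriv n d f x v i k) (at 0)"
proof -
  have lin: "((\<lambda>t. x j b + t * v j b) has_field_derivative v j b) (at 0)" for j b
    by (auto intro!: derivative_eq_intros)
  have "((\<lambda>t. mono_at n i (\<lambda>j b. x j b + t * v j b) idx) has_field_derivative dmono_at n i x v idx) (at 0)" for idx
    using has_field_derivative_prod[of "{..<n} - {i}" "\<lambda>j t. x j (idx j) + t * v j (idx j)" "\<lambda>j. v j (idx j)" 0] lin
    by (simp add: mono_at_def dmono_at_def Diff_insert_single)
  then show ?thesis unfolding sec_eval_mono_at sec_deriv_dmono_at
    by (intro DERIV_sum DERIV_cmult)
qed

lemma finite_multi_idx: "finite (multi_idx n d i)"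
proof -
  have "multi_idx n d i \<subseteq> {f. \<forall>j. (j \<in> {..<n} \<longrightarrow> f j \<in> insert 0 (\<Union>j<n. {..<d j})) \<and> (j \<notin> {..<n} \<longrightarrow> f j = 0)}"
    by (auto simp: multi_idx_def)
  then show ?thesis by (rule finite_subset) (intro finite_set_of_finite_funs, auto)
qed

lemma finite_sec_idx: "finite (sec_idx n d)"
proof -
  have "sec_idx n d \<subseteq> (\<Union>i<n. {i} \<times> {..<d i - 1} \<times> multi_idx n d i)"
    by (auto simp: sec_idx_def)
  then show ?thesis by (rule finite_subset) (auto simp: finite_multi_idx)
qed

lemma sections_eq_supported: "sections n d = supported (sec_idx n d)"
  by (simp add: sections_def supported_def)

subsection \<open>Affine charts\<close>

definition sec_rows :: "nat \<Rightarrow> (nat \<Rightarrow> nat) \<Rightarrow> (nat \<times> nat) set" where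
  "sec_rows n d = {(i, k). i < n \<and> k < d i - 1}"

definition pivots :: "nat \<Rightarrow> (nat \<Rightarrow> nat) \<Rightarrow> (nat \<Rightarrow> nat) set" where
  "pivots n d = {a. \<forall>j. (j < n \<longrightarrow> a j < d j) \<and> (n \<le> j \<longrightarrow> a j = 0)}"

definition chart_cols :: "nat \<Rightarrow> (nat \<Rightarrow> nat) \<Rightarrow> (nat \<Rightarrow> nat) \<Rightarrow> (nat \<times> nat) set" where
  "chart_cols n d a = {(j, b). j < n \<and> b < d j \<and> b \<noteq> a j}"

definition chart :: "nat \<Rightarrow> (nat \<Rightarrow> nat) \<Rightarrow> (nat \<Rightarrow> nat) \<Rightarrow> (nat \<Rightarrow> nat \<Rightarrow> complex) set" where
  "chart n d a = {x. (\<forall>j<n. x j (a j) = 1) \<and> (\<forall>j b. n \<le> j \<or> d j \<le> b \<longrightarrow> x j b = 0)}"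

definition chart_tan :: "nat \<Rightarrow> (nat \<Rightarrow> nat) \<Rightarrow> (nat \<Rightarrow> nat) \<Rightarrow> (nat \<Rightarrow> nat \<Rightarrow> complex) set" where
  "chart_tan n d a = {v. \<forall>j b. (j, b) \<notin> chart_cols n d a \<longrightarrow> v j b = 0}"

text \<open>The monomial of type \<open>i\<close> that is identically 1 on the chart, hence the
  constant term there; changing one of its entries gives a linear monomial.\<close>

definition pivot_idx :: "nat \<Rightarrow> (nat \<Rightarrow> nat) \<Rightarrow> nat \<Rightarrow> nat \<Rightarrow> nat" where
  "pivot_idx n a i = (\<lambda>j. if j < n \<and> j \<noteq> i then a j else 0)"

lemma sec_rows_Sigma: "sec_rows n d = Sigma {..<n} (\<lambda>i. {..<d i - 1})"
  by (auto simp: sec_rows_def)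

lemma chart_cols_Sigma: "chart_cols n d a = Sigma {..<n} (\<lambda>j. {..<d j} - {a j})"
  by (auto simp: chart_cols_def)

lemma finite_sec_rows: "finite (sec_rows n d)"
  by (simp add: sec_rows_Sigma)

lemma finite_chart_cols: "finite (chart_cols n d a)"
  by (simp add: chart_cols_Sigma)

lemma card_sec_rows: "card (sec_rows n d) = (\<Sum>i<n. d i - 1)"
  by (simp add: sec_rows_Sigma)

text \<open>The rank of the bundle equals the dimension of the variety, so the systems solved in a
  chart are square.\<close>

lemma card_chart_cols: "a \<in> pivots n d \<Longrightarrow> card (chart_cols n d a) = card (sec_rows n d)"
  unfolding card_sec_rows chart_cols_Sigma
  by (subst card_SigmaI) (auto intro!: sum.cong simp: pivots_def)

lemma finite_pivots: "finite (pivots n d)"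
proof -
  have "pivots n d \<subseteq> {f. \<forall>j. (j \<in> {..<n} \<longrightarrow> f j \<in> insert 0 (\<Union>j<n. {..<d j})) \<and> (j \<notin> {..<n} \<longrightarrow> f j = 0)}"
    by (auto simp: pivots_def not_less)
  then show ?thesis by (rule finite_subset) (intro finite_set_of_finite_funs, auto)
qed

lemma pivot_idx_in: "a \<in> pivots n d \<Longrightarrow> pivot_idx n a i \<in> multi_idx n d i"
  by (auto simp: pivot_idx_def pivots_def multi_idx_def)

lemma pivot_idx_upd_in:
  "a \<in> pivots n d \<Longrightarrow> (m, b) \<in> chart_cols n d a \<Longrightarrow> m \<noteq> i \<Longrightarrow> (pivot_idx n a i)(m := b) \<in> multi_idx n d i"
  by (auto simp: pivot_idx_def pivots_def multi_idx_def chart_cols_def)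

lemma pivot_idx_upd_neq: "(m, b) \<in> chart_cols n d a \<Longrightarrow> m \<noteq> i \<Longrightarrow> (pivot_idx n a i)(m := b) \<noteq> pivot_idx n a i"
  by (auto simp: pivot_idx_def chart_cols_def fun_eq_iff)

lemma mono_at_pivot: "x \<in> chart n d a \<Longrightarrow> mono_at n i x (pivot_idx n a i) = 1"
  by (auto simp: mono_at_def chart_def pivot_idx_def intro!: prod.neutral)

lemma mono_at_pivot_upd:
  assumes "x \<in> chart n d a" "m < n" "m \<noteq> i"
  shows "mono_at n i x ((pivot_idx n a i)(m := b)) = x m b"
proof -
  have "m \<in> {..<n} - {i}" using assms by auto
  then have "mono_at n i x ((pivot_idx n a i)(m := b)) = x m b * (\<Prod>j\<in>{..<n} - {i} - {m}. x j (((pivot_idx n a i)(m := b)) j))"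
    unfolding mono_at_def by (subst prod.remove) auto
  moreover have "(\<Prod>j\<in>{..<n} - {i} - {m}. x j (((pivot_idx n a i)(m := b)) j)) = 1"
    using assms(1) by (intro prod.neutral) (auto simp: chart_def pivot_idx_def)
  ultimately show ?thesis by simp
qed

lemma dmono_at_pivot:
  assumes "\<And>j. j < n \<Longrightarrow> v j (a j) = 0"
  shows "dmono_at n i x v (pivot_idx n a i) = 0"
  using assms by (auto simp: dmono_at_def pivot_idx_def intro!: sum.neutral)

lemma dmono_at_pivot_upd:
  assumes "x \<in> chart n d a" "\<And>j. j < n \<Longrightarrow> v j (a j) = 0" "m < n" "m \<noteq> i"
  shows "dmono_at n i x v ((pivot_idx n a i)(m := b)) = v m b"
proof -
  have m: "m \<in> {..<n} - {i}" using assms by auto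
  have "(\<Sum>l\<in>{..<n} - {i} - {m}. v l (((pivot_idx n a i)(m := b)) l) * (\<Prod>j\<in>{..<n} - {i, l}. x j (((pivot_idx n a i)(m := b)) j))) = 0"
    using assms(2) by (intro sum.neutral) (auto simp: pivot_idx_def)
  moreover have "(\<Prod>j\<in>{..<n} - {i, m}. x j (((pivot_idx n a i)(m := b)) j)) = 1"
    using assms(1) by (intro prod.neutral) (auto simp: chart_def pivot_idx_def)
  ultimately show ?thesis unfolding dmono_at_def using m by (subst sum.remove[OF _ m]) auto
qed

text \<open>Only the tangent space clause of \<open>reduced_dim0\<close> is negated; empty and
  infinite zero sets are excluded separately.\<close>

definition degenerate :: "nat \<Rightarrow> (nat \<Rightarrow> nat) \<Rightarrow> (nat \<times> nat \<times> (nat \<Rightarrow> nat) \<Rightarrow> complex) set" where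
  "degenerate n d = {f. \<exists>x\<in>zero_set n d f. \<exists>v\<in>tan_vecs n d.
     (\<forall>i<n. \<forall>k<d i - 1. sec_deriv n d f x v i k = 0) \<and> \<not> (\<exists>c. \<forall>j<n. \<forall>a. v j a = c j * x j a)}"

text \<open>In each factor the pivot is a coordinate of largest modulus. The bound by 1 is what
  later confines zeros to compact sets.\<close>

lemma cone_pts_chart:
  assumes "x \<in> cone_pts n d"
  shows "\<exists>a\<in>pivots n d. (\<lambda>j b. inverse (x j (a j)) * x j b) \<in> chart n d a \<and> (\<forall>j<n. x j (a j) \<noteq> 0)
    \<and> (\<forall>j<n. \<forall>b. cmod (inverse (x j (a j)) * x j b) \<le> 1)"
proof -
  have "\<exists>a<d j. x j a \<noteq> 0 \<and> (\<forall>b<d j. cmod (x j b) \<le> cmod (x j a))" if j: "j < n" for j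
  proof -
    obtain b where b: "b < d j" "x j b \<noteq> 0" using assms j by (auto simp: cone_pts_def)
    obtain a where a: "a < d j" "\<forall>b<d j. cmod (x j b) \<le> cmod (x j a)"
      using finite_attains_max[of "{..<d j}" b "\<lambda>b. cmod (x j b)"] b(1) by auto
    moreover have "x j a \<noteq> 0" using a(2) b by force
    ultimately show ?thesis by blast
  qed
  then obtain a where a: "\<And>j. j < n \<Longrightarrow> a j < d j \<and> x j (a j) \<noteq> 0 \<and> (\<forall>b<d j. cmod (x j b) \<le> cmod (x j (a j)))" by metis
  define a' where "a' j = (if j < n then a j else 0)" for j
  have "a' \<in> pivots n d" using a by (auto simp: a'_def pivots_def)
  moreover have "(\<lambda>j b. inverse (x j (a' j)) * x j b) \<in> chart n d a'"
    using a assms by (auto simp: a'_def chart_def cone_pts_def)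
  moreover have "\<forall>j<n. x j (a' j) \<noteq> 0" using a by (auto simp: a'_def)
  moreover have "cmod (inverse (x j (a' j)) * x j b) \<le> 1" if "j < n" for j b
  proof (cases "b < d j")
    case True
    then show ?thesis using a[OF that] that
      by (simp add: a'_def norm_mult norm_inverse inverse_eq_divide divide_le_eq_1 norm_divide)
  next
    case False
    then show ?thesis using assms that by (simp add: cone_pts_def)
  qed
  ultimately show ?thesis by blast
qed

text \<open>The point is scaled into a chart and the vector with it; an Euler vector is subtracted
  so that all pivot entries vanish. What remains is nonzero because the vector was not an Euler
  direction, and is scaled to have an entry 1.\<close>

lemma degenerate_normal_form:
  assumes "f \<in> degenerate n d"
  shows "\<exists>a\<in>pivots n d. \<exists>x\<in>chart n d a. \<exists>v\<in>chart_tan n d a. \<exists>m b. (m, b) \<in> chart_cols n d a \<and> v m b = 1 \<and>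
    (\<forall>i<n. \<forall>k<d i - 1. sec_eval n d f x i k = 0 \<and> sec_deriv n d f x v i k = 0)"
proof -
  obtain x v where x: "x \<in> zero_set n d f" and v: "v \<in> tan_vecs n d"
    and ker: "\<And>i k. i < n \<Longrightarrow> k < d i - 1 \<Longrightarrow> sec_deriv n d f x v i k = 0"
    and ne: "\<not> (\<exists>c. \<forall>j<n. \<forall>a. v j a = c j * x j a)" using assms unfolding degenerate_def by blast
  have xc: "x \<in> cone_pts n d" and x0: "\<And>i k. i < n \<Longrightarrow> k < d i - 1 \<Longrightarrow> sec_eval n d f x i k = 0"
    using x by (auto simp: zero_set_def)
  obtain a where a: "a \<in> pivots n d" "(\<lambda>j b. inverse (x j (a j)) * x j b) \<in> chart n d a" "\<And>j. j < n \<Longrightarrow> x j (a j) \<noteq> 0"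
    using cone_pts_chart[OF xc] by blast
  define c where "c j = inverse (x j (a j))" for j
  define x' where "x' = (\<lambda>j b. c j * x j b)"
  define w where "w = (\<lambda>j b. c j * v j b)"
  define u where "u = (\<lambda>j b. w j b - w j (a j) * x' j b)"
  have x': "x' \<in> chart n d a" using a(2) by (simp add: x'_def c_def)
  have e: "sec_eval n d f x' i k = 0" "sec_deriv n d f x' u i k = 0" if "i < n" "k < d i - 1" for i k
    using x0[OF that] ker[OF that] unfolding u_def sec_deriv_euler unfolding x'_def w_def sec_eval_scale sec_deriv_scale by auto
  have utan: "u \<in> chart_tan n d a"
    using v x' by (auto simp: chart_tan_def chart_cols_def u_def w_def tan_vecs_def chart_def not_less) (metis not_less)
  have "\<exists>m b. m < n \<and> u m b \<noteq> 0"
  proof (rule ccontr)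
    assume u0: "\<not> (\<exists>m b. m < n \<and> u m b \<noteq> 0)"
    have wx: "w j b = w j (a j) * x' j b" if "j < n" for j b
    proof -
      have "u j b = 0" using u0 that by blast
      then show ?thesis unfolding u_def by (rule eq_iff_diff_eq_0[THEN iffD2])
    qed
    have "c j * v j b = c j * (w j (a j) * x j b)" if "j < n" for j b
    proof -
      have "c j * v j b = w j b" by (simp add: w_def)
      also have "\<dots> = w j (a j) * x' j b" by (rule wx[OF that])
      also have "\<dots> = c j * (w j (a j) * x j b)" unfolding x'_def by (rule mult.left_commute)
      finally show ?thesis .
    qed
    moreover have "c j \<noteq> 0" if "j < n" for j using a(3)[OF that] by (simp add: c_def)
    ultimately have "v j b = w j (a j) * x j b" if "j < n" for j b
      using that by (metis mult_cancel_left)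
    then have "\<exists>c. \<forall>j<n. \<forall>b. v j b = c j * x j b" by (intro exI[of _ "\<lambda>j. w j (a j)"]) simp
    then show False using ne by simp
  qed
  then obtain m b where mb: "u m b \<noteq> 0" by blast
  then have mbc: "(m, b) \<in> chart_cols n d a" using utan by (auto simp: chart_tan_def)
  define v' where "v' = (\<lambda>j l. inverse (u m b) * u j l)"
  have "v' \<in> chart_tan n d a" "v' m b = 1" using utan mb by (auto simp: v'_def chart_tan_def)
  moreover have "\<forall>i<n. \<forall>k<d i - 1. sec_eval n d f x' i k = 0 \<and> sec_deriv n d f x' v' i k = 0"
    using e by (simp add: v'_def sec_deriv_scale_vec)
  ultimately show ?thesis using a(1) x' mbc by blast
qed

subsection \<open>The degenerate sections lie in a hypersurface\<close>

type_synonym sec_index = "nat \<times> nat \<times> (nat \<Rightarrow> nat)"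
text \<open>Section, point and tangent vector become one coordinate function, to which the results
  on polynomial and rational functions of coordinates apply.\<close>

type_synonym datum_index = "sec_index + (nat \<times> nat) + (nat \<times> nat)"

definition d_sec :: "(datum_index \<Rightarrow> complex) \<Rightarrow> sec_index \<Rightarrow> complex" where "d_sec z p = z (Inl p)"
definition d_pt :: "(datum_index \<Rightarrow> complex) \<Rightarrow> nat \<Rightarrow> nat \<Rightarrow> complex" where "d_pt z j b = z (Inr (Inl (j, b)))"
definition d_vec :: "(datum_index \<Rightarrow> complex) \<Rightarrow> nat \<Rightarrow> nat \<Rightarrow> complex" where "d_vec z j b = z (Inr (Inr (j, b)))"

definition datum :: "(sec_index \<Rightarrow> complex) \<Rightarrow> (nat \<Rightarrow> nat \<Rightarrow> complex) \<Rightarrow> (nat \<Rightarrow> nat \<Rightarrow> complex) \<Rightarrow> datum_index \<Rightarrow> complex" where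
  "datum f x v q = (case q of Inl p \<Rightarrow> f p | Inr (Inl (j, b)) \<Rightarrow> x j b | Inr (Inr (j, b)) \<Rightarrow> v j b)"

lemma datum_simps [simp]: "d_sec (datum f x v) = f" "d_pt (datum f x v) = x" "d_vec (datum f x v) = v"
  by (auto simp: datum_def d_sec_def d_pt_def d_vec_def fun_eq_iff)

text \<open>The pivot coefficients of each row are solved for, by the vanishing of the section and of its
  derivative; everything else is a free parameter.\<close>

lemma degenerate_family_annihilated:
  assumes a: "a \<in> pivots n d"
    and R2: "R2 \<subseteq> sec_rows n d" "\<And>r. r \<in> R2 \<Longrightarrow> pv r \<in> chart_cols n d a \<and> fst (pv r) \<noteq> fst r"
    and Vv: "Vv \<subseteq> chart_cols n d a" "card Vv < card R2"
    and \<Omega>: "\<And>z. z \<in> \<Omega> \<Longrightarrow> d_pt z \<in> chart n d a"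
      "\<And>z j b. z \<in> \<Omega> \<Longrightarrow> (j, b) \<notin> Vv \<Longrightarrow> d_vec z j b = \<kappa> (j, b)"
      "\<And>z j. z \<in> \<Omega> \<Longrightarrow> j < n \<Longrightarrow> d_vec z j (a j) = 0"
      "\<And>z i k. z \<in> \<Omega> \<Longrightarrow> (i, k) \<in> sec_rows n d \<Longrightarrow> sec_eval n d (d_sec z) (d_pt z) i k = 0"
      "\<And>z i k. z \<in> \<Omega> \<Longrightarrow> (i, k) \<in> R2 \<Longrightarrow> sec_deriv n d (d_sec z) (d_pt z) (d_vec z) i k = 0"
      "\<And>z r. z \<in> \<Omega> \<Longrightarrow> r \<in> R2 \<Longrightarrow> d_vec z (fst (pv r)) (snd (pv r)) \<noteq> 0"
  shows "\<exists>P. polynomial_fn (sec_idx n d) P \<and> (\<exists>x. P x \<noteq> 0) \<and> (\<forall>z\<in>\<Omega>. P (d_sec z) = 0)"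
proof -
  \<comment> \<open>The monomial \<open>I1\<close> has value 1 and derivative 0; the monomial
    \<open>I2\<close> has derivative equal to the nonzero vector entry \<open>pv r\<close>. The
    system is thus triangular: the derivative equation yields the coefficient of \<open>I2\<close>,
    and then the value equation that of \<open>I1\<close>.\<close>
  define I1 where "I1 i = pivot_idx n a i" for i
  define I2 where "I2 r = (pivot_idx n a (fst r))(fst (pv r) := snd (pv r))" for r
  define p1 where "p1 = (\<lambda>r :: nat \<times> nat. (fst r, snd r, I1 (fst r)))"
  define p2 where "p2 = (\<lambda>r. (fst r, snd r, I2 r))"
  have I1: "I1 i \<in> multi_idx n d i" for i using pivot_idx_in[OF a] by (simp add: I1_def)
  have I2: "I2 r \<in> multi_idx n d (fst r)" "I2 r \<noteq> I1 (fst r)" if "r \<in> R2" for r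
    using R2(2)[OF that] pivot_idx_upd_in[OF a, of "fst (pv r)" "snd (pv r)"]
      pivot_idx_upd_neq[of "fst (pv r)" "snd (pv r)" n d a] by (auto simp: I1_def I2_def)
  define V :: "datum_index set" where
    "V = Inl ` (sec_idx n d - p1 ` sec_rows n d - p2 ` R2) \<union> (Inr \<circ> Inl) ` chart_cols n d a \<union> (Inr \<circ> Inr) ` Vv"
  have fin: "finite (sec_rows n d)" "finite R2" "finite (chart_cols n d a)" "finite Vv" "finite (sec_idx n d)"
    using finite_subset[OF R2(1) finite_sec_rows] finite_subset[OF Vv(1) finite_chart_cols]
    by (auto simp: finite_sec_rows finite_chart_cols finite_sec_idx)
  have finV: "finite V" using fin by (simp add: V_def)
  \<comment> \<open>Every row loses one coefficient, which pays for the coordinates of the point;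
    the rows of \<open>R2\<close> lose a second one, and there are more of these than free entries
    of the vector.\<close>
  have cardV: "card V < card (sec_idx n d)"
  proof -
    have inj: "inj_on p1 (sec_rows n d)" "inj_on p2 R2" by (auto simp: inj_on_def p1_def p2_def)
    have disj: "p1 ` sec_rows n d \<inter> p2 ` R2 = {}" using I2(2) by (fastforce simp: p1_def p2_def)
    have sub: "p1 ` sec_rows n d \<union> p2 ` R2 \<subseteq> sec_idx n d"
      using I1 I2 R2(1) by (auto simp: p1_def p2_def sec_idx_def sec_rows_def subset_eq) 
    have Diff_Diff_Un_eq: "sec_idx n d - p1 ` sec_rows n d - p2 ` R2 = sec_idx n d - (p1 ` sec_rows n d \<union> p2 ` R2)" by blast
    have c: "card (p1 ` sec_rows n d \<union> p2 ` R2) = card (sec_rows n d) + card R2"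
      using disj inj fin by (simp add: card_Un_disjoint card_image)
    have le: "card (sec_rows n d) + card R2 \<le> card (sec_idx n d)" using card_mono[OF fin(5) sub] c by simp
    have "card (sec_idx n d - p1 ` sec_rows n d - p2 ` R2) = card (sec_idx n d) - (card (sec_rows n d) + card R2)"
      using c sub fin by (metis Diff_Diff_Un_eq card_Diff_subset finite_subset)
    moreover have "card V \<le> card (sec_idx n d - p1 ` sec_rows n d - p2 ` R2) + card (chart_cols n d a) + card Vv"
      unfolding V_def using fin
      by (intro order_trans[OF card_Un_le] add_mono card_image_le) auto
    ultimately show ?thesis using le Vv(2) card_chart_cols[OF a] by linarith
  qed
  have pt: "rational_on V \<Omega> (\<lambda>z. d_pt z j b)" for j b
  proof (cases "(j, b) \<in> chart_cols n d a")
    case True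
    then have "Inr (Inl (j, b)) \<in> V" by (force simp: V_def)
    then show ?thesis unfolding d_pt_def by (rule rational_on_var)
  next
    case False
    then have "d_pt z j b = (if j < n \<and> b = a j then 1 else 0)" if "z \<in> \<Omega>" for z
      using \<Omega>(1)[OF that] by (auto simp: chart_cols_def chart_def not_less)
    then show ?thesis by (subst rational_on_cong) (auto intro: rational_on_const)
  qed
  have vec: "rational_on V \<Omega> (\<lambda>z. d_vec z j b)" for j b
  proof (cases "(j, b) \<in> Vv")
    case True
    then have "Inr (Inr (j, b)) \<in> V" by (force simp: V_def)
    then show ?thesis unfolding d_vec_def by (rule rational_on_var)
  next
    case False
    then show ?thesis using \<Omega>(2) by (subst rational_on_cong[of _ _ "\<lambda>_. \<kappa> (j, b)"]) (auto intro: rational_on_const)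
  qed
  have mono: "rational_on V \<Omega> (\<lambda>z. mono_at n i (d_pt z) idx)" for i idx
    unfolding mono_at_def by (intro rational_on_prod pt)
  have dmono: "rational_on V \<Omega> (\<lambda>z. dmono_at n i (d_pt z) (d_vec z) idx)" for i idx
    unfolding dmono_at_def by (intro rational_on_sum rational_on_mult rational_on_prod pt vec)
  have free: "rational_on V \<Omega> (\<lambda>z. d_sec z (i, k, idx))"
    if "(i, k) \<in> sec_rows n d" "idx \<in> multi_idx n d i - {I1 i}" "(i, k) \<in> R2 \<longrightarrow> idx \<noteq> I2 (i, k)" for i k idx
  proof -
    have "Inl (i, k, idx) \<in> V" using that by (auto simp: V_def sec_idx_def sec_rows_def p1_def p2_def)
    then show ?thesis unfolding d_sec_def by (rule rational_on_var)
  qed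
  have second: "rational_on V \<Omega> (\<lambda>z. d_sec z (i, k, I2 (i, k)))" if r: "(i, k) \<in> R2" for i k
  proof -
    define r where "r = (i, k)"
    define T where "T z = (\<Sum>idx\<in>multi_idx n d i - {I1 i} - {I2 r}. d_sec z (i, k, idx) * dmono_at n i (d_pt z) (d_vec z) idx)" for z
    have row: "(i, k) \<in> sec_rows n d" using r R2(1) by blast
    have eq: "d_sec z (i, k, I2 r) = - 1 * T z / d_vec z (fst (pv r)) (snd (pv r))" if z: "z \<in> \<Omega>" for z
    proof -
      have 1: "dmono_at n i (d_pt z) (d_vec z) (I1 i) = 0"
        unfolding I1_def using \<Omega>(3)[OF z] by (rule dmono_at_pivot)
      have 2: "dmono_at n i (d_pt z) (d_vec z) (I2 r) = d_vec z (fst (pv r)) (snd (pv r))"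
        using dmono_at_pivot_upd[where v = "d_vec z" and a = a and m = "fst (pv r)" and b = "snd (pv r)" and i = i,
            OF \<Omega>(1)[OF z]] \<Omega>(3)[OF z] R2(2)[OF r]
        by (auto simp: I2_def r_def chart_cols_def)
      have "0 = sec_deriv n d (d_sec z) (d_pt z) (d_vec z) i k" using \<Omega>(5)[OF z r] by simp
      also have "\<dots> = d_sec z (i, k, I1 i) * 0 + (d_sec z (i, k, I2 r) * d_vec z (fst (pv r)) (snd (pv r)) + T z)"
        unfolding sec_deriv_dmono_at T_def using I1 I2[OF r] 1 2
        by (subst sum.remove[of _ "I1 i"]) (auto simp: finite_multi_idx r_def sum.remove[of _ "I2 (i, k)"])
      finally show ?thesis using \<Omega>(6)[OF z r] by (simp add: r_def field_simps eq_neg_iff_add_eq_0)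
    qed
    have "rational_on V \<Omega> (\<lambda>z. - 1 * T z / d_vec z (fst (pv r)) (snd (pv r)))"
      unfolding T_def using free[OF row] \<Omega>(6) r
      by (intro rational_on_divide rational_on_mult rational_on_const rational_on_sum dmono vec) (auto simp: r_def)
    then show ?thesis using eq by (subst rational_on_cong[OF eq[unfolded r_def]]) (auto simp: r_def)
  qed
  have nonfirst: "rational_on V \<Omega> (\<lambda>z. d_sec z (i, k, idx))"
    if "(i, k) \<in> sec_rows n d" "idx \<in> multi_idx n d i - {I1 i}" for i k idx
    using free[OF that] second[of i k] by (cases "(i, k) \<in> R2 \<and> idx = I2 (i, k)") auto
  have first: "rational_on V \<Omega> (\<lambda>z. d_sec z (i, k, I1 i))" if row: "(i, k) \<in> sec_rows n d" for i k
  proof -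
    define T where "T z = (\<Sum>idx\<in>multi_idx n d i - {I1 i}. d_sec z (i, k, idx) * mono_at n i (d_pt z) idx)" for z
    have eq: "d_sec z (i, k, I1 i) = - 1 * T z" if z: "z \<in> \<Omega>" for z
    proof -
      have "0 = sec_eval n d (d_sec z) (d_pt z) i k" using \<Omega>(4)[OF z row] by simp
      also have "\<dots> = d_sec z (i, k, I1 i) * mono_at n i (d_pt z) (I1 i) + T z"
        unfolding sec_eval_mono_at T_def using I1 finite_multi_idx by (intro sum.remove) auto
      also have "mono_at n i (d_pt z) (I1 i) = 1" unfolding I1_def using \<Omega>(1)[OF z] by (rule mono_at_pivot)
      finally show ?thesis by (simp add: eq_neg_iff_add_eq_0)
    qed
    have "rational_on V \<Omega> (\<lambda>z. - 1 * T z)"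
      unfolding T_def using nonfirst[OF row]
      by (intro rational_on_mult rational_on_const rational_on_sum mono) auto
    then show ?thesis by (subst rational_on_cong[OF eq])
  qed
  have "rational_on V \<Omega> (\<lambda>z. d_sec z p)" if "p \<in> sec_idx n d" for p
  proof -
    obtain i k idx where p: "p = (i, k, idx)" by (cases p)
    then show ?thesis using that first[of i k] nonfirst[of i k idx]
      by (cases "idx = I1 i") (auto simp: sec_idx_def sec_rows_def)
  qed
  from annihilating_polynomial[OF finV fin(5) cardV this] show ?thesis by simp
qed

text \<open>Degenerate data fall into finitely many families, by chart, by an entry of the vector
  scaled to 1, and by a second entry; the product of the polynomials of all families vanishes on
  every degenerate section.\<close>

lemma degenerate_in_hypersurface:
  assumes d2: "\<And>i. i < n \<Longrightarrow> 2 \<le> d i"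
    and bal: "\<And>i. i < n \<Longrightarrow> 2 * (d i - 1) \<le> (\<Sum>j<n. d j - 1)"
  shows "\<exists>P. polynomial_fn (sec_idx n d) P \<and> (\<exists>x. P x \<noteq> 0) \<and> (\<forall>f\<in>degenerate n d. P f = 0)"
proof -
  define cols where "cols = (\<Union>a\<in>pivots n d. chart_cols n d a)"
  define \<kappa> where "\<kappa> c = (\<lambda>q. if q = c then 1 else 0 :: complex)" for c :: "nat \<times> nat"
  \<comment> \<open>\<open>c\<close> is the entry equal to 1. If \<open>c'\<close> lies in another
    factor it marks a second nonzero entry; a \<open>c'\<close> in the same factor encodes that the
    vector is supported in that factor alone.\<close>
  define \<Omega> where "\<Omega> a c c' = {z. a \<in> pivots n d \<and> c \<in> chart_cols n d a \<and> c' \<in> chart_cols n d a \<and>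
     d_pt z \<in> chart n d a \<and> d_vec z \<in> chart_tan n d a \<and>
     (\<forall>i<n. \<forall>k<d i - 1. sec_eval n d (d_sec z) (d_pt z) i k = 0 \<and> sec_deriv n d (d_sec z) (d_pt z) (d_vec z) i k = 0) \<and>
     d_vec z (fst c) (snd c) = 1 \<and>
     (if fst c = fst c' then \<forall>j b. j \<noteq> fst c \<longrightarrow> d_vec z j b = 0 else d_vec z (fst c') (snd c') \<noteq> 0)}" for a c c'
  have \<Omega>D: "d_pt z \<in> chart n d a" "d_vec z \<in> chart_tan n d a" "d_vec z (fst c) (snd c) = 1"
    "\<And>i k. (i, k) \<in> sec_rows n d \<Longrightarrow> sec_eval n d (d_sec z) (d_pt z) i k = 0"
    "\<And>i k. (i, k) \<in> sec_rows n d \<Longrightarrow> sec_deriv n d (d_sec z) (d_pt z) (d_vec z) i k = 0"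
    "fst c \<noteq> fst c' \<Longrightarrow> d_vec z (fst c') (snd c') \<noteq> 0"
    "\<And>j b. fst c = fst c' \<Longrightarrow> j \<noteq> fst c \<Longrightarrow> d_vec z j b = 0"
    if "z \<in> \<Omega> a c c'" for z a c c'
    using that unfolding \<Omega>_def sec_rows_def by (auto split: if_splits)
  have \<Omega>0: "d_vec z j b = 0" if "z \<in> \<Omega> a c c'" "(j, b) \<notin> chart_cols n d a" for z a c c' j b
    using \<Omega>D(2)[OF that(1)] that(2) by (simp add: chart_tan_def)
  have ann: "\<exists>P. polynomial_fn (sec_idx n d) P \<and> (\<exists>x. P x \<noteq> 0) \<and> (\<forall>z\<in>\<Omega> a c c'. P (d_sec z) = 0)" for a c c'
  proof (cases "a \<in> pivots n d \<and> c \<in> chart_cols n d a \<and> c' \<in> chart_cols n d a")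
    case False
    then have "\<Omega> a c c' = {}" by (auto simp: \<Omega>_def)
    then show ?thesis by (intro exI[of _ "\<lambda>_. 1"]) auto
  next
    case True
    then have a: "a \<in> pivots n d" and c: "c \<in> chart_cols n d a" and c': "c' \<in> chart_cols n d a" by auto
    have zero: "d_vec z j (a j) = 0" if "z \<in> \<Omega> a c c'" for z j
      by (rule \<Omega>0[OF that]) (simp add: chart_cols_def)
    show ?thesis
    proof (cases "fst c = fst c'")
      case two: False
      \<comment> \<open>A row does not involve its own factor. With nonzero entries in two factors,
        at least one of them is usable in any given row, so all rows supply a derivative
        equation.\<close>
      define pv where "pv = (\<lambda>r :: nat \<times> nat. if fst r \<noteq> fst c then c else c')"
      show ?thesis
      proof (rule degenerate_family_annihilated[OF a, of "sec_rows n d" pv "chart_cols n d a - {c}" _ "\<kappa> c"])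
        show "card (chart_cols n d a - {c}) < card (sec_rows n d)"
          using card_Diff1_less[OF finite_chart_cols c] card_chart_cols[OF a] by simp
        show "d_vec z j b = \<kappa> c (j, b)" if "z \<in> \<Omega> a c c'" "(j, b) \<notin> chart_cols n d a - {c}" for z j b
          using \<Omega>0[OF that(1), of j b] \<Omega>D(3)[OF that(1)] that(2) by (cases "(j, b) = c") (auto simp: \<kappa>_def)
        show "d_vec z (fst (pv r)) (snd (pv r)) \<noteq> 0" if "z \<in> \<Omega> a c c'" for z r
          using \<Omega>D(3,6)[OF that] two by (simp add: pv_def)
        show "pv r \<in> chart_cols n d a \<and> fst (pv r) \<noteq> fst r" for r
          using c c' two by (simp add: pv_def)
      qed (use \<Omega>D zero in auto)
    next
      case one: True
      define m where "m = fst c"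
      define R2 where "R2 = {r \<in> sec_rows n d. fst r \<noteq> m}"
      define Vv where "Vv = {q \<in> chart_cols n d a. fst q = m} - {c}"
      have m: "m < n" using c by (auto simp: m_def chart_cols_def)
      have "{q \<in> chart_cols n d a. fst q = m} = {m} \<times> ({..<d m} - {a m})" using m by (auto simp: chart_cols_def)
      moreover have "c \<in> {q \<in> chart_cols n d a. fst q = m}" using c by (simp add: m_def)
      moreover have "a m < d m" using a m by (simp add: pivots_def)
      ultimately have cVv: "card Vv = d m - 2" unfolding Vv_def by (simp add: card_cartesian_product)
      have "R2 = sec_rows n d - {m} \<times> {..<d m - 1}" using m by (auto simp: R2_def sec_rows_def)
      moreover have "{m} \<times> {..<d m - 1} \<subseteq> sec_rows n d" using m by (auto simp: sec_rows_def)
      ultimately have "card R2 = (\<Sum>j<n. d j - 1) - (d m - 1)"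
        by (simp add: card_Diff_subset card_sec_rows card_cartesian_product)
      \<comment> \<open>This is where the balance condition enters the count:
        \<open>S - (d m - 1) \<ge> d m - 1 > d m - 2\<close>.\<close>
      then have less: "card Vv < card R2" using cVv bal[OF m] d2[OF m] by linarith
      show ?thesis
      proof (rule degenerate_family_annihilated[OF a, of R2 "\<lambda>_. c" Vv _ "\<kappa> c"])
        show "d_vec z j b = \<kappa> c (j, b)" if "z \<in> \<Omega> a c c'" "(j, b) \<notin> Vv" for z j b
          using \<Omega>0[OF that(1), of j b] \<Omega>D(3)[OF that(1)] \<Omega>D(7)[OF that(1) one, of j b] that(2)
          by (cases "(j, b) = c") (auto simp: \<kappa>_def Vv_def m_def)
        show "sec_deriv n d (d_sec z) (d_pt z) (d_vec z) i k = 0" if "z \<in> \<Omega> a c c'" "(i, k) \<in> R2" for z i k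
          using \<Omega>D(5)[OF that(1)] that(2) by (simp add: R2_def)
        show "c \<in> chart_cols n d a \<and> fst c \<noteq> fst r" if "r \<in> R2" for r
          using c that by (simp add: R2_def m_def)
      qed (use \<Omega>D zero less in \<open>auto simp: R2_def Vv_def\<close>)
    qed
  qed
  define D where "D = (\<lambda>(a, c, c'). d_sec ` \<Omega> a c c')"
  have fin: "finite (pivots n d \<times> cols \<times> cols)"
    by (auto simp: cols_def finite_pivots finite_chart_cols)
  obtain P where P: "polynomial_fn (sec_idx n d) P" "\<exists>x. P x \<noteq> 0" "\<forall>z\<in>\<Union>(D ` (pivots n d \<times> cols \<times> cols)). P z = 0"
    using ann by (atomize_elim, intro common_annihilating_polynomial[OF fin]) (auto simp: D_def)
  have "f \<in> \<Union>(D ` (pivots n d \<times> cols \<times> cols))" if "f \<in> degenerate n d" for f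
  proof -
    from degenerate_normal_form[OF that] obtain a x v m b where *: "a \<in> pivots n d" "x \<in> chart n d a"
      "v \<in> chart_tan n d a" "(m, b) \<in> chart_cols n d a" "v m b = 1"
      "\<forall>i<n. \<forall>k<d i - 1. sec_eval n d f x i k = 0 \<and> sec_deriv n d f x v i k = 0" by blast
    obtain c' where c': "c' \<in> chart_cols n d a"
      "if m = fst c' then \<forall>j b. j \<noteq> m \<longrightarrow> v j b = 0 else v (fst c') (snd c') \<noteq> 0"
    proof (cases "\<forall>j b. j \<noteq> m \<longrightarrow> v j b = 0")
      case True
      then show thesis using that[of "(m, b)"] * by auto
    next
      case False
      then obtain j l where "j \<noteq> m" "v j l \<noteq> 0" by blast
      then show thesis using that[of "(j, l)"] *(3) by (auto simp: chart_tan_def)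
    qed
    define z where "z = datum f x v"
    note z = datum_simps[of f x v, folded z_def]
    have "z \<in> \<Omega> a (m, b) c'" using * c' by (auto simp: \<Omega>_def z)
    then have "f \<in> D (a, (m, b), c')" using z(1) by (auto simp: D_def)
    moreover have "(a, (m, b), c') \<in> pivots n d \<times> cols \<times> cols" using * c' by (auto simp: cols_def)
    ultimately show ?thesis by blast
  qed
  then have "\<forall>f\<in>degenerate n d. P f = 0" using P(3) by blast
  with P(1,2) show ?thesis by (intro exI[of _ P] conjI)
qed

subsection \<open>Compactness arguments\<close>

lemma continuous_on_sec_eval:
  assumes "continuous_on A f" "continuous_on A x"
  shows "continuous_on A (\<lambda>u. sec_eval n d (f u) (x u) i k)"
  unfolding sec_eval_def
  by (intro continuous_on_sum continuous_on_mult continuous_on_prod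
      continuous_on_product_then_coordinatewise[OF assms(1)]
      continuous_on_product_then_coordinatewise[OF continuous_on_product_then_coordinatewise[OF assms(2)]])

lemma continuous_on_datum:
  assumes "continuous_on A f" "continuous_on A x" "continuous_on A v"
  shows "continuous_on A (\<lambda>u. datum (f u) (x u) (v u))"
proof (rule continuous_on_coordinatewise_then_product)
  fix q :: datum_index
  show "continuous_on A (\<lambda>u. datum (f u) (x u) (v u) q)"
  proof -
    have "continuous_on A (\<lambda>u. f u p)" "continuous_on A (\<lambda>u. x u j b)" "continuous_on A (\<lambda>u. v u j b)" for p j b
      by (rule continuous_on_product_then_coordinatewise[OF assms(1)]
        continuous_on_product_then_coordinatewise[OF continuous_on_product_then_coordinatewise[OF assms(2)]]
        continuous_on_product_then_coordinatewise[OF continuous_on_product_then_coordinatewise[OF assms(3)]])+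
    then show ?thesis by (cases q rule: sum.exhaust[case_names sec rest]; (cases "case q of Inr s \<Rightarrow> s")?) (auto simp: datum_def)
  qed
qed

definition datum_vars :: "nat \<Rightarrow> (nat \<Rightarrow> nat) \<Rightarrow> datum_index set" where
  "datum_vars n d = Inl ` sec_idx n d \<union> (Inr \<circ> Inl) ` Sigma {..<n} (\<lambda>j. {..<d j}) \<union> (Inr \<circ> Inr) ` Sigma {..<n} (\<lambda>j. {..<d j})"

lemma finite_datum_vars: "finite (datum_vars n d)"
  by (auto simp: datum_vars_def finite_sec_idx)

lemma polynomial_fn_datum_vars:
  "p \<in> sec_idx n d \<Longrightarrow> polynomial_fn (datum_vars n d) (\<lambda>z. d_sec z p)"
  "j < n \<Longrightarrow> b < d j \<Longrightarrow> polynomial_fn (datum_vars n d) (\<lambda>z. d_pt z j b)"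
  "j < n \<Longrightarrow> b < d j \<Longrightarrow> polynomial_fn (datum_vars n d) (\<lambda>z. d_vec z j b)"
  unfolding d_sec_def d_pt_def d_vec_def by (rule polynomial_fn_var, force simp: datum_vars_def)+

lemma polynomial_fn_sec_eval:
  assumes "(i, k) \<in> sec_rows n d"
  shows "polynomial_fn (datum_vars n d) (\<lambda>z. sec_eval n d (d_sec z) (d_pt z) i k)"
  using assms unfolding sec_eval_def
  by (intro polynomial_fn_sum polynomial_fn_mult polynomial_fn_prod polynomial_fn_datum_vars)
     (auto simp: sec_idx_def sec_rows_def multi_idx_def)

lemma polynomial_fn_sec_deriv:
  assumes "(i, k) \<in> sec_rows n d"
  shows "polynomial_fn (datum_vars n d) (\<lambda>z. sec_deriv n d (d_sec z) (d_pt z) (d_vec z) i k)"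
  using assms unfolding sec_deriv_def
  by (intro polynomial_fn_sum polynomial_fn_mult polynomial_fn_prod polynomial_fn_datum_vars)
     (auto simp: sec_idx_def sec_rows_def multi_idx_def)

lemma open_split_at_pair:
  assumes "open X" "(a, b) \<in> X"
  obtains A B where "open A" "open B" "a \<in> A" "b \<in> B" "A \<times> B \<subseteq> X"
  using open_prod_elim[OF assms] by (metis mem_Sigma_iff)

lemma chart_agree_off_cols:
  "x \<in> chart n d a \<Longrightarrow> y \<in> chart n d a \<Longrightarrow> (j, b) \<notin> chart_cols n d a \<Longrightarrow> x j b = y j b"
  by (cases "j < n \<and> b < d j") (auto simp: chart_def chart_cols_def not_less)

text \<open>The neighbourhood \<open>B\<close> is uniform in \<open>f\<close>, because section and
  zero will be varied together.\<close>

definition sec_eval_inj_near where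
  "sec_eval_inj_near n d a f0 x0 \<longleftrightarrow> (\<exists>A B. open A \<and> open B \<and> f0 \<in> A \<and> x0 \<in> B \<and> (\<forall>f\<in>A. \<forall>x\<in>B \<inter> chart n d a. \<forall>y\<in>B \<inter> chart n d a.
    (\<forall>(i, k)\<in>sec_rows n d. sec_eval n d f x i k = sec_eval n d f y i k) \<longrightarrow> x = y))"

text \<open>An instance of \<open>polynomial_map_locally_injective\<close> in which only the chart
  coordinates of the point may differ; the coefficients of the section are shared parameters and the
  vector is kept at 0.\<close>

lemma sec_eval_locally_injective:
  assumes x0: "x0 \<in> chart n d a"
    and ker: "\<And>v. v \<in> chart_tan n d a \<Longrightarrow> (\<And>i k. (i, k) \<in> sec_rows n d \<Longrightarrow> sec_deriv n d f0 x0 v i k = 0) \<Longrightarrow> v = (\<lambda>_ _. 0)"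
  shows "sec_eval_inj_near n d a f0 x0"
proof -
  define F where "F = (\<lambda>(i, k) z. sec_eval n d (d_sec z) (d_pt z) i k)"
  define C :: "datum_index set" where "C = (Inr \<circ> Inl) ` chart_cols n d a"
  define z0 where "z0 = datum f0 x0 (\<lambda>_ _. 0)"
  have CV: "C \<subseteq> datum_vars n d" by (auto simp: C_def datum_vars_def chart_cols_def)
  have poly: "polynomial_fn (datum_vars n d) (F r)" if "r \<in> sec_rows n d" for r
    using polynomial_fn_sec_eval[of "fst r" "snd r"] that by (simp add: F_def case_prod_unfold)
  have kerF: "w = (\<lambda>_. 0)" if w: "w \<in> supported C"
    and dF: "\<And>r. r \<in> sec_rows n d \<Longrightarrow> ((\<lambda>t. F r (\<lambda>p. z0 p + t * w p)) has_field_derivative 0) (at 0)" for w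
  proof -
    have 1: "d_sec (\<lambda>p. z0 p + t * w p) = f0" for t
      using w by (auto simp: z0_def d_sec_def datum_def supported_def C_def fun_eq_iff)
    have 2: "d_pt (\<lambda>p. z0 p + t * w p) = (\<lambda>j b. x0 j b + t * d_pt w j b)" for t
      by (auto simp: z0_def d_pt_def datum_def fun_eq_iff)
    have "Inr (Inl (j, b)) \<notin> C" if "(j, b) \<notin> chart_cols n d a" for j b using that by (auto simp: C_def)
    then have tan: "d_pt w \<in> chart_tan n d a" using w by (simp add: chart_tan_def d_pt_def supported_def)
    have "d_pt w = (\<lambda>_ _. 0)"
    proof (rule ker[OF tan])
      fix i k assume "(i, k) \<in> sec_rows n d"
      from dF[OF this] have "((\<lambda>t. sec_eval n d f0 (\<lambda>j b. x0 j b + t * d_pt w j b) i k) has_field_derivative 0) (at 0)"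
        by (simp add: F_def 1 2)
      then show "sec_deriv n d f0 x0 (d_pt w) i k = 0"
        using has_field_derivative_sec_eval DERIV_unique by blast
    qed
    then have "w (Inr (Inl q)) = 0" for q by (cases q) (auto simp: d_pt_def fun_eq_iff)
    then have "w q = 0" for q using w by (cases "q \<in> C") (auto simp: C_def supported_def)
    then show ?thesis by blast
  qed
  have "\<exists>W. open W \<and> z0 \<in> W \<and> (\<forall>z\<in>W. \<forall>z'\<in>W. (\<forall>p. p \<notin> C \<longrightarrow> z p = z' p) \<longrightarrow>
    (\<forall>r\<in>sec_rows n d. F r z = F r z') \<longrightarrow> z = z')"
    by (rule polynomial_map_locally_injective[OF finite_datum_vars CV]) (use poly kerF in auto)
  then obtain W where W: "open W" "z0 \<in> W" "\<forall>z\<in>W. \<forall>z'\<in>W. (\<forall>p. p \<notin> C \<longrightarrow> z p = z' p) \<longrightarrow>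
    (\<forall>r\<in>sec_rows n d. F r z = F r z') \<longrightarrow> z = z'" by (elim exE conjE)
  define \<phi> where "\<phi> u = datum (fst u) (snd u) (\<lambda>_ _. 0)" for u
  have "continuous_on UNIV \<phi>" unfolding \<phi>_def
    by (intro continuous_on_datum continuous_on_fst continuous_on_snd continuous_on_id continuous_on_const)
  then have "open (\<phi> -` W)" using W(1) by (rule open_vimage[rotated])
  moreover have "(f0, x0) \<in> \<phi> -` W" using W(2) by (simp add: \<phi>_def z0_def)
  ultimately obtain A B where AB: "open A" "open B" "f0 \<in> A" "x0 \<in> B" "A \<times> B \<subseteq> \<phi> -` W" by (rule open_split_at_pair)
  show ?thesis unfolding sec_eval_inj_near_def
  proof (intro exI[of _ A] exI[of _ B] conjI ballI impI)
    fix f x y assume *: "f \<in> A" "x \<in> B \<inter> chart n d a" "y \<in> B \<inter> chart n d a"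
      and eq: "\<forall>(i, k)\<in>sec_rows n d. sec_eval n d f x i k = sec_eval n d f y i k"
    have "datum f x (\<lambda>_ _. 0) = datum f y (\<lambda>_ _. 0)"
    proof (rule W(3)[rule_format])
      show "datum f x (\<lambda>_ _. 0) \<in> W" "datum f y (\<lambda>_ _. 0) \<in> W" using * AB(5) by (auto simp: \<phi>_def subset_eq)
      show "datum f x (\<lambda>_ _. 0) p = datum f y (\<lambda>_ _. 0) p" if "p \<notin> C" for p
        using * chart_agree_off_cols[of x n d a y] that by (auto simp: C_def datum_def split: sum.split prod.split)
      show "F r (datum f x (\<lambda>_ _. 0)) = F r (datum f y (\<lambda>_ _. 0))" if "r \<in> sec_rows n d" for r
        using eq that by (auto simp: F_def case_prod_unfold)
    qed
    then show "x = y" by (metis datum_simps(2))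
  qed (use AB in auto)
qed

section \<open>A compact cover of the product of projective spaces\<close>

definition unit_chart :: "nat \<Rightarrow> (nat \<Rightarrow> nat) \<Rightarrow> (nat \<Rightarrow> nat) \<Rightarrow> (nat \<Rightarrow> nat \<Rightarrow> complex) set" where
  "unit_chart n d a = {x. \<forall>j b. x j b \<in> (if j < n \<and> b < d j then if b = a j then {1} else cball 0 1 else {0})}"

lemma compact_unit_chart: "compact (unit_chart n d a)"
proof -
  have "compact {y. \<forall>b. y b \<in> (if j < n \<and> b < d j then if b = a j then {1} else cball 0 1 else {0::complex})}" for j
    by (rule compact_product) auto
  from compact_product[of "\<lambda>j. {y. \<forall>b. y b \<in> (if j < n \<and> b < d j then if b = a j then {1} else cball 0 1 else {0::complex})}", OF this]
  show ?thesis by (simp add: unit_chart_def)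
qed

lemma unit_chart_subset: "a \<in> pivots n d \<Longrightarrow> unit_chart n d a \<subseteq> chart n d a"
  by (auto simp: unit_chart_def chart_def pivots_def not_less split: if_splits) (metis singletonD)

lemma chart_subset_cone_pts: "a \<in> pivots n d \<Longrightarrow> chart n d a \<subseteq> cone_pts n d"
  unfolding chart_def cone_pts_def pivots_def by force

lemma zero_set_unit_chart:
  assumes "x \<in> zero_set n d f"
  shows "\<exists>a\<in>pivots n d. \<exists>c. (\<forall>j<n. c j \<noteq> 0) \<and> (\<lambda>j b. c j * x j b) \<in> unit_chart n d a \<inter> zero_set n d f"
proof -
  have xc: "x \<in> cone_pts n d" using assms by (simp add: zero_set_def)
  obtain a where a: "a \<in> pivots n d" "(\<lambda>j b. inverse (x j (a j)) * x j b) \<in> chart n d a" "\<forall>j<n. x j (a j) \<noteq> 0"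
    "\<forall>j<n. \<forall>b. cmod (inverse (x j (a j)) * x j b) \<le> 1" using cone_pts_chart[OF xc] by blast
  define c where "c j = inverse (x j (a j))" for j
  define y where "y = (\<lambda>j b. c j * x j b)"
  have "y \<in> chart n d a" "\<forall>j<n. \<forall>b. cmod (y j b) \<le> 1" using a by (auto simp: y_def c_def)
  then have "y \<in> unit_chart n d a" by (auto simp: unit_chart_def chart_def)
  moreover have "y \<in> zero_set n d f"
    using assms \<open>y \<in> chart n d a\<close> chart_subset_cone_pts[OF a(1)]
    by (auto simp: zero_set_def y_def sec_eval_scale)
  moreover have "\<forall>j<n. c j \<noteq> 0" using a(3) by (simp add: c_def)
  ultimately show ?thesis using a(1) unfolding y_def by blast
qed

text \<open>Up to scaling all zeros lie in the compact union of the unit charts. At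
  \<open>f0\<close> some equation is nonzero at each point of it, and the tube lemma extends this to
  nearby \<open>f\<close>.\<close>

lemma open_no_zero: "open {f. zero_set n d f = {}}"
proof (subst open_subopen, intro ballI)
  fix f0 assume "f0 \<in> {f. zero_set n d f = {}}"
  then have f0: "zero_set n d f0 = {}" by simp
  define K where "K = (\<Union>a\<in>pivots n d. unit_chart n d a)"
  have K: "compact K" unfolding K_def by (intro compact_UN finite_pivots compact_unit_chart)
  have Kc: "K \<subseteq> cone_pts n d" using unit_chart_subset chart_subset_cone_pts by (fastforce simp: K_def)
  define X where "X = (\<Union>r\<in>sec_rows n d. (\<lambda>u. sec_eval n d (fst u) (snd u) (fst r) (snd r)) -` (- {0}))"
  have oX: "open X" unfolding X_def
    by (intro open_UN ballI open_vimage continuous_on_sec_eval continuous_on_fst continuous_on_snd continuous_on_id) auto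
  have "{f0} \<times> K \<subseteq> X"
    using f0 Kc by (force simp: X_def zero_set_def sec_rows_def)
  from Elementary_Topology.tube_lemma[OF K oX this]
  obtain Y where Y: "f0 \<in> Y" "open Y" "Y \<times> K \<subseteq> X" by (elim exE conjE)
  have "Y \<subseteq> {f. zero_set n d f = {}}"
  proof (intro subsetI CollectI, rule ccontr)
    fix f assume f: "f \<in> Y" "zero_set n d f \<noteq> {}"
    then obtain a y where "a \<in> pivots n d" "y \<in> unit_chart n d a" "y \<in> zero_set n d f"
      using zero_set_unit_chart by blast
    then have "y \<in> K" by (auto simp: K_def)
    then have "(f, y) \<in> X" using Y(3) f(1) by blast
    then show False using \<open>y \<in> zero_set n d f\<close> by (auto simp: X_def zero_set_def sec_rows_def)
  qed
  then show "\<exists>T. open T \<and> f0 \<in> T \<and> T \<subseteq> {f. zero_set n d f = {}}" using Y by blast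
qed

text \<open>An Euler direction tangent to the chart is zero: its pivot entries vanish while those of
  \<open>x\<close> are 1.\<close>

lemma nondegenerate_chart_kernel:
  assumes "f \<notin> degenerate n d" "a \<in> pivots n d" "x \<in> chart n d a" "x \<in> zero_set n d f" "v \<in> chart_tan n d a"
    and "\<And>i k. (i, k) \<in> sec_rows n d \<Longrightarrow> sec_deriv n d f x v i k = 0"
  shows "v = (\<lambda>_ _. 0)"
proof -
  have "v \<in> tan_vecs n d" using assms(5) by (auto simp: tan_vecs_def chart_tan_def chart_cols_def)
  moreover have "\<forall>i<n. \<forall>k<d i - 1. sec_deriv n d f x v i k = 0" using assms(6) by (simp add: sec_rows_def)
  ultimately obtain c where c: "\<forall>j<n. \<forall>b. v j b = c j * x j b"
    using assms(1,4) unfolding degenerate_def by blast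
  have "v j b = 0" for j b
  proof (cases "j < n")
    case True
    have "v j (a j) = 0" using assms(5) by (simp add: chart_tan_def chart_cols_def)
    then have "c j * x j (a j) = 0" using c True by metis
    then show ?thesis using assms(3) c True by (simp add: chart_def)
  next
    case False then show ?thesis using assms(5) by (auto simp: chart_tan_def chart_cols_def)
  qed
  then show ?thesis by blast
qed

text \<open>The zeros in a unit chart form a compact set, and by local injectivity each of them is
  isolated. Finitely many charts meet every projective class.\<close>

lemma finite_zeros_nondegenerate:
  assumes "f \<notin> degenerate n d"
  shows "finite (zero_set n d f // proj_rel n d)"
proof -
  define Z where "Z a = unit_chart n d a \<inter> (\<Inter>r\<in>sec_rows n d. {x. sec_eval n d f x (fst r) (snd r) = 0})" for a
  have Zz: "x \<in> zero_set n d f" if "a \<in> pivots n d" "x \<in> Z a" for a x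
    using that unit_chart_subset chart_subset_cone_pts by (fastforce simp: Z_def zero_set_def sec_rows_def)
  have fin: "finite (Z a)" if a: "a \<in> pivots n d" for a
  proof -
    have "closed (\<Inter>r\<in>sec_rows n d. {x. sec_eval n d f x (fst r) (snd r) = 0})"
      by (intro closed_INT ballI closed_Collect_eq continuous_on_sec_eval continuous_on_const continuous_on_id)
    then have Zc: "compact (Z a)" unfolding Z_def by (intro compact_Int_closed compact_unit_chart)
    have "\<exists>B. open B \<and> x \<in> B \<and> Z a \<inter> B \<subseteq> {x}" if x: "x \<in> Z a" for x
    proof -
      have xa: "x \<in> chart n d a" using x unit_chart_subset[OF a] by (auto simp: Z_def)
      have "sec_eval_inj_near n d a f x"
        by (rule sec_eval_locally_injective[OF xa]) (rule nondegenerate_chart_kernel[OF assms a xa Zz[OF a x]])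
      then obtain A B where AB: "open A" "open B" "f \<in> A" "x \<in> B" "\<forall>f\<in>A. \<forall>x\<in>B \<inter> chart n d a. \<forall>y\<in>B \<inter> chart n d a.
        (\<forall>(i, k)\<in>sec_rows n d. sec_eval n d f x i k = sec_eval n d f y i k) \<longrightarrow> x = y"
        unfolding sec_eval_inj_near_def by (elim exE conjE)
      have "y = x" if y: "y \<in> Z a \<inter> B" for y
      proof -
        have "\<forall>(i, k)\<in>sec_rows n d. sec_eval n d f x i k = sec_eval n d f y i k"
          unfolding case_prod_unfold using x y by (simp add: Z_def)
        moreover have "x \<in> B \<inter> chart n d a" "y \<in> B \<inter> chart n d a"
          using AB(4) xa y unit_chart_subset[OF a] by (auto simp: Z_def)
        ultimately show ?thesis using AB(3,5) by blast
      qed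
      then show ?thesis using AB by blast
    qed
    then obtain B where B: "\<And>x. x \<in> Z a \<Longrightarrow> open (B x) \<and> x \<in> B x \<and> Z a \<inter> B x \<subseteq> {x}" by metis
    obtain D where "D \<subseteq> Z a" "finite D" "Z a \<subseteq> (\<Union>x\<in>D. B x)"
      by (rule compactE_image[OF Zc, of "Z a" B]) (use B in auto)
    then have "Z a \<subseteq> D" using B by fastforce
    then show ?thesis using \<open>finite D\<close> finite_subset by blast
  qed
  have "zero_set n d f // proj_rel n d \<subseteq> (\<lambda>x. proj_rel n d `` {x}) ` (\<Union>a\<in>pivots n d. Z a)"
  proof
    fix X assume "X \<in> zero_set n d f // proj_rel n d"
    then obtain x where x: "x \<in> zero_set n d f" "X = proj_rel n d `` {x}" by (rule quotientE)
    obtain a c where a: "a \<in> pivots n d" "\<forall>j<n. c j \<noteq> 0" "(\<lambda>j b. c j * x j b) \<in> unit_chart n d a \<inter> zero_set n d f"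
      using zero_set_unit_chart[OF x(1)] by blast
    define y where "y = (\<lambda>j b. c j * x j b)"
    have y: "y \<in> Z a" "y \<in> cone_pts n d" using a(3) by (auto simp: Z_def y_def zero_set_def sec_rows_def)
    have xc: "x \<in> cone_pts n d" using x by (simp add: zero_set_def)
    have "(x, w) \<in> proj_rel n d \<longleftrightarrow> (y, w) \<in> proj_rel n d" for w
    proof
      assume "(x, w) \<in> proj_rel n d"
      then obtain e where e: "w \<in> cone_pts n d" "\<forall>j<n. e j \<noteq> 0" "\<forall>j<n. \<forall>b. x j b = e j * w j b" by (auto simp: proj_rel_def)
      then show "(y, w) \<in> proj_rel n d" using y(2) a(2) unfolding proj_rel_def
        by (auto simp: y_def intro!: exI[of _ "\<lambda>j. c j * e j"])
    next
      assume "(y, w) \<in> proj_rel n d"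
      then obtain e where e: "w \<in> cone_pts n d" "\<forall>j<n. e j \<noteq> 0" "\<forall>j<n. \<forall>b. y j b = e j * w j b" by (auto simp: proj_rel_def)
      then have "\<forall>j<n. \<forall>b. x j b = (e j / c j) * w j b" using a(2) by (simp add: y_def field_simps)
      then show "(x, w) \<in> proj_rel n d" using e xc a(2) unfolding proj_rel_def
        by (auto intro!: exI[of _ "\<lambda>j. e j / c j"])
    qed
    then have "X = proj_rel n d `` {y}" using x(2) by auto
    then show "X \<in> (\<lambda>x. proj_rel n d `` {x}) ` (\<Union>a\<in>pivots n d. Z a)" using y a(1) by blast
  qed
  then show ?thesis by (rule finite_subset) (use fin finite_pivots in auto)
qed

subsection \<open>Persistence of nondegenerate zeros\<close>

definition pivot_coeff :: "nat \<Rightarrow> (nat \<Rightarrow> nat) \<Rightarrow> nat \<times> nat \<Rightarrow> sec_index" where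
  "pivot_coeff n a r = (fst r, snd r, pivot_idx n a (fst r))"

text \<open>An order-preserving identification of the row numbers \<open>k < d j - 1\<close> with
  the columns \<open>b < d j\<close> other than the pivot; it assigns a storage slot to each chart
  coordinate.\<close>

definition skip :: "nat \<Rightarrow> nat \<Rightarrow> nat" where "skip a k = (if k < a then k else Suc k)"
definition unskip :: "nat \<Rightarrow> nat \<Rightarrow> nat" where "unskip a b = (if b < a then b else b - 1)"

lemma skip_unskip: "b \<noteq> a \<Longrightarrow> skip a (unskip a b) = b" "unskip a (skip a k) = k" "skip a k \<noteq> a"
  by (auto simp: skip_def unskip_def)

lemma skip_in_cols: "(j, k) \<in> sec_rows n d \<Longrightarrow> (j, skip (a j) k) \<in> chart_cols n d a"
  by (auto simp: chart_cols_def sec_rows_def skip_def)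

lemma unskip_in_rows: "(j, b) \<in> chart_cols n d a \<Longrightarrow> a \<in> pivots n d \<Longrightarrow> (j, unskip (a j) b) \<in> sec_rows n d"
  by (auto simp: chart_cols_def sec_rows_def unskip_def pivots_def)

lemma pivot_coeff_in: "a \<in> pivots n d \<Longrightarrow> r \<in> sec_rows n d \<Longrightarrow> pivot_coeff n a r \<in> sec_idx n d"
  using pivot_idx_in[of a n d "fst r"] by (auto simp: pivot_coeff_def sec_idx_def sec_rows_def)

lemma sec_eval_pivot:
  assumes "a \<in> pivots n d" "x \<in> chart n d a"
  shows "sec_eval n d f x i k = f (pivot_coeff n a (i, k)) +
    (\<Sum>idx\<in>multi_idx n d i - {pivot_idx n a i}. f (i, k, idx) * mono_at n i x idx)"
  unfolding sec_eval_mono_at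
  by (subst sum.remove[OF finite_multi_idx pivot_idx_in[OF assms(1)]])
     (simp add: pivot_coeff_def mono_at_pivot[OF assms(2)])

text \<open>Near a nondegenerate zero, sections with a zero are parametrised by the zero together with the
  coefficients of nonpivot monomials. The map below stores the coordinates of the zero in the slots of the
  pivot coefficients, so that it becomes a locally injective self-map of the space of sections, to
  which invariance of domain applies.\<close>

lemma zeros_persist:
  assumes a: "a \<in> pivots n d" and x0: "x0 \<in> chart n d a" and f0: "f0 \<in> sections n d"
    and zero: "\<And>i k. (i, k) \<in> sec_rows n d \<Longrightarrow> sec_eval n d f0 x0 i k = 0"
    and inj: "sec_eval_inj_near n d a f0 x0"
  shows "\<exists>Y. open Y \<and> f0 \<in> Y \<and> (\<forall>f\<in>Y \<inter> sections n d. zero_set n d f \<noteq> {})"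
proof -
  from inj obtain A B where AB: "open A" "open B" "f0 \<in> A" "x0 \<in> B" "\<forall>f\<in>A. \<forall>x\<in>B \<inter> chart n d a. \<forall>y\<in>B \<inter> chart n d a.
    (\<forall>(i, k)\<in>sec_rows n d. sec_eval n d f x i k = sec_eval n d f y i k) \<longrightarrow> x = y"
    unfolding sec_eval_inj_near_def by (elim exE conjE)
  define X :: "(sec_index \<Rightarrow> complex) \<Rightarrow> nat \<Rightarrow> nat \<Rightarrow> complex" where
    "X h j b = (if (j, b) \<in> chart_cols n d a then h (pivot_coeff n a (j, unskip (a j) b))
      else if j < n \<and> b = a j then 1 else 0)" for h j b
  define rest where "rest h r = (\<Sum>idx\<in>multi_idx n d (fst r) - {pivot_idx n a (fst r)}.
      h (fst r, snd r, idx) * mono_at n (fst r) (X h) idx)" for h r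
  \<comment> \<open>\<open>\<Theta> h\<close> is the section with the nonpivot coefficients of
    \<open>h\<close> whose pivot coefficients make it vanish at the stored point
    \<open>X h\<close>.\<close>
  define \<Theta> where "\<Theta> h p = (if p \<in> pivot_coeff n a ` sec_rows n d then - rest h (fst p, fst (snd p)) else h p)" for h p
  have Xchart: "X h \<in> chart n d a" for h
    using a by (auto simp: X_def chart_def chart_cols_def pivots_def not_less)
  have \<Theta>_pivot: "\<Theta> h (pivot_coeff n a r) = - rest h r" if "r \<in> sec_rows n d" for h r
    using that by (auto simp: \<Theta>_def pivot_coeff_def)
  have \<Theta>_rest: "\<Theta> h (i, k, idx) = h (i, k, idx)" if "idx \<noteq> pivot_idx n a i" for h i k idx
    using that by (auto simp: \<Theta>_def pivot_coeff_def)
  have eval: "sec_eval n d (\<Theta> h) (X h) i k = 0" if r: "(i, k) \<in> sec_rows n d" for h i k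
    unfolding sec_eval_pivot[OF a Xchart] \<Theta>_pivot[OF r] by (simp add: rest_def \<Theta>_rest)
  have cX: "continuous_on UNIV (\<lambda>h. X h j b)" for j b
    unfolding X_def by (cases "(j, b) \<in> chart_cols n d a") (auto intro!: continuous_on_coordinate)
  have "continuous_on UNIV (\<lambda>h. rest h r)" for r
    unfolding rest_def mono_at_def
    by (intro continuous_on_sum continuous_on_mult continuous_on_prod cX continuous_on_coordinate)
  then have "continuous_on UNIV (\<lambda>h. \<Theta> h p)" for p
    by (cases "p \<in> pivot_coeff n a ` sec_rows n d") (auto simp: \<Theta>_def intro!: continuous_on_minus continuous_on_coordinate)
  then have c\<Theta>: "continuous_on UNIV \<Theta>" by (rule continuous_on_coordinatewise_then_product)
  have cX': "continuous_on UNIV X" using cX by (intro continuous_on_coordinatewise_then_product)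
  define N where "N = \<Theta> -` A \<inter> X -` B"
  have N: "open N" unfolding N_def using AB c\<Theta> cX' by (intro open_Int open_vimage)
  have maps: "\<Theta> ` (sections n d \<inter> N) \<subseteq> sections n d"
    using pivot_coeff_in[OF a] by (auto simp: sections_def \<Theta>_def)
  have injN: "inj_on \<Theta> (sections n d \<inter> N)"
  proof (rule inj_onI)
    fix h h' assume h: "h \<in> sections n d \<inter> N" "h' \<in> sections n d \<inter> N" "\<Theta> h = \<Theta> h'"
    \<comment> \<open>The points stored in \<open>h\<close> and \<open>h'\<close> are both zeros of
      the common section \<open>\<Theta> h\<close>, so they coincide; the remaining slots are copied
      by \<open>\<Theta>\<close>.\<close>
    have "\<forall>(i, k)\<in>sec_rows n d. sec_eval n d (\<Theta> h) (X h) i k = sec_eval n d (\<Theta> h) (X h') i k"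
      using eval[of _ _ h] eval[of _ _ h'] h(3) by auto
    moreover have "\<Theta> h \<in> A" "X h \<in> B \<inter> chart n d a" "X h' \<in> B \<inter> chart n d a"
      using h Xchart by (auto simp: N_def)
    ultimately have XX: "X h = X h'" using AB(5) by blast
    show "h = h'"
    proof
      fix p show "h p = h' p"
      proof (cases "p \<in> pivot_coeff n a ` sec_rows n d")
        case True
        then obtain j k where jk: "(j, k) \<in> sec_rows n d" "p = pivot_coeff n a (j, k)" by auto
        have "X h j (skip (a j) k) = X h' j (skip (a j) k)" using XX by simp
        then show ?thesis using skip_in_cols[OF jk(1), of a] jk(2) by (simp add: X_def skip_unskip)
      next
        case False
        then show ?thesis using fun_cong[OF h(3), of p] by (simp add: \<Theta>_def)
      qed
    qed
  qed
  have coords: "euclidean_coords (2 * card (sec_idx n d)) (sections n d :: (sec_index \<Rightarrow> complex) set)"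
    unfolding sections_eq_supported by (rule euclidean_coords_complex[OF finite_sec_idx])
  obtain Y where Y: "open Y" "\<Theta> ` (sections n d \<inter> N) = sections n d \<inter> Y"
    using invariance_of_domain_coords[OF coords coords N continuous_on_subset[OF c\<Theta>] injN maps] by blast
  \<comment> \<open>The preimage of \<open>f0\<close>: it stores \<open>x0\<close>, and the pivot
    coefficients are recovered because \<open>f0\<close> vanishes at \<open>x0\<close>.\<close>
  define h0 where "h0 p = (if p \<in> pivot_coeff n a ` sec_rows n d then x0 (fst p) (skip (a (fst p)) (fst (snd p))) else f0 p)" for p
  have Xh0: "X h0 = x0"
  proof (intro ext)
    fix j b show "X h0 j b = x0 j b"
    proof (cases "(j, b) \<in> chart_cols n d a")
      case True
      then have "pivot_coeff n a (j, unskip (a j) b) \<in> pivot_coeff n a ` sec_rows n d"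
        using unskip_in_rows[OF True a] by blast
      moreover have "b \<noteq> a j" using True by (simp add: chart_cols_def)
      ultimately show ?thesis using True by (simp add: X_def h0_def) (simp add: pivot_coeff_def skip_unskip)
    next
      case False
      then show ?thesis using chart_agree_off_cols[OF Xchart x0] by blast
    qed
  qed
  have "\<Theta> h0 = f0"
  proof
    fix p show "\<Theta> h0 p = f0 p"
    proof (cases "p \<in> pivot_coeff n a ` sec_rows n d")
      case True
      then obtain i k where ik: "(i, k) \<in> sec_rows n d" "p = pivot_coeff n a (i, k)" by auto
      have "rest h0 (i, k) = (\<Sum>idx\<in>multi_idx n d i - {pivot_idx n a i}. f0 (i, k, idx) * mono_at n i x0 idx)"
        unfolding rest_def Xh0 by (intro sum.cong) (auto simp: h0_def pivot_coeff_def)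
      then show ?thesis using zero[OF ik(1)] \<Theta>_pivot[OF ik(1)] unfolding sec_eval_pivot[OF a x0] ik(2)
        by (simp add: neg_eq_iff_add_eq_0 add.commute)
    next
      case False
      then show ?thesis by (simp add: \<Theta>_def h0_def)
    qed
  qed
  moreover have "h0 \<in> sections n d" using f0 pivot_coeff_in[OF a] by (auto simp: h0_def sections_def)
  ultimately have "f0 \<in> Y" using Y AB Xh0 unfolding N_def by blast
  moreover have "zero_set n d f \<noteq> {}" if "f \<in> Y \<inter> sections n d" for f
  proof -
    obtain h where "f = \<Theta> h" using Y(2) \<open>f \<in> Y \<inter> sections n d\<close> by blast
    then have "X h \<in> zero_set n d f"
      using eval Xchart chart_subset_cone_pts[OF a] by (auto simp: zero_set_def sec_rows_def)
    then show ?thesis by blast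
  qed
  ultimately show ?thesis using Y(1) by blast
qed

subsection \<open>Sections with prescribed linear part\<close>

abbreviation origin_cols :: "nat \<Rightarrow> (nat \<Rightarrow> nat) \<Rightarrow> (nat \<times> nat) set" where
  "origin_cols n d \<equiv> chart_cols n d (\<lambda>_. 0)"

definition origin :: "nat \<Rightarrow> nat \<Rightarrow> nat \<Rightarrow> complex" where
  "origin n j b = (if j < n \<and> b = 0 then 1 else 0)"

definition idx1 :: "nat \<times> nat \<Rightarrow> nat \<Rightarrow> nat" where "idx1 c = (\<lambda>_. 0)(fst c := snd c)"
definition idx2 :: "nat \<times> nat \<Rightarrow> nat \<times> nat \<Rightarrow> nat \<Rightarrow> nat" where "idx2 c c' = (\<lambda>_. 0)(fst c := snd c, fst c' := snd c')"

text \<open>In the chart at the origin, row \<open>r\<close> is the linear form with coefficients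
  \<open>A r\<close> plus \<open>B r\<close> times the product of the coordinates \<open>c0\<close>
  and \<open>c1\<close>. The evaluation lemma asks that no coordinate of the row's own factor
  occur.\<close>

definition model_section :: "nat \<Rightarrow> (nat \<Rightarrow> nat) \<Rightarrow> (nat \<times> nat \<Rightarrow> nat \<times> nat \<Rightarrow> complex) \<Rightarrow> (nat \<times> nat \<Rightarrow> complex) \<Rightarrow>
    nat \<times> nat \<Rightarrow> nat \<times> nat \<Rightarrow> sec_index \<Rightarrow> complex" where
  "model_section n d A B c0 c1 = (\<lambda>(i, k, idx). if (i, k, idx) \<in> sec_idx n d
     then (\<Sum>c\<in>origin_cols n d. A (i, k) c * of_bool (idx = idx1 c)) + B (i, k) * of_bool (idx = idx2 c0 c1) else 0)"

lemma origin_pivots: "(\<And>j. j < n \<Longrightarrow> 2 \<le> d j) \<Longrightarrow> (\<lambda>_. 0) \<in> pivots n d"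
  by (fastforce simp: pivots_def)

lemma pivot_idx_origin: "pivot_idx n (\<lambda>_. 0) i = (\<lambda>_. 0)"
  by (auto simp: pivot_idx_def)

lemma origin_in_chart: "(\<And>j. j < n \<Longrightarrow> 2 \<le> d j) \<Longrightarrow> origin n \<in> chart n d (\<lambda>_. 0)"
  by (fastforce simp: origin_def chart_def)

lemma mono_at_idx1:
  assumes "x \<in> chart n d (\<lambda>_. 0)" "fst c < n" "fst c \<noteq> i"
  shows "mono_at n i x (idx1 c) = x (fst c) (snd c)"
  using mono_at_pivot_upd[OF assms, of "snd c"] by (simp add: pivot_idx_origin idx1_def)

lemma mono_at_idx2:
  assumes x: "x \<in> chart n d (\<lambda>_. 0)" and c: "fst c < n" "fst c \<noteq> i" "fst c' < n" "fst c' \<noteq> i" "fst c \<noteq> fst c'"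
  shows "mono_at n i x (idx2 c c') = x (fst c) (snd c) * x (fst c') (snd c')"
proof -
  have 1: "fst c \<in> {..<n} - {i}" "fst c' \<in> {..<n} - {i} - {fst c}" using c by auto
  have "(\<Prod>j\<in>{..<n} - {i} - {fst c} - {fst c'}. x j (idx2 c c' j)) = 1"
    using x by (intro prod.neutral) (auto simp: idx2_def chart_def)
  then show ?thesis unfolding mono_at_def using c(5)
    by (subst prod.remove[OF _ 1(1)], simp, subst prod.remove[OF _ 1(2)]) (simp_all add: idx2_def)
qed

lemma idx1_in: "c \<in> origin_cols n d \<Longrightarrow> fst c \<noteq> i \<Longrightarrow> (\<And>j. j < n \<Longrightarrow> 2 \<le> d j) \<Longrightarrow> idx1 c \<in> multi_idx n d i"
  by (fastforce simp: idx1_def multi_idx_def chart_cols_def)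

lemma idx2_in: "c \<in> origin_cols n d \<Longrightarrow> c' \<in> origin_cols n d \<Longrightarrow> fst c \<noteq> i \<Longrightarrow> fst c' \<noteq> i \<Longrightarrow>
    (\<And>j. j < n \<Longrightarrow> 2 \<le> d j) \<Longrightarrow> idx2 c c' \<in> multi_idx n d i"
  by (fastforce simp: idx2_def multi_idx_def chart_cols_def)

lemma sum_of_bool_eq:
  assumes "finite S" "i \<in> S"
  shows "(\<Sum>j\<in>S. of_bool (j = i) * g j) = (g i :: 'a::semiring_1)"
  using assms by (simp add: of_bool_def if_distrib[of "\<lambda>x. x * _"] cong: if_cong)

lemma sec_eval_model_section:
  assumes d2: "\<And>j. j < n \<Longrightarrow> 2 \<le> d j" and x: "x \<in> chart n d (\<lambda>_. 0)" and r: "(i, k) \<in> sec_rows n d"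
    and A: "\<And>c. c \<in> origin_cols n d \<Longrightarrow> fst c = i \<Longrightarrow> A (i, k) c = 0"
    and B: "B (i, k) \<noteq> 0 \<Longrightarrow> c0 \<in> origin_cols n d \<and> c1 \<in> origin_cols n d \<and> fst c0 \<noteq> i \<and> fst c1 \<noteq> i \<and> fst c0 \<noteq> fst c1"
  shows "sec_eval n d (model_section n d A B c0 c1) x i k =
    (\<Sum>c\<in>origin_cols n d. A (i, k) c * x (fst c) (snd c)) + B (i, k) * (x (fst c0) (snd c0) * x (fst c1) (snd c1))"
proof -
  have sec: "(i, k, idx) \<in> sec_idx n d" if "idx \<in> multi_idx n d i" for idx
    using r that by (simp add: sec_idx_def sec_rows_def)
  have "sec_eval n d (model_section n d A B c0 c1) x i k =
      (\<Sum>idx\<in>multi_idx n d i. (\<Sum>c\<in>origin_cols n d. A (i, k) c * (of_bool (idx = idx1 c) * mono_at n i x idx))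
        + B (i, k) * (of_bool (idx = idx2 c0 c1) * mono_at n i x idx))"
    unfolding sec_eval_mono_at
    by (intro sum.cong refl) (simp add: model_section_def sec distrib_right sum_distrib_right mult.assoc)
  also have "\<dots> = (\<Sum>c\<in>origin_cols n d. A (i, k) c * (\<Sum>idx\<in>multi_idx n d i. of_bool (idx = idx1 c) * mono_at n i x idx))
        + B (i, k) * (\<Sum>idx\<in>multi_idx n d i. of_bool (idx = idx2 c0 c1) * mono_at n i x idx)"
    unfolding sum.distrib sum_distrib_left by (subst sum.swap) simp
  also have "(\<Sum>c\<in>origin_cols n d. A (i, k) c * (\<Sum>idx\<in>multi_idx n d i. of_bool (idx = idx1 c) * mono_at n i x idx))
      = (\<Sum>c\<in>origin_cols n d. A (i, k) c * x (fst c) (snd c))"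
  proof (rule sum.cong[OF refl])
    fix c assume c: "c \<in> origin_cols n d"
    show "A (i, k) c * (\<Sum>idx\<in>multi_idx n d i. of_bool (idx = idx1 c) * mono_at n i x idx) = A (i, k) c * x (fst c) (snd c)"
    proof (cases "fst c = i")
      case False
      have "fst c < n" using c by (auto simp: chart_cols_def)
      then show ?thesis using mono_at_idx1[OF x _ False]
        by (simp add: sum_of_bool_eq[OF finite_multi_idx idx1_in[OF c False d2]])
    qed (simp add: A[OF c])
  qed
  also have "B (i, k) * (\<Sum>idx\<in>multi_idx n d i. of_bool (idx = idx2 c0 c1) * mono_at n i x idx)
     = B (i, k) * (x (fst c0) (snd c0) * x (fst c1) (snd c1))"
  proof (cases "B (i, k) = 0")
    case False
    note b = B[OF False]
    then have "fst c0 < n" "fst c1 < n" by (auto simp: chart_cols_def)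
    then show ?thesis using mono_at_idx2[OF x, of c0 i c1] b
      by (simp add: sum_of_bool_eq[OF finite_multi_idx idx2_in[OF _ _ _ _ d2]])
  qed simp
  finally show ?thesis .
qed

lemma model_section_in_sections: "model_section n d A B c0 c1 \<in> sections n d"
  by (auto simp: model_section_def sections_def)

lemma chart_line: "x \<in> chart n d a \<Longrightarrow> v \<in> chart_tan n d a \<Longrightarrow> (\<lambda>j b. x j b + t * v j b) \<in> chart n d a"
  by (auto simp: chart_def chart_tan_def chart_cols_def)

text \<open>Obtained by differentiating the explicit value along a line inside the chart, so the
  monomials need not be inspected a second time.\<close>

lemma sec_deriv_model_section:
  assumes d2: "\<And>j. j < n \<Longrightarrow> 2 \<le> d j" and x: "x \<in> chart n d (\<lambda>_. 0)" and v: "v \<in> chart_tan n d (\<lambda>_. 0)" and r: "(i, k) \<in> sec_rows n d"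
    and A: "\<And>c. c \<in> origin_cols n d \<Longrightarrow> fst c = i \<Longrightarrow> A (i, k) c = 0"
    and B: "B (i, k) \<noteq> 0 \<Longrightarrow> c0 \<in> origin_cols n d \<and> c1 \<in> origin_cols n d \<and> fst c0 \<noteq> i \<and> fst c1 \<noteq> i \<and> fst c0 \<noteq> fst c1"
  shows "sec_deriv n d (model_section n d A B c0 c1) x v i k =
    (\<Sum>c\<in>origin_cols n d. A (i, k) c * v (fst c) (snd c)) +
    B (i, k) * (v (fst c0) (snd c0) * x (fst c1) (snd c1) + x (fst c0) (snd c0) * v (fst c1) (snd c1))"
proof -
  let ?g = "\<lambda>t. (\<Sum>c\<in>origin_cols n d. A (i, k) c * (x (fst c) (snd c) + t * v (fst c) (snd c)))
      + B (i, k) * ((x (fst c0) (snd c0) + t * v (fst c0) (snd c0)) * (x (fst c1) (snd c1) + t * v (fst c1) (snd c1)))"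
  have "(?g has_field_derivative (\<Sum>c\<in>origin_cols n d. A (i, k) c * v (fst c) (snd c)) +
    B (i, k) * (v (fst c0) (snd c0) * x (fst c1) (snd c1) + x (fst c0) (snd c0) * v (fst c1) (snd c1))) (at 0)"
    by (auto intro!: derivative_eq_intros simp: algebra_simps)
  moreover have "sec_eval n d (model_section n d A B c0 c1) (\<lambda>j b. x j b + t * v j b) i k = ?g t" for t
    by (rule sec_eval_model_section[where A = A and B = B, OF d2 chart_line[OF x v] r A B])
  ultimately show ?thesis
    using has_field_derivative_sec_eval[of n d "model_section n d A B c0 c1" x v i k] DERIV_unique by simp
qed

subsection \<open>A matching between rows and columns\<close>

text \<open>Enumerate the blocks one after the other and shift cyclically by \<open>M\<close>. No
  block is longer than \<open>M\<close>, and the shift is at most half the total length, so every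
  element leaves its block in either direction.\<close>

lemma balanced_matching:
  fixes e :: "nat \<Rightarrow> nat"
  assumes "\<And>i. i < n \<Longrightarrow> e i \<le> M" "2 * M \<le> (\<Sum>i<n. e i)"
  shows "\<exists>\<tau>. bij_betw \<tau> (Sigma {..<n} (\<lambda>i. {..<e i})) (Sigma {..<n} (\<lambda>i. {..<e i})) \<and>
    (\<forall>r\<in>Sigma {..<n} (\<lambda>i. {..<e i}). fst (\<tau> r) \<noteq> fst r)"
proof -
  define T where "T = Sigma {..<n} (\<lambda>i. {..<e i})"
  define S where "S = (\<Sum>i<n. e i)"
  define off where "off i = (\<Sum>j<i. e j)" for i
  define pos where "pos = (\<lambda>(i, k). off i + k)"
  have mono: "off i \<le> off j" if "i \<le> j" for i j
    unfolding off_def using that by (intro sum_mono2) auto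
  have lt: "off i + k < off j" if "k < e i" "i < j" for i j k
  proof -
    have "off i + k < off (Suc i)" using that by (simp add: off_def)
    also have "\<dots> \<le> off j" using that by (intro mono) simp
    finally show ?thesis .
  qed
  have inj: "inj_on pos T"
  proof (rule inj_onI, clarsimp simp: T_def pos_def)
    fix i k i' k' assume *: "k < e i" "k' < e i'" "off i + k = off i' + k'"
    have "\<not> i < i'" using lt[of k i i'] * by linarith
    moreover have "\<not> i' < i" using lt[of k' i' i] * by linarith
    ultimately show "i = i' \<and> k = k'" using * by simp
  qed
  have finT: "finite T" "card T = S" by (auto simp: T_def S_def)
  have img: "pos ` T = {..<S}"
  proof (rule card_subset_eq)
    show "pos ` T \<subseteq> {..<S}" using lt by (auto simp: T_def pos_def S_def off_def)
    show "card (pos ` T) = card {..<S}" using card_image[OF inj] finT by simp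
  qed simp
  have bp: "bij_betw pos T {..<S}" using inj img by (simp add: bij_betw_def)
  define sh where "sh p = (p + M) mod S" for p
  have "inj_on sh {..<S}"
  proof (rule inj_onI)
    fix p q assume *: "p \<in> {..<S}" "q \<in> {..<S}" "sh p = sh q"
    then have "M \<le> S" using assms(2) by (simp add: S_def)
    have "sh u = (if u + M < S then u + M else u + M - S)" if "u \<in> {..<S}" for u
      using that \<open>M \<le> S\<close> by (auto simp: sh_def le_mod_geq not_less)
    then show "p = q" using * \<open>M \<le> S\<close> by (auto split: if_splits)
  qed
  moreover have "sh ` {..<S} \<subseteq> {..<S}" by (auto simp: sh_def)
  ultimately have bs: "bij_betw sh {..<S} {..<S}"
    by (simp add: bij_betw_def endo_inj_surj)
  define \<tau> where "\<tau> = the_inv_into T pos \<circ> (sh \<circ> pos)"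
  have "bij_betw \<tau> T T" unfolding \<tau>_def
    by (intro bij_betw_trans[OF bij_betw_trans[OF bp bs]] bij_betw_the_inv_into[OF bp])
  moreover have "fst (\<tau> r) \<noteq> fst r" if r: "r \<in> T" for r
  proof
    assume eq: "fst (\<tau> r) = fst r"
    obtain i k where ik: "r = (i, k)" by (cases r)
    obtain k' where k': "\<tau> r = (i, k')" using eq ik by (cases "\<tau> r") auto
    have "\<tau> r \<in> T" using \<open>bij_betw \<tau> T T\<close> r by (auto simp: bij_betw_def)
    then have b: "i < n" "k < e i" "k' < e i" using r ik k' by (auto simp: T_def)
    have "sh (pos r) \<in> pos ` T" using bs img bp r by (auto simp: bij_betw_def)
    then have "pos (\<tau> r) = sh (pos r)" using f_the_inv_into_f[OF inj] by (simp add: \<tau>_def)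
    then have "off i + k' = (off i + k + M) mod S" using ik k' by (simp add: pos_def sh_def)
    moreover have "off i + k < S" using lt[OF b(2,1)] by (simp add: S_def off_def)
    moreover have "e i \<le> M" "2 * M \<le> S" using assms b by (auto simp: S_def)
    \<comment> \<open>Without wrapping, the position advances by \<open>M \<ge> e i\<close>; with
      wrapping it falls back by \<open>S - M \<ge> M \<ge> e i\<close>. Both leave the block
      \<open>i\<close>.\<close>
    ultimately show False using b
      by (cases "off i + k + M < S") (auto simp: le_mod_geq not_less)
  qed
  ultimately show ?thesis unfolding T_def by blast
qed

lemma row_col_matching:
  assumes bal: "\<And>i. i < n \<Longrightarrow> 2 * (d i - 1) \<le> (\<Sum>j<n. d j - 1)"
  shows "\<exists>\<sigma>. bij_betw \<sigma> (sec_rows n d) (origin_cols n d) \<and> (\<forall>r\<in>sec_rows n d. fst (\<sigma> r) \<noteq> fst r)"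
proof -
  define M where "M = (if n = 0 then 0 else Max ((\<lambda>i. d i - 1) ` {..<n}))"
  have "d i - 1 \<le> M" if "i < n" for i using that by (auto simp: M_def)
  moreover have "2 * M \<le> (\<Sum>i<n. d i - 1)"
  proof (cases "n = 0")
    case False
    then have "M \<in> (\<lambda>i. d i - 1) ` {..<n}" unfolding M_def by (auto intro!: Max_in)
    then show ?thesis using bal by auto
  qed (simp add: M_def)
  ultimately obtain \<tau> where \<tau>: "bij_betw \<tau> (sec_rows n d) (sec_rows n d)" "\<forall>r\<in>sec_rows n d. fst (\<tau> r) \<noteq> fst r"
    using balanced_matching[of n "\<lambda>i. d i - 1" M] by (auto simp: sec_rows_Sigma)
  have "bij_betw (\<lambda>(j, k). (j, Suc k)) (sec_rows n d) (origin_cols n d)"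
    by (rule bij_betw_byWitness[where f' = "\<lambda>(j, b). (j, b - 1)"]) (auto simp: sec_rows_def chart_cols_def)
  from bij_betw_trans[OF \<tau>(1) this] \<tau>(2) show ?thesis
    by (intro exI[of _ "(\<lambda>(j, k). (j, Suc k)) \<circ> \<tau>"]) (auto simp: case_prod_unfold)
qed

subsection \<open>Every section has a zero\<close>

lemma nonzero_at_supported:
  assumes "polynomial_fn I P" "P x \<noteq> 0"
  shows "\<exists>y\<in>supported I. P y \<noteq> 0"
proof -
  obtain m where "polyfn I m P" using assms by (auto simp: polynomial_fn_def)
  then have "P (\<lambda>i. if i \<in> I then x i else 0) = P x" by (rule polyfn_cong_supp) simp
  then show ?thesis using assms(2) by (intro bexI[of _ "\<lambda>i. if i \<in> I then x i else 0"]) (auto simp: supported_def)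
qed

lemma nonvanishing_dense:
  assumes "polynomial_fn I P" "P x \<noteq> 0" "open X" "z \<in> X" "z \<in> supported I"
  shows "\<exists>y\<in>X \<inter> supported I. P y \<noteq> 0"
proof -
  obtain y where y: "y \<in> supported I" "P y \<noteq> 0" using nonzero_at_supported[OF assms(1,2)] by blast
  obtain t :: real where "(\<lambda>i. z i + of_real t * (y i - z i)) \<in> X" "P (\<lambda>i. z i + of_real t * (y i - z i)) \<noteq> 0"
    using polynomial_fn_nonzero_nearby[OF assms(1) y(2) assms(3,4)] by blast
  moreover have "(\<lambda>i. z i + of_real t * (y i - z i)) \<in> supported I" using y assms(5) by (simp add: supported_def)
  ultimately show ?thesis by blast
qed

text \<open>The matching avoids the row's own factor, so its permutation matrix is the linear part
  of an actual section; it has no kernel, so the zero at the origin persists.\<close>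

lemma exists_section_persistent_zero:
  assumes d2: "\<And>i. i < n \<Longrightarrow> 2 \<le> d i"
    and bal: "\<And>i. i < n \<Longrightarrow> 2 * (d i - 1) \<le> (\<Sum>j<n. d j - 1)"
  shows "\<exists>f0\<in>sections n d. \<exists>Y. open Y \<and> f0 \<in> Y \<and> (\<forall>f\<in>Y \<inter> sections n d. zero_set n d f \<noteq> {})"
proof -
  obtain \<sigma> where \<sigma>: "bij_betw \<sigma> (sec_rows n d) (origin_cols n d)" "\<forall>r\<in>sec_rows n d. fst (\<sigma> r) \<noteq> fst r"
    using row_col_matching[OF bal] by blast
  define A where "A r c = (of_bool (c = \<sigma> r) :: complex)" for r c
  define f0 where "f0 = model_section n d A (\<lambda>_. 0) (0, 0) (0, 0)"
  have A: "A (i, k) c = 0" if "(i, k) \<in> sec_rows n d" "fst c = i" for i k c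
    using that \<sigma>(2) by (auto simp: A_def)
  have \<sigma>in: "\<sigma> r \<in> origin_cols n d" if "r \<in> sec_rows n d" for r using \<sigma>(1) that by (auto simp: bij_betw_def)
  have x0: "origin n \<in> chart n d (\<lambda>_. 0)" by (rule origin_in_chart[OF d2])
  have "sec_eval_inj_near n d (\<lambda>_. 0) f0 (origin n)"
  proof (rule sec_eval_locally_injective[OF x0])
    fix v assume v: "v \<in> chart_tan n d (\<lambda>_. 0)" and ker: "\<And>i k. (i, k) \<in> sec_rows n d \<Longrightarrow> sec_deriv n d f0 (origin n) v i k = 0"
    have "v (fst (\<sigma> r)) (snd (\<sigma> r)) = 0" if r: "r \<in> sec_rows n d" for r
    proof -
      obtain i k where ik: "r = (i, k)" by (cases r)
      have "0 = sec_deriv n d f0 (origin n) v i k" using ker r ik by simp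
      also have "\<dots> = (\<Sum>c\<in>origin_cols n d. A (i, k) c * v (fst c) (snd c))"
        unfolding f0_def using A r ik by (subst sec_deriv_model_section[OF d2 x0 v]) auto
      also have "\<dots> = v (fst (\<sigma> r)) (snd (\<sigma> r))"
        unfolding A_def ik[symmetric] by (rule sum_of_bool_eq[OF finite_chart_cols \<sigma>in[OF r]])
      finally show ?thesis by simp
    qed
    then have "v j b = 0" if "(j, b) \<in> origin_cols n d" for j b
      using \<sigma>(1) that by (metis bij_betw_imp_surj_on fst_conv imageE snd_conv)
    then show "v = (\<lambda>_ _. 0)" using v by (intro ext) (auto simp: chart_tan_def)
  qed
  moreover have "sec_eval n d f0 (origin n) i k = 0" if "(i, k) \<in> sec_rows n d" for i k
    using that A unfolding f0_def
    by (subst sec_eval_model_section[OF d2 x0]) (auto simp: origin_def chart_cols_def intro!: sum.neutral)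
  moreover have f0s: "f0 \<in> sections n d" unfolding f0_def by (rule model_section_in_sections)
  ultimately show ?thesis
    by (intro bexI[OF _ f0s] zeros_persist[OF origin_pivots[OF d2] x0])
qed

theorem zero_set_nonempty:
  assumes d2: "\<And>i. i < n \<Longrightarrow> 2 \<le> d i"
    and bal: "\<And>i. i < n \<Longrightarrow> 2 * (d i - 1) \<le> (\<Sum>j<n. d j - 1)"
    and f: "f \<in> sections n d"
  shows "zero_set n d f \<noteq> {}"
proof -
  have "\<exists>P. polynomial_fn (sec_idx n d) P \<and> (\<exists>x. P x \<noteq> 0) \<and> (\<forall>f\<in>degenerate n d. P f = 0)"
    using d2 bal by (rule degenerate_in_hypersurface)
  then obtain P x where P: "polynomial_fn (sec_idx n d) P" and x: "P x \<noteq> 0" and P0: "\<forall>f\<in>degenerate n d. P f = 0"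
    by (elim exE conjE)
  define Y where "Y = {f \<in> supported (sec_idx n d). P f \<noteq> 0}"
  \<comment> \<open>The largest open set in which every section has a zero. Being a union it is open
    at once, and that \<open>Y\<close> is covered by \<open>Z\<close> and \<open>E\<close> becomes
    the persistence of nondegenerate zeros.\<close>
  define Z where "Z = \<Union>{W. open W \<and> (\<forall>f\<in>W \<inter> sections n d. zero_set n d f \<noteq> {})}"
  define E where "E = {f. zero_set n d f = {}}"
  have conn: "connected Y" unfolding Y_def by (rule connected_nonvanishing[OF P])
  have oZ: "open Z" unfolding Z_def by (intro open_Union) auto
  have oE: "open E" unfolding E_def by (rule open_no_zero)
  have "Z \<inter> E \<inter> Y = {}" unfolding Z_def E_def Y_def sections_eq_supported by blast
  moreover have "Y \<subseteq> Z \<union> E"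
  proof
    fix f assume fY: "f \<in> Y"
    show "f \<in> Z \<union> E"
    proof (cases "zero_set n d f = {}")
      case False
      then obtain y where "y \<in> zero_set n d f" by blast
      then obtain a y where a: "a \<in> pivots n d" "y \<in> unit_chart n d a" "y \<in> zero_set n d f"
        using zero_set_unit_chart by blast
      have y: "y \<in> chart n d a" using a unit_chart_subset by blast
      have fd: "f \<notin> degenerate n d" using fY P0 by (auto simp: Y_def)
      have "sec_eval_inj_near n d a f y"
        by (rule sec_eval_locally_injective[OF y]) (rule nondegenerate_chart_kernel[OF fd a(1) y a(3)])
      moreover have "f \<in> sections n d" using fY by (simp add: Y_def sections_eq_supported)
      moreover have "sec_eval n d f y i k = 0" if "(i, k) \<in> sec_rows n d" for i k
        using a(3) that by (simp add: zero_set_def sec_rows_def)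
      ultimately have "\<exists>W. open W \<and> f \<in> W \<and> (\<forall>f\<in>W \<inter> sections n d. zero_set n d f \<noteq> {})"
        by (intro zeros_persist[OF a(1) y])
      then have "f \<in> Z" unfolding Z_def by blast
      then show ?thesis by simp
    qed (simp add: E_def)
  qed
  moreover have "Z \<inter> Y \<noteq> {}"
  proof -
    have "\<exists>f0\<in>sections n d. \<exists>W. open W \<and> f0 \<in> W \<and> (\<forall>f\<in>W \<inter> sections n d. zero_set n d f \<noteq> {})"
      using d2 bal by (rule exists_section_persistent_zero)
    then obtain f0 W where W: "f0 \<in> sections n d" "open W" "f0 \<in> W" "\<forall>f\<in>W \<inter> sections n d. zero_set n d f \<noteq> {}"
      by (elim bexE exE conjE)
    then obtain y where y: "y \<in> W \<inter> supported (sec_idx n d)" "P y \<noteq> 0"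
      using nonvanishing_dense[OF P x W(2,3)] by (auto simp: sections_eq_supported)
    moreover have "W \<subseteq> Z" using W(2,4) unfolding Z_def by blast
    ultimately show ?thesis unfolding Y_def by blast
  qed
  ultimately have EY: "E \<inter> Y = {}" using connectedD[OF conn oZ oE] by blast
  show ?thesis
  proof
    assume "zero_set n d f = {}"
    \<comment> \<open>Sections on the hypersurface are reached by density: having no zero is open,
      so it would spread to a nearby section with \<open>P\<close> nonzero.\<close>
    then have "f \<in> E" by (simp add: E_def)
    then show False using nonvanishing_dense[OF P x oE] f EY unfolding Y_def sections_eq_supported by blast
  qed
qed

subsection \<open>A simple degenerate zero\<close>

text \<open>The linear part of the fold: the matching \<open>\<sigma>\<close> gives a permutation matrix; its row \<open>r0\<close> over the column
  \<open>(0, 1)\<close> is replaced by zero, and one or two further rows are changed so that the kernel vector also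
  has a nonzero coordinate \<open>c1\<close> in another factor, as the quadratic term needs.\<close>

lemma corank_one_matrix:
  assumes n: "3 \<le> n" and d2: "\<And>i. i < n \<Longrightarrow> 2 \<le> d i"
    and mono: "\<And>i j. i \<le> j \<Longrightarrow> j < n \<Longrightarrow> d i \<le> d j"
    and bal: "\<And>i. i < n \<Longrightarrow> 2 * (d i - 1) \<le> (\<Sum>j<n. d j - 1)"
  shows "\<exists>(A :: nat \<times> nat \<Rightarrow> nat \<times> nat \<Rightarrow> complex) v r0 c1. r0 \<in> sec_rows n d \<and> c1 \<in> origin_cols n d \<and>
    fst r0 \<noteq> 0 \<and> fst c1 \<noteq> 0 \<and> fst c1 \<noteq> fst r0 \<and>
    (\<forall>r\<in>sec_rows n d. \<forall>c\<in>origin_cols n d. fst c = fst r \<longrightarrow> A r c = 0) \<and> (\<forall>c. A r0 c = 0) \<and>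
    (\<forall>r c. A r c \<in> \<real>) \<and> (\<forall>c. v c \<in> \<real>) \<and> v (0, 1) = 1 \<and> v c1 = 1 \<and>
    (\<forall>r\<in>sec_rows n d. (\<Sum>c\<in>origin_cols n d. A r c * v c) = 0) \<and>
    (\<forall>y. (\<forall>r\<in>sec_rows n d. (\<Sum>c\<in>origin_cols n d. A r c * y c) = 0) \<longrightarrow> (\<forall>c\<in>origin_cols n d. y c = y (0, 1) * v c))"
proof -
  obtain \<sigma> where \<sigma>: "bij_betw \<sigma> (sec_rows n d) (origin_cols n d)" "\<forall>r\<in>sec_rows n d. fst (\<sigma> r) \<noteq> fst r"
    using row_col_matching[OF bal] by blast
  define c0 :: "nat \<times> nat" where "c0 = (0, 1)"
  have row: "\<exists>r\<in>sec_rows n d. \<sigma> r = c" if "c \<in> origin_cols n d" for c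
    using \<sigma>(1) that unfolding bij_betw_def by (metis imageE)
  have c0: "c0 \<in> origin_cols n d" using n d2[of 0] by (auto simp: c0_def chart_cols_def)
  obtain r0 where r0: "r0 \<in> sec_rows n d" "\<sigma> r0 = c0" using row[OF c0] by blast
  have i0: "fst r0 \<noteq> 0" using \<sigma>(2)[rule_format, OF r0(1)] r0(2) by (simp add: c0_def)
  \<comment> \<open>A factor different from 0 and from that of \<open>r0\<close>; this is where
    three factors are required.\<close>
  define m1 :: nat where "m1 = (if fst r0 = 1 then 2 else 1)"
  define c1 where "c1 = (m1, 1 :: nat)"
  have c1: "c1 \<in> origin_cols n d" "fst c1 \<noteq> 0" "fst c1 \<noteq> fst r0"
    using n d2[of m1] by (auto simp: c1_def m1_def chart_cols_def)
  obtain r1 where r1: "r1 \<in> sec_rows n d" "\<sigma> r1 = c1" using row[OF c1(1)] by blast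
  \<comment> \<open>The rows of \<open>E\<close> will say that the entries at
    \<open>\<sigma> r\<close> and \<open>p r\<close> agree, linking \<open>c1\<close> back to
    \<open>c0\<close>. One link suffices unless the row of \<open>c1\<close> belongs to factor 0 and
    so cannot involve \<open>c0\<close>; then a detour through a column \<open>c2\<close> is
    made.\<close>
  obtain E p where E: "E \<subseteq> sec_rows n d - {r0}" "r1 \<in> E" "\<And>r. r \<in> E \<Longrightarrow> fst (p r) \<noteq> fst r \<and> p r \<in> insert c0 (\<sigma> ` E)"
    and chain: "\<And>y r. (\<forall>r\<in>E. y (\<sigma> r) = (y (p r) :: complex)) \<Longrightarrow> r \<in> E \<Longrightarrow> y (\<sigma> r) = y c0"
  proof (cases "fst r1 = 0")
    case False
    show thesis
      by (rule that[of "{r1}" "\<lambda>_. c0"]) (use r1 r0 c1 False in \<open>auto simp: c0_def\<close>)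
  next
    case True
    \<comment> \<open>Factors 1 and 2 alone contribute at least \<open>2 * (d 0 - 1)\<close> columns
      to \<open>K1\<close>, whereas at most \<open>d 0 - 1\<close> columns are matched with rows of
      factor 0. So some column outside factor 0 has its row outside factor 0 as well.\<close>
    define K1 where "K1 = {c \<in> origin_cols n d. fst c \<noteq> 0}"
    define K2 where "K2 = \<sigma> ` {r \<in> sec_rows n d. fst r = 0}"
    have "{c \<in> origin_cols n d. fst c = 0} = {0} \<times> ({..<d 0} - {0})" using n by (auto simp: chart_cols_def)
    then have "card {c \<in> origin_cols n d. fst c = 0} = d 0 - 1"
      using d2[of 0] n by (simp add: card_cartesian_product)
    moreover have "card (origin_cols n d) = card {c \<in> origin_cols n d. fst c = 0} + card K1"
      unfolding K1_def by (subst card_Un_disjoint[symmetric]) (auto simp: finite_chart_cols intro!: arg_cong[of _ _ card])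
    moreover have "card (origin_cols n d) = (\<Sum>j<n. d j - 1)"
      using card_chart_cols[OF origin_pivots[OF d2]] by (simp add: card_sec_rows)
    moreover have "(\<Sum>j\<in>{0, 1, 2}. d j - 1) \<le> (\<Sum>j<n. d j - 1)"
      using n by (intro sum_mono2) auto
    moreover have "d 0 \<le> d 1" "d 0 \<le> d 2" "2 \<le> d 0" using n mono d2[of 0] by auto
    ultimately have "d 0 - 1 < card K1" by simp
    moreover have "{r \<in> sec_rows n d. fst r = 0} = {0} \<times> {..<d 0 - 1}" using n by (auto simp: sec_rows_def)
    then have "card K2 \<le> d 0 - 1" unfolding K2_def by (intro order_trans[OF card_image_le]) (auto simp: card_cartesian_product)
    moreover have "finite K2" unfolding K2_def using finite_sec_rows by auto
    ultimately have "\<not> K1 \<subseteq> K2" using card_mono[of K2 K1] by linarith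
    then obtain c2 where c2: "c2 \<in> origin_cols n d" "fst c2 \<noteq> 0" "c2 \<notin> K2" by (auto simp: K1_def)
    obtain r2 where r2: "r2 \<in> sec_rows n d" "\<sigma> r2 = c2" using row[OF c2(1)] by blast
    have "fst r2 \<noteq> 0" using c2(3) r2 by (auto simp: K2_def)
    then have ne: "r1 \<noteq> r2" using True by auto
    show thesis
      by (rule that[of "{r1, r2}" "\<lambda>r. if r = r1 then c2 else c0"])
         (use r1 r2 r0 c1 c2 True ne \<open>fst r2 \<noteq> 0\<close> in \<open>auto simp: c0_def\<close>)
  qed
  \<comment> \<open>Row \<open>r0\<close> is zero, a row of \<open>E\<close> equates two entries,
    and every other row kills its matched entry. The kernel is thus the line spanned by the
    indicator of \<open>c0\<close> and the columns linked to it.\<close>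
  define A where "A r c = (of_bool (r \<noteq> r0) * (of_bool (c = \<sigma> r) - of_bool (r \<in> E) * of_bool (c = p r)) :: complex)" for r c
  define v where "v c = (of_bool (c \<in> insert c0 (\<sigma> ` E)) :: complex)" for c
  have \<sigma>in: "\<sigma> r \<in> origin_cols n d" if "r \<in> sec_rows n d" for r using \<sigma>(1) that by (auto simp: bij_betw_def)
  have pin: "p r \<in> origin_cols n d" if "r \<in> E" for r
  proof -
    have "p r = c0 \<or> (\<exists>s\<in>E. p r = \<sigma> s)" using E(3)[OF that] by auto
    then show ?thesis using c0 \<sigma>in E(1) by auto
  qed
  have inj: "\<sigma> r = \<sigma> r' \<longleftrightarrow> r = r'" if "r \<in> sec_rows n d" "r' \<in> sec_rows n d" for r r'
    using \<sigma>(1) that by (auto simp: bij_betw_def inj_on_def)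
  have sumA: "(\<Sum>c\<in>origin_cols n d. A r c * y c) = (if r = r0 then 0 else y (\<sigma> r) - (if r \<in> E then y (p r) else 0))"
    if r: "r \<in> sec_rows n d" for r y
  proof -
    have "(\<Sum>c\<in>origin_cols n d. A r c * y c) = of_bool (r \<noteq> r0) * ((\<Sum>c\<in>origin_cols n d. of_bool (c = \<sigma> r) * y c)
        - of_bool (r \<in> E) * (\<Sum>c\<in>origin_cols n d. of_bool (c = p r) * y c))"
      unfolding A_def sum_distrib_left sum_subtractf[symmetric] by (intro sum.cong) (auto simp: algebra_simps)
    then show ?thesis
      using sum_of_bool_eq[OF finite_chart_cols \<sigma>in[OF r], of y] sum_of_bool_eq[OF finite_chart_cols pin, of r y] by auto
  qed
  show ?thesis
  proof (rule exI[of _ A], rule exI[of _ v], rule exI[of _ r0], rule exI[of _ c1], intro conjI ballI allI impI)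
    show "A r c = 0" if "r \<in> sec_rows n d" "fst c = fst r" for r c
      using that \<sigma>(2) E(3)[of r] by (auto simp: A_def)
    show "v (0, 1) = 1" "v c1 = 1" using E(2) r1 by (auto simp: v_def c0_def)
    show "(\<Sum>c\<in>origin_cols n d. A r c * v c) = 0" if r: "r \<in> sec_rows n d" for r
    proof -
      have "v (\<sigma> r) = of_bool (r \<in> E)" if "r \<noteq> r0"
      proof -
        have "\<sigma> r \<noteq> c0" using inj[OF r r0(1)] r0(2) that by auto
        moreover have "\<sigma> r \<in> \<sigma> ` E \<longleftrightarrow> r \<in> E" using inj[OF r] E(1) by blast
        ultimately show ?thesis by (simp add: v_def)
      qed
      moreover have "v (p r) = 1" if "r \<in> E" using E(3)[OF that] by (auto simp: v_def)
      ultimately show ?thesis unfolding sumA[OF r] by auto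
    qed
    show "y c = y (0, 1) * v c" if y: "\<forall>r\<in>sec_rows n d. (\<Sum>c\<in>origin_cols n d. A r c * y c) = 0" and c: "c \<in> origin_cols n d" for y c
    proof -
      have eq: "y (\<sigma> r) = (if r \<in> E then y (p r) else 0)" if "r \<in> sec_rows n d" "r \<noteq> r0" for r
        using y sumA[OF that(1), of y] that by auto
      have E': "y (\<sigma> r) = y c0" if "r \<in> E" for r
      proof (rule chain[OF _ that], rule ballI)
        fix r assume "r \<in> E"
        then show "y (\<sigma> r) = y (p r)" using eq[of r] E(1) by auto
      qed
      obtain r where r: "r \<in> sec_rows n d" "\<sigma> r = c" using row[OF c] by blast
      consider "r = r0" | "r \<in> E" | "r \<noteq> r0" "r \<notin> E" by blast
      then show ?thesis
      proof cases
        case 1 then show ?thesis using r r0 by (simp add: v_def c0_def)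
      next
        case 2 then show ?thesis using E'[OF 2] r by (simp add: v_def c0_def) (use 2 in blast)
      next
        case 3
        have "c \<noteq> c0" using inj[OF r(1) r0(1)] r r0 3 by simp
        moreover have "c \<noteq> \<sigma> s" if "s \<in> E" for s using inj[OF r(1), of s] that E(1) r(2) 3(2) by auto
        ultimately have "c \<notin> insert c0 (\<sigma> ` E)" by auto
        then show ?thesis using eq[OF r(1) 3(1)] 3(2) r(2) by (simp add: v_def)
      qed
    qed
  qed (use r0 c1 i0 in \<open>auto simp: A_def v_def\<close>)
qed

section \<open>Local uniqueness of the degenerate zero\<close>

text \<open>The section is shared and the entry \<open>v 0 1\<close> is prescribed; the latter
  removes the freedom to scale the kernel vector.\<close>

definition datum_inj_near where
  "datum_inj_near n d f0 x0 v0 \<longleftrightarrow> (\<exists>W. open W \<and> datum f0 (x0) v0 \<in> W \<and> (\<forall>f x x' v v'. datum f x v \<in> W \<longrightarrow> datum f x' v' \<in> W \<longrightarrow>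
    x \<in> chart n d (\<lambda>_. 0) \<longrightarrow> x' \<in> chart n d (\<lambda>_. 0) \<longrightarrow> v \<in> chart_tan n d (\<lambda>_. 0) \<longrightarrow> v' \<in> chart_tan n d (\<lambda>_. 0) \<longrightarrow>
    v 0 1 = v' 0 1 \<longrightarrow> (\<forall>(i, k)\<in>sec_rows n d. sec_eval n d f x i k = sec_eval n d f x' i k \<and> sec_deriv n d f x v i k = sec_deriv n d f x' v' i k)
    \<longrightarrow> x = x' \<and> v = v'))"

text \<open>Linearise the system of values and derivatives at the fold. The value equations force
  the displacement of the point to be a multiple \<open>s\<close> of \<open>v0\<close>. In row
  \<open>r0\<close>, which has no linear part, the derivative equation then reads
  \<open>2 * s = 0\<close>, the second derivative of the quadratic term along \<open>v0\<close>. So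
  the point is fixed; the displacement of the vector lies in the kernel, and its entry at
  \<open>(0, 1)\<close> is 0, so it vanishes too.\<close>

lemma degenerate_zero_locally_unique:
  assumes d2: "\<And>i. i < n \<Longrightarrow> 2 \<le> d i" and n0: "0 < n"
    and A: "\<And>r c. r \<in> sec_rows n d \<Longrightarrow> c \<in> origin_cols n d \<Longrightarrow> fst c = fst r \<Longrightarrow> A r c = 0" "\<And>c. A r0 c = 0"
    and r0: "r0 \<in> sec_rows n d" "fst r0 \<noteq> 0" and c1: "c1 \<in> origin_cols n d" "fst c1 \<noteq> 0" "fst c1 \<noteq> fst r0"
    and v0: "v0 \<in> chart_tan n d (\<lambda>_. 0)" "v0 0 1 = 1" "v0 (fst c1) (snd c1) = 1"
    and ker: "\<And>y. (\<And>r. r \<in> sec_rows n d \<Longrightarrow> (\<Sum>c\<in>origin_cols n d. A r c * y c) = 0) \<Longrightarrow>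
      (\<And>c. c \<in> origin_cols n d \<Longrightarrow> y c = y (0, 1) * v0 (fst c) (snd c))"
  defines "f0 \<equiv> model_section n d A (\<lambda>r. of_bool (r = r0)) (0, 1) c1"
  shows "datum_inj_near n d f0 (origin n) v0"
proof -
  define F where "F = (\<lambda>(r, e) z. if e then sec_deriv n d (d_sec z) (d_pt z) (d_vec z) (fst r) (snd r)
    else sec_eval n d (d_sec z) (d_pt z) (fst r) (snd r))"
  define C :: "datum_index set" where "C = (Inr \<circ> Inl) ` origin_cols n d \<union> (Inr \<circ> Inr) ` (origin_cols n d - {(0, 1)})"
  define z0 where "z0 = datum f0 (origin n) v0"
  define R where "R = sec_rows n d \<times> (UNIV :: bool set)"
  have x0: "origin n \<in> chart n d (\<lambda>_. 0)" by (rule origin_in_chart[OF d2])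
  have c0: "(0, 1) \<in> origin_cols n d" using d2[OF n0] n0 by (simp add: chart_cols_def)
  have CV: "C \<subseteq> datum_vars n d" by (auto simp: C_def datum_vars_def chart_cols_def)
  have poly: "polynomial_fn (datum_vars n d) (F q)" if "q \<in> R" for q
    using that polynomial_fn_sec_eval[of "fst (fst q)" "snd (fst q)"] polynomial_fn_sec_deriv[of "fst (fst q)" "snd (fst q)"]
    by (cases "snd q") (auto simp: F_def R_def case_prod_unfold)
  have x0c: "origin n (fst c) (snd c) = 0" if "c \<in> origin_cols n d" for c
    using that by (auto simp: origin_def chart_cols_def)
  have dv: "sec_deriv n d f0 x v i k = (\<Sum>c\<in>origin_cols n d. A (i, k) c * v (fst c) (snd c)) +
    of_bool ((i, k) = r0) * (v 0 1 * x (fst c1) (snd c1) + x 0 1 * v (fst c1) (snd c1))"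
    if "(i, k) \<in> sec_rows n d" "x \<in> chart n d (\<lambda>_. 0)" "v \<in> chart_tan n d (\<lambda>_. 0)" for x v i k
  proof -
    have "sec_deriv n d f0 x v i k = (\<Sum>c\<in>origin_cols n d. A (i, k) c * v (fst c) (snd c)) +
      of_bool ((i, k) = r0) * (v (fst (0, 1 :: nat)) (snd (0 :: nat, 1)) * x (fst c1) (snd c1) + x (fst (0, 1 :: nat)) (snd (0 :: nat, 1)) * v (fst c1) (snd c1))"
      unfolding f0_def
      by (rule sec_deriv_model_section[where A = A and B = "\<lambda>r. of_bool (r = r0)", OF d2 that(2,3,1)])
         (use that A(1) c0 c1 r0(2) in \<open>auto split: if_splits\<close>)
    then show ?thesis by simp
  qed
  have kerF: "w = (\<lambda>_. 0)" if w: "w \<in> supported C"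
    and dF: "\<And>q. q \<in> R \<Longrightarrow> ((\<lambda>t. F q (\<lambda>p. z0 p + t * w p)) has_field_derivative 0) (at 0)" for w
  proof -
    have wC: "w q = 0" if "q \<notin> C" for q using w that by (simp add: supported_def)
    have 1: "d_sec (\<lambda>p. z0 p + t * w p) = f0" for t
    proof -
      have "w (Inl p) = 0" for p by (rule wC) (auto simp: C_def)
      then show ?thesis by (simp add: z0_def d_sec_def datum_def fun_eq_iff)
    qed
    define dx where "dx = d_pt w"
    define dw where "dw = d_vec w"
    have 2: "d_pt (\<lambda>p. z0 p + t * w p) = (\<lambda>j b. origin n j b + t * dx j b)"
      "d_vec (\<lambda>p. z0 p + t * w p) = (\<lambda>j b. v0 j b + t * dw j b)" for t
      by (auto simp: z0_def d_pt_def d_vec_def datum_def fun_eq_iff dx_def dw_def)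
    have "Inr (Inl (j, b)) \<notin> C" "Inr (Inr (j, b)) \<notin> C" if "(j, b) \<notin> origin_cols n d" for j b using that by (auto simp: C_def)
    then have tan: "dx \<in> chart_tan n d (\<lambda>_. 0)" "dw \<in> chart_tan n d (\<lambda>_. 0)"
      using wC by (auto simp: chart_tan_def dx_def dw_def d_pt_def d_vec_def)
    have dw0: "dw 0 1 = 0" unfolding dw_def d_vec_def by (rule wC) (auto simp: C_def)
    have row1: "(\<Sum>c\<in>origin_cols n d. A r c * dx (fst c) (snd c)) = 0" if r: "r \<in> sec_rows n d" for r
    proof -
      obtain i k where ik: "r = (i, k)" by (cases r)
      have "((\<lambda>t. F (r, False) (\<lambda>p. z0 p + t * w p)) has_field_derivative 0) (at 0)" using r by (intro dF) (simp add: R_def)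
      then have "sec_deriv n d f0 (origin n) dx i k = 0"
        using has_field_derivative_sec_eval DERIV_unique by (fastforce simp: F_def 1 2 ik)
      then show ?thesis using dv[of i k "origin n" dx] r ik x0 tan x0c[OF c1(1)] x0c[OF c0] by simp
    qed
    have dxv: "dx (fst c) (snd c) = dx 0 1 * v0 (fst c) (snd c)" if "c \<in> origin_cols n d" for c
      using ker[of "\<lambda>c. dx (fst c) (snd c)", OF row1 that] by simp
    have row2: "(\<Sum>c\<in>origin_cols n d. A r c * dw (fst c) (snd c)) + of_bool (r = r0) * (dx (fst c1) (snd c1) + dx 0 1) = 0"
      if r: "r \<in> sec_rows n d" for r
    proof -
      obtain i k where ik: "r = (i, k)" by (cases r)
      let ?g = "\<lambda>t. (\<Sum>c\<in>origin_cols n d. A r c * (v0 (fst c) (snd c) + t * dw (fst c) (snd c)))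
        + of_bool (r = r0) * ((v0 0 1 + t * dw 0 1) * (t * dx (fst c1) (snd c1)) + (t * dx 0 1) * (v0 (fst c1) (snd c1) + t * dw (fst c1) (snd c1)))"
      have "(?g has_field_derivative (\<Sum>c\<in>origin_cols n d. A r c * dw (fst c) (snd c)) + of_bool (r = r0) * (dx (fst c1) (snd c1) + dx 0 1)) (at 0)"
        by (auto intro!: derivative_eq_intros simp: v0(3) v0(2)[unfolded One_nat_def] mult.commute)
      moreover have "F (r, True) (\<lambda>p. z0 p + t * w p) = ?g t" for t
      proof -
        have "(\<lambda>j b. v0 j b + t * dw j b) \<in> chart_tan n d (\<lambda>_. 0)" using v0(1) tan by (simp add: chart_tan_def)
        then show ?thesis using dv[of i k "\<lambda>j b. origin n j b + t * dx j b" "\<lambda>j b. v0 j b + t * dw j b"] r ik chart_line[OF x0 tan(1)]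
            x0c[OF c1(1)] x0c[OF c0] by (simp add: F_def 1 2)
      qed
      moreover have "((\<lambda>t. F (r, True) (\<lambda>p. z0 p + t * w p)) has_field_derivative 0) (at 0)" using r by (intro dF) (simp add: R_def)
      ultimately show ?thesis using DERIV_unique by fastforce
    qed
    have "dx (fst c1) (snd c1) = dx 0 1" using dxv[OF c1(1)] v0(3) by simp
    then have "2 * dx 0 1 = 0" using row2[OF r0(1)] by (simp add: A(2))
    then have dx00: "dx 0 1 = 0" by simp
    then have dx0: "dx = (\<lambda>_ _. 0)" using dxv tan(1) by (fastforce simp: chart_tan_def fun_eq_iff)
    have "(\<Sum>c\<in>origin_cols n d. A r c * dw (fst c) (snd c)) = 0" if "r \<in> sec_rows n d" for r
      using row2[OF that] dx0 by simp
    then have "dw (fst c) (snd c) = dw 0 1 * v0 (fst c) (snd c)" if "c \<in> origin_cols n d" for c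
      using ker[of "\<lambda>c. dw (fst c) (snd c)", OF _ that] by simp
    then have dw0: "dw = (\<lambda>_ _. 0)" using dw0 tan(2) by (fastforce simp: chart_tan_def fun_eq_iff)
    have "w (Inr (Inl q)) = 0" for q using dx0 by (cases q) (auto simp: dx_def d_pt_def fun_eq_iff)
    moreover have "w (Inr (Inr q)) = 0" for q using dw0 by (cases q) (auto simp: dw_def d_vec_def fun_eq_iff)
    ultimately have "w q = 0" for q using wC by (cases "q \<in> C") (auto simp: C_def)
    then show ?thesis by blast
  qed
  have "\<exists>W. open W \<and> z0 \<in> W \<and> (\<forall>z\<in>W. \<forall>z'\<in>W. (\<forall>p. p \<notin> C \<longrightarrow> z p = z' p) \<longrightarrow> (\<forall>q\<in>R. F q z = F q z') \<longrightarrow> z = z')"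
    by (rule polynomial_map_locally_injective[OF finite_datum_vars CV]) (use poly kerF in auto)
  then obtain W where W: "open W" "z0 \<in> W" "\<forall>z\<in>W. \<forall>z'\<in>W. (\<forall>p. p \<notin> C \<longrightarrow> z p = z' p) \<longrightarrow> (\<forall>q\<in>R. F q z = F q z') \<longrightarrow> z = z'"
    by (elim exE conjE)
  show ?thesis unfolding datum_inj_near_def
  proof (intro exI[of _ W] conjI allI impI)
    fix f x x' v v'
    assume *: "datum f x v \<in> W" "datum f x' v' \<in> W" "x \<in> chart n d (\<lambda>_. 0)" "x' \<in> chart n d (\<lambda>_. 0)"
      "v \<in> chart_tan n d (\<lambda>_. 0)" "v' \<in> chart_tan n d (\<lambda>_. 0)" "v 0 1 = v' 0 1"
      "\<forall>(i, k)\<in>sec_rows n d. sec_eval n d f x i k = sec_eval n d f x' i k \<and> sec_deriv n d f x v i k = sec_deriv n d f x' v' i k"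
    have "datum f x v = datum f x' v'"
    proof (rule W(3)[rule_format, OF *(1,2)])
      fix p assume p: "p \<notin> C"
      consider q where "p = Inl q" | j b where "p = Inr (Inl (j, b))" | j b where "p = Inr (Inr (j, b))"
        by (metis sum.exhaust surj_pair)
      then show "datum f x v p = datum f x' v' p"
      proof cases
        case 2
        then have "(j, b) \<notin> origin_cols n d" using p by (auto simp: C_def)
        then show ?thesis using chart_agree_off_cols[OF *(3,4)] 2 by (simp add: datum_def)
      next
        case 3
        then have "(j, b) \<notin> origin_cols n d \<or> (j, b) = (0, 1)" using p by (auto simp: C_def)
        then show ?thesis using *(5,6,7) 3 by (auto simp: datum_def chart_tan_def)
      qed (simp add: datum_def)
    next
      fix q assume "q \<in> R"
      then show "F q (datum f x v) = F q (datum f x' v')" using *(8)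
        by (cases "snd q") (auto simp: F_def R_def case_prod_unfold)
    qed
    then show "x = x'" "v = v'" by (metis datum_simps(2), metis datum_simps(3))
  qed (use W in \<open>auto simp: z0_def\<close>)
qed

subsection \<open>A cell of degenerate sections\<close>

lemma continuous_on_divide_complex:
  "continuous_on A (f :: 'a::topological_space \<Rightarrow> complex) \<Longrightarrow> continuous_on A g \<Longrightarrow> (\<And>x. x \<in> A \<Longrightarrow> g x \<noteq> 0) \<Longrightarrow> continuous_on A (\<lambda>x. f x / g x)"
  by (rule continuous_on_divide) auto

text \<open>The device of \<open>zeros_persist\<close> again: the slots of the two pivot coefficients of each row store the
  coordinates of the degenerate zero and of its kernel vector. The slot \<open>p\<close> stays unused because the kernel
  vector is normalised to have coordinate 1 there, which accounts for the codimension.\<close>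

lemma degenerate_cell:
  assumes n: "3 \<le> n" and d2: "\<And>i. i < n \<Longrightarrow> 2 \<le> d i"
    and mono: "\<And>i j. i \<le> j \<Longrightarrow> j < n \<Longrightarrow> d i \<le> d j"
    and bal: "\<And>i. i < n \<Longrightarrow> 2 * (d i - 1) \<le> (\<Sum>j<n. d j - 1)"
  shows "\<exists>p\<in>sec_idx n d. \<exists>N \<Psi> h0. open N \<and> h0 \<in> N \<inter> supported (sec_idx n d - {p}) \<and> (\<forall>q. (h0 q :: complex) \<in> \<real>) \<and>
    continuous_on N \<Psi> \<and> inj_on \<Psi> (N \<inter> supported (sec_idx n d - {p})) \<and>
    \<Psi> ` (N \<inter> supported (sec_idx n d - {p})) \<subseteq> discr_cone n d \<and>
    (\<forall>h. (\<forall>q. h q \<in> \<real>) \<longrightarrow> (\<forall>q. \<Psi> h q \<in> \<real>))"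
proof -
  let ?o = "\<lambda>_ :: nat. 0 :: nat"
  have "\<exists>(A :: nat \<times> nat \<Rightarrow> nat \<times> nat \<Rightarrow> complex) v r0 c1. r0 \<in> sec_rows n d \<and> c1 \<in> origin_cols n d \<and>
    fst r0 \<noteq> 0 \<and> fst c1 \<noteq> 0 \<and> fst c1 \<noteq> fst r0 \<and>
    (\<forall>r\<in>sec_rows n d. \<forall>c\<in>origin_cols n d. fst c = fst r \<longrightarrow> A r c = 0) \<and> (\<forall>c. A r0 c = 0) \<and>
    (\<forall>r c. A r c \<in> \<real>) \<and> (\<forall>c. v c \<in> \<real>) \<and> v (0, 1) = 1 \<and> v c1 = 1 \<and>
    (\<forall>r\<in>sec_rows n d. (\<Sum>c\<in>origin_cols n d. A r c * v c) = 0) \<and>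
    (\<forall>y. (\<forall>r\<in>sec_rows n d. (\<Sum>c\<in>origin_cols n d. A r c * y c) = 0) \<longrightarrow> (\<forall>c\<in>origin_cols n d. y c = y (0, 1) * v c))"
    by (rule corank_one_matrix) (use assms in auto)
  then obtain A :: "nat \<times> nat \<Rightarrow> nat \<times> nat \<Rightarrow> complex" and v r0 c1 where r0: "r0 \<in> sec_rows n d" and c1: "c1 \<in> origin_cols n d"
    and ne: "fst r0 \<noteq> 0" "fst c1 \<noteq> 0" "fst c1 \<noteq> fst r0"
    and A: "\<forall>r\<in>sec_rows n d. \<forall>c\<in>origin_cols n d. fst c = fst r \<longrightarrow> A r c = 0" "\<forall>c. A r0 c = 0"
    and real: "\<forall>r c. A r c \<in> \<real>" "\<forall>c. v c \<in> \<real>" and v: "v (0, 1) = 1" "v c1 = 1"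
    and Av: "\<forall>r\<in>sec_rows n d. (\<Sum>c\<in>origin_cols n d. A r c * v c) = 0"
    and ker: "\<forall>y. (\<forall>r\<in>sec_rows n d. (\<Sum>c\<in>origin_cols n d. A r c * y c) = 0) \<longrightarrow> (\<forall>c\<in>origin_cols n d. y c = y (0, 1) * v c)"
    by (elim exE conjE)
  define c0 where "c0 = (0 :: nat, 1 :: nat)"
  have c0: "c0 \<in> origin_cols n d" using n d2[of 0] by (simp add: c0_def chart_cols_def)
  have o: "?o \<in> pivots n d" by (rule origin_pivots[OF d2])
  have x0: "origin n \<in> chart n d ?o" by (rule origin_in_chart[OF d2])
  define B where "B r = (of_bool (r = r0) :: complex)" for r
  define f0 where "f0 = model_section n d A B (0, 1) c1"
  define v0 where "v0 j b = (if (j, b) \<in> origin_cols n d then v (j, b) else 0)" for j b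
  have v0: "v0 \<in> chart_tan n d ?o" by (simp add: v0_def chart_tan_def)
  have v0c: "v0 (fst c) (snd c) = v c" if "c \<in> origin_cols n d" for c using that by (simp add: v0_def)
  have v01: "v0 0 1 = 1" "v0 (fst c1) (snd c1) = 1" using v0c[OF c0] v0c[OF c1] v by (auto simp: c0_def)
  have "datum_inj_near n d f0 (origin n) v0"
    unfolding f0_def B_def
  proof (rule degenerate_zero_locally_unique[OF d2 _ _ _ r0 ne(1) c1 ne(2,3) v0 v01])
    show "y c = y (0, 1) * v0 (fst c) (snd c)"
      if "\<And>r. r \<in> sec_rows n d \<Longrightarrow> (\<Sum>c\<in>origin_cols n d. A r c * y c) = 0" "c \<in> origin_cols n d" for y c
      using ker that v0c by simp
  qed (use A n in auto)
  then obtain W where W: "open W" "datum f0 (origin n) v0 \<in> W"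
    and Winj: "\<forall>f x x' v v'. datum f x v \<in> W \<longrightarrow> datum f x' v' \<in> W \<longrightarrow>
    x \<in> chart n d ?o \<longrightarrow> x' \<in> chart n d ?o \<longrightarrow> v \<in> chart_tan n d ?o \<longrightarrow> v' \<in> chart_tan n d ?o \<longrightarrow>
    v 0 1 = v' 0 1 \<longrightarrow> (\<forall>(i, k)\<in>sec_rows n d. sec_eval n d f x i k = sec_eval n d f x' i k \<and> sec_deriv n d f x v i k = sec_deriv n d f x' v' i k)
    \<longrightarrow> x = x' \<and> v = v'"
    unfolding datum_inj_near_def by (elim exE conjE)
  define q1 where "q1 = pivot_coeff n ?o"
  have q1: "q1 (i, k) = (i, k, \<lambda>_. 0)" for i k by (simp add: q1_def pivot_coeff_def pivot_idx_origin)
  \<comment> \<open>The column through which the derivative equation of a row of type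
    \<open>i\<close> is solved. It must avoid factor \<open>i\<close>, and the vector must be
    nonzero there: at \<open>c0\<close> it is 1 by normalisation, at \<open>c1\<close> it is near
    1.\<close>
  define cc where "cc i = (if i = 0 then c1 else c0)" for i :: nat
  have cc: "cc i \<in> origin_cols n d" "fst (cc i) \<noteq> i" for i using c0 c1 ne by (auto simp: cc_def c0_def)
  define q2 where "q2 r = (fst r, snd r, idx1 (cc (fst r)))" for r :: "nat \<times> nat"
  have idx1_in: "idx1 (cc i) \<in> multi_idx n d i" for i by (rule idx1_in[OF cc d2])
  have idx1_ne: "idx1 (cc i) \<noteq> (\<lambda>_. 0)" for i using cc(1)[of i] by (auto simp: idx1_def chart_cols_def fun_eq_iff)
  have q1_in: "q1 r \<in> sec_idx n d" if "r \<in> sec_rows n d" for r unfolding q1_def by (rule pivot_coeff_in[OF o that])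
  have q2_in: "q2 r \<in> sec_idx n d" if "r \<in> sec_rows n d" for r
    using that idx1_in by (auto simp: q2_def sec_idx_def sec_rows_def)
  have row00: "(0, 0) \<in> sec_rows n d" using n d2[of 0] by (simp add: sec_rows_def)
  \<comment> \<open>The slot in which the entry \<open>c0 = (0, 1)\<close> of the vector would be
    stored: column \<open>b\<close> is kept in row \<open>b - 1\<close>.\<close>
  define p where "p = q2 (0, 0)"
  have p: "p \<in> sec_idx n d" unfolding p_def by (rule q2_in[OF row00])
  define X :: "(sec_index \<Rightarrow> complex) \<Rightarrow> nat \<Rightarrow> nat \<Rightarrow> complex" where
    "X h j b = (if (j, b) \<in> origin_cols n d then h (q1 (j, b - 1)) else if j < n \<and> b = 0 then 1 else 0)" for h j b
  define V :: "(sec_index \<Rightarrow> complex) \<Rightarrow> nat \<Rightarrow> nat \<Rightarrow> complex" where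
    "V h j b = (if (j, b) = c0 then 1 else if (j, b) \<in> origin_cols n d then h (q2 (j, b - 1)) else 0)" for h j b
  \<comment> \<open>The pivot monomial has derivative 0 along \<open>V h\<close>, so this
    coefficient is determined without the pivot coefficient; \<open>G1\<close> is computed
    afterwards from the completed \<open>f2\<close>.\<close>
  define G2 where "G2 h r = - (\<Sum>idx\<in>multi_idx n d (fst r) - {\<lambda>_. 0} - {idx1 (cc (fst r))}.
      h (fst r, snd r, idx) * dmono_at n (fst r) (X h) (V h) idx) / V h (fst (cc (fst r))) (snd (cc (fst r)))" for h r
  define f2 where "f2 h q = (if q \<in> q2 ` sec_rows n d then G2 h (fst q, fst (snd q)) else h q)" for h and q :: sec_index
  define G1 where "G1 h r = - (\<Sum>idx\<in>multi_idx n d (fst r) - {\<lambda>_. 0}. f2 h (fst r, snd r, idx) * mono_at n (fst r) (X h) idx)" for h r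
  define \<Psi> where "\<Psi> h q = (if q \<in> q1 ` sec_rows n d then G1 h (fst q, fst (snd q)) else f2 h q)" for h and q :: sec_index
  define D where "D = {h. V h (fst c1) (snd c1) \<noteq> 0}"
  have Xc: "X h \<in> chart n d ?o" for h
    using d2 by (fastforce simp: X_def chart_def chart_cols_def)
  have Vt: "V h \<in> chart_tan n d ?o" for h using c0 by (auto simp: V_def chart_tan_def)
  have V0: "V h 0 1 = 1" "V h (fst c0) (snd c0) = 1" for h by (auto simp: V_def c0_def)
  have Vcc: "V h (fst (cc i)) (snd (cc i)) \<noteq> 0" if "h \<in> D" for h i
    using that V0(2)[of h] by (auto simp: cc_def D_def)
  have q2_ne: "(i, k, \<lambda>_. 0) \<notin> q2 ` sec_rows n d" for i k
    using idx1_ne[of i] by (auto simp: q2_def)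
  have q1_ne: "(i, k, idx) \<notin> q1 ` sec_rows n d" if "idx \<noteq> (\<lambda>_. 0)" for i k idx using that by (auto simp: q1)
  have \<Psi>1: "\<Psi> h (q1 r) = G1 h r" if "r \<in> sec_rows n d" for h r
    using imageI[OF that, of q1] by (cases r) (simp add: \<Psi>_def q1)
  have \<Psi>2: "\<Psi> h (i, k, idx) = f2 h (i, k, idx)" if "idx \<noteq> (\<lambda>_. 0)" for h i k idx
    using q1_ne[OF that] by (simp add: \<Psi>_def)
  have f22: "f2 h (q2 r) = G2 h r" if "r \<in> sec_rows n d" for h r
    using imageI[OF that, of q2] by (simp add: f2_def) (simp add: q2_def)
  have f2r: "f2 h (i, k, idx) = h (i, k, idx)" if "idx \<noteq> idx1 (cc i)" for h i k idx
    using that by (auto simp: f2_def q2_def)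
  have eval: "sec_eval n d (\<Psi> h) (X h) i k = 0" if r: "(i, k) \<in> sec_rows n d" for h i k
    unfolding sec_eval_pivot[OF o Xc] q1_def[symmetric] \<Psi>1[OF r] by (simp add: G1_def pivot_idx_origin \<Psi>2)
  have d_split: "sec_deriv n d f x u i k = f (i, k, idx1 (cc i)) * u (fst (cc i)) (snd (cc i)) +
      (\<Sum>idx\<in>multi_idx n d i - {\<lambda>_. 0} - {idx1 (cc i)}. f (i, k, idx) * dmono_at n i x u idx)"
    if x: "x \<in> chart n d ?o" and u: "u \<in> chart_tan n d ?o" for f x u i k
  proof -
    have u0: "u j 0 = 0" for j using u by (simp add: chart_tan_def chart_cols_def)
    have 1: "dmono_at n i x u (\<lambda>_. 0) = 0"
      using dmono_at_pivot[of n u ?o i x] u0 by (simp add: pivot_idx_origin)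
    have "fst (cc i) < n" using cc(1)[of i] by (auto simp: chart_cols_def)
    then have 2: "dmono_at n i x u (idx1 (cc i)) = u (fst (cc i)) (snd (cc i))"
      using dmono_at_pivot_upd[where v = u and a = ?o and m = "fst (cc i)" and i = i and b = "snd (cc i)", OF x] u0 cc(2)[of i]
      by (simp add: pivot_idx_origin idx1_def)
    have z: "(\<lambda>_. 0) \<in> multi_idx n d i" using pivot_idx_in[OF o, of i] by (simp add: pivot_idx_origin)
    have "sec_deriv n d f x u i k = f (i, k, \<lambda>_. 0) * dmono_at n i x u (\<lambda>_. 0) + (f (i, k, idx1 (cc i)) * dmono_at n i x u (idx1 (cc i)) +
      (\<Sum>idx\<in>multi_idx n d i - {\<lambda>_. 0} - {idx1 (cc i)}. f (i, k, idx) * dmono_at n i x u idx))"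
      unfolding sec_deriv_dmono_at sum.remove[OF finite_multi_idx z]
      by (subst sum.remove[of _ "idx1 (cc i)"]) (use finite_multi_idx idx1_in idx1_ne in auto)
    then show ?thesis unfolding 1 2 by simp
  qed
  have deriv: "sec_deriv n d (\<Psi> h) (X h) (V h) i k = 0" if r: "(i, k) \<in> sec_rows n d" and h: "h \<in> D" for h i k
  proof -
    have "\<Psi> h (i, k, idx1 (cc i)) = G2 h (i, k)" using \<Psi>2[OF idx1_ne] f22[OF r] by (simp add: q2_def)
    then show ?thesis unfolding d_split[OF Xc Vt] using Vcc[OF h, of i] by (simp add: G2_def \<Psi>2 f2r)
  qed
  have cX: "continuous_on T (\<lambda>h. X h j b)" for T j b
    unfolding X_def by (cases "(j, b) \<in> origin_cols n d") (auto intro!: continuous_on_coordinate)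
  have cV: "continuous_on T (\<lambda>h. V h j b)" for T j b
    unfolding V_def by (cases "(j, b) = c0"; cases "(j, b) \<in> origin_cols n d") (auto intro!: continuous_on_coordinate)
  have cmono: "continuous_on T (\<lambda>h. mono_at n i (X h) idx)" "continuous_on T (\<lambda>h. dmono_at n i (X h) (V h) idx)" for T i idx
    unfolding mono_at_def dmono_at_def
    by (intro continuous_on_sum continuous_on_mult continuous_on_prod cX cV)+
  have cG2: "continuous_on D (\<lambda>h. G2 h r)" for r
    unfolding G2_def by (intro continuous_on_divide_complex continuous_on_minus continuous_on_sum continuous_on_mult
        continuous_on_coordinate cmono cV Vcc)
  have cf2: "continuous_on D (\<lambda>h. f2 h q)" for q
    by (cases "q \<in> q2 ` sec_rows n d") (simp_all add: f2_def cG2 continuous_on_coordinate)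
  have cG1: "continuous_on D (\<lambda>h. G1 h r)" for r
    unfolding G1_def by (intro continuous_on_minus continuous_on_sum continuous_on_mult cf2 cmono)
  have "continuous_on D (\<lambda>h. \<Psi> h q)" for q
    by (cases "q \<in> q1 ` sec_rows n d") (simp_all add: \<Psi>_def cG1 cf2)
  then have c\<Psi>: "continuous_on D \<Psi>" by (rule continuous_on_coordinatewise_then_product)
  have "continuous_on D X" "continuous_on D V" using cX cV by (auto intro!: continuous_on_coordinatewise_then_product)
  then have cd: "continuous_on D (\<lambda>h. datum (\<Psi> h) (X h) (V h))" using c\<Psi> by (intro continuous_on_datum)
  have oD: "open D"
  proof -
    have "open ((\<lambda>h. V h (fst c1) (snd c1)) -` (- {0}))" by (intro open_vimage cV) auto
    then show ?thesis by (simp add: D_def vimage_def)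
  qed
  \<comment> \<open>The discriminant cone excludes the zero section. The quadratic coefficient is 1
    in \<open>f0\<close>, so keeping it nonzero on \<open>N\<close> guarantees a nonzero
    section.\<close>
  define quad where "quad = (fst r0, snd r0, idx2 c0 c1)"
  define W' where "W' = W \<inter> (\<lambda>z. z (Inl quad)) -` (- {0})"
  have W': "open W'" unfolding W'_def using W(1) by (intro open_Int open_vimage) auto
  define N where "N = (\<lambda>h. datum (\<Psi> h) (X h) (V h)) -` W' \<inter> D"
  have oN: "open N" unfolding N_def using continuous_on_open_vimage[OF oD] cd W' by blast
  have ND: "N \<subseteq> D" by (auto simp: N_def)
  define J where "J = sec_idx n d - {p}"
  have maps: "\<Psi> h \<in> discr_cone n d" if h: "h \<in> N \<inter> supported J" for h
  proof -
    have "\<Psi> h q = 0" if "q \<notin> sec_idx n d" for q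
    proof -
      have "q \<notin> q1 ` sec_rows n d" "q \<notin> q2 ` sec_rows n d" using that q1_in q2_in by auto
      moreover have "h q = 0" using h that unfolding J_def supported_def by blast
      ultimately show ?thesis by (simp add: \<Psi>_def f2_def)
    qed
    then have "\<Psi> h \<in> sections n d" by (simp add: sections_def)
    moreover have "\<Psi> h quad \<noteq> 0" using h by (simp add: N_def W'_def datum_def)
    moreover have "\<not> reduced_dim0 n d (\<Psi> h)"
    proof
      assume red: "reduced_dim0 n d (\<Psi> h)"
      have "X h \<in> zero_set n d (\<Psi> h)"
        using eval Xc chart_subset_cone_pts[OF o] by (auto simp: zero_set_def sec_rows_def)
      moreover have "V h \<in> tan_vecs n d" using Vt[of h] by (auto simp: tan_vecs_def chart_tan_def chart_cols_def)
      moreover have "\<forall>i<n. \<forall>k<d i - 1. sec_deriv n d (\<Psi> h) (X h) (V h) i k = 0"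
        using deriv h ND by (auto simp: sec_rows_def)
      ultimately obtain c where c: "\<forall>j<n. \<forall>b. V h j b = c j * X h j b" using red unfolding reduced_dim0_def by blast
      \<comment> \<open>\<open>V h\<close> is no Euler direction: its pivot entry would force the
        factor \<open>c 0\<close> to be 0, against \<open>V h 0 1 = 1\<close>.\<close>
      have "V h 0 0 = 0" "X h 0 0 = 1" using Vt[of h] Xc[of h] n by (auto simp: chart_tan_def chart_cols_def chart_def)
      then have "c 0 = 0" using c n by (metis less_le_trans mult.right_neutral zero_less_numeral)
      then have "V h 0 1 = 0" using c n by simp
      then show False using V0(1) by simp
    qed
    ultimately show ?thesis unfolding discr_cone_def by blast
  qed
  have inj: "inj_on \<Psi> (N \<inter> supported J)"
  proof (rule inj_onI)
    fix h h' assume h: "h \<in> N \<inter> supported J" "h' \<in> N \<inter> supported J" and eq: "\<Psi> h = \<Psi> h'"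
    have hD: "h \<in> D" "h' \<in> D" using h ND by auto
    have "datum (\<Psi> h) (X h) (V h) \<in> W" "datum (\<Psi> h) (X h') (V h') \<in> W" using h eq by (auto simp: N_def W'_def)
    moreover have "\<forall>(i, k)\<in>sec_rows n d. sec_eval n d (\<Psi> h) (X h) i k = sec_eval n d (\<Psi> h) (X h') i k \<and>
        sec_deriv n d (\<Psi> h) (X h) (V h) i k = sec_deriv n d (\<Psi> h) (X h') (V h') i k"
      using eval[of _ _ h] eval[of _ _ h'] deriv[OF _ hD(1)] deriv[OF _ hD(2)] eq by auto
    moreover have "V h 0 1 = V h' 0 1" using V0 by simp
    ultimately have XV: "X h = X h'" "V h = V h'" using Winj Xc Vt by blast+
    show "h = h'"
    proof
      fix q
      consider r where "r \<in> sec_rows n d" "q = q1 r" | r where "r \<in> sec_rows n d" "q = q2 r"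
        | "q \<notin> q1 ` sec_rows n d" "q \<notin> q2 ` sec_rows n d" by blast
      then show "h q = h' q"
      proof cases
        case 1
        obtain j k where jk: "r = (j, k)" by (cases r)
        have "(j, Suc k) \<in> origin_cols n d" using 1 jk by (auto simp: sec_rows_def chart_cols_def)
        then show ?thesis using fun_cong[OF fun_cong[OF XV(1)], of j "Suc k"] 1 jk by (simp add: X_def)
      next
        case 2
        obtain j k where jk: "r = (j, k)" by (cases r)
        show ?thesis
        proof (cases "(j, k) = (0, 0)")
          case True
          then have "q \<notin> J" using 2 jk by (simp add: J_def p_def)
          then have "h q = 0" "h' q = 0" using h unfolding supported_def by blast+
          then show ?thesis by simp
        next
          case False
          then have "(j, Suc k) \<noteq> c0" by (auto simp: c0_def)
          moreover have "(j, Suc k) \<in> origin_cols n d" using 2 jk by (auto simp: sec_rows_def chart_cols_def)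
          ultimately show ?thesis using fun_cong[OF fun_cong[OF XV(2)], of j "Suc k"] 2 jk by (simp add: V_def)
        qed
      next
        case 3
        then show ?thesis using fun_cong[OF eq, of q] by (simp add: \<Psi>_def f2_def)
      qed
    qed
  qed
  \<comment> \<open>The slots store the origin, whose chart coordinates are 0, and the kernel vector
    \<open>v\<close>; the default 0 at \<open>p\<close> keeps \<open>h0\<close> in the smaller
    space. All other entries are those of \<open>f0\<close>.\<close>
  define h0 where "h0 q = (if q \<in> q1 ` sec_rows n d \<or> q = p then 0
      else if q \<in> q2 ` sec_rows n d then v (fst q, Suc (fst (snd q))) else f0 q)" for q
  have Bc: "(0, 1) \<in> origin_cols n d \<and> c1 \<in> origin_cols n d \<and> fst (0, 1 :: nat) \<noteq> i \<and> fst c1 \<noteq> i \<and> fst (0, 1 :: nat) \<noteq> fst c1"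
    if "B (i, k) \<noteq> 0" for i k using that c0 c1 ne by (auto simp: B_def c0_def split: if_splits)
  have Ac: "A (i, k) c = 0" if "(i, k) \<in> sec_rows n d" "c \<in> origin_cols n d" "fst c = i" for i k c using A(1) that by force
  have o0: "origin n (fst c) (snd c) = 0" if "c \<in> origin_cols n d" for c
    using that by (auto simp: origin_def chart_cols_def)
  have Xh0: "X h0 = origin n"
  proof (intro ext)
    fix j b show "X h0 j b = origin n j b"
    proof (cases "(j, b) \<in> origin_cols n d")
      case True
      then have "(j, b - 1) \<in> sec_rows n d" by (auto simp: sec_rows_def chart_cols_def)
      then have "h0 (q1 (j, b - 1)) = 0" by (simp add: h0_def)
      then show ?thesis using True o0[OF True] by (simp add: X_def)
    next
      case False
      then show ?thesis using chart_agree_off_cols[OF Xc x0] by blast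
    qed
  qed
  have q2p: "q2 (j, k) = p \<longleftrightarrow> (j, k) = (0, 0)" for j k by (auto simp: q2_def p_def)
  have Vh0: "V h0 = v0"
  proof (intro ext)
    fix j b show "V h0 j b = v0 j b"
    proof (cases "(j, b) \<in> origin_cols n d \<and> (j, b) \<noteq> c0")
      case True
      then have jb: "(j, b - 1) \<in> sec_rows n d" "Suc (b - 1) = b" "(j, b - 1) \<noteq> (0, 0)"
        by (auto simp: sec_rows_def chart_cols_def c0_def)
      define q where "q = q2 (j, b - 1)"
      have "q \<notin> q1 ` sec_rows n d" unfolding q_def q2_def by (intro q1_ne idx1_ne)
      moreover have "q \<noteq> p" "q \<in> q2 ` sec_rows n d" using q2p[of j "b - 1"] jb by (auto simp: q_def)
      moreover have "fst q = j" "fst (snd q) = b - 1" by (simp_all add: q_def q2_def)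
      ultimately have "h0 (q2 (j, b - 1)) = v (j, b)" unfolding q_def[symmetric] using jb(2) by (simp add: h0_def)
      then show ?thesis using True by (simp add: V_def v0_def)
    next
      case False
      show ?thesis
      proof (cases "(j, b) = c0")
        case True
        then show ?thesis using v01(1) by (simp add: V_def) (simp add: c0_def)
      next
        case no: False
        then show ?thesis using False by (simp add: V_def v0_def)
      qed
    qed
  qed
  have h0D: "h0 \<in> D" using v01(2) by (simp add: D_def Vh0)
  have \<Psi>h0: "\<Psi> h0 = f0"
  proof -
    have free: "h0 (i, k, idx) = f0 (i, k, idx)" if "idx \<noteq> (\<lambda>_. 0)" "idx \<noteq> idx1 (cc i)" for i k idx
      using that by (auto simp: h0_def q1 q2_def p_def)
    have second: "f2 h0 (i, k, idx) = f0 (i, k, idx)" if "idx \<noteq> (\<lambda>_. 0)" for i k idx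
    proof (cases "(i, k, idx) \<in> q2 ` sec_rows n d")
      case True
      then have r: "(i, k) \<in> sec_rows n d" and idx: "idx = idx1 (cc i)" by (auto simp: q2_def)
      have "sec_deriv n d f0 (origin n) v0 i k = (\<Sum>c\<in>origin_cols n d. A (i, k) c * v0 (fst c) (snd c)) +
        B (i, k) * (v0 (fst (0, 1 :: nat)) (snd (0 :: nat, 1)) * origin n (fst c1) (snd c1) + origin n (fst (0, 1 :: nat)) (snd (0 :: nat, 1)) * v0 (fst c1) (snd c1))"
        unfolding f0_def by (rule sec_deriv_model_section[where A = A and B = B, OF d2 x0 v0 r]) (use Ac[OF r] Bc in auto)
      also have "\<dots> = 0" using Av r v0c o0[OF c1] o0[OF c0] by (simp add: c0_def)
      finally have "f0 (i, k, idx1 (cc i)) * v0 (fst (cc i)) (snd (cc i)) +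
        (\<Sum>idx\<in>multi_idx n d i - {\<lambda>_. 0} - {idx1 (cc i)}. f0 (i, k, idx) * dmono_at n i (origin n) v0 idx) = 0"
        unfolding d_split[OF x0 v0] .
      moreover have "f2 h0 (i, k, idx) = - (\<Sum>idx\<in>multi_idx n d i - {\<lambda>_. 0} - {idx1 (cc i)}. f0 (i, k, idx) * dmono_at n i (origin n) v0 idx)
          / v0 (fst (cc i)) (snd (cc i))"
        using f22[OF r, of h0] by (simp add: q2_def idx G2_def Xh0 Vh0 free)
      moreover have "v0 (fst (cc i)) (snd (cc i)) \<noteq> 0" using Vcc[OF h0D, of i] by (simp add: Vh0)
      moreover have "g = a" if "a * u + s = 0" "g = - s / u" "u \<noteq> 0" for a g u s :: complex
      proof -
        have "- s = a * u" using that(1) by (simp add: neg_eq_iff_add_eq_0 add.commute)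
        then show ?thesis using that by simp
      qed
      ultimately show ?thesis unfolding idx by blast
    next
      case False
      have "(i, k, idx) \<noteq> p" using False row00 by (auto simp: p_def)
      then show ?thesis using False q1_ne[OF that] by (simp add: f2_def h0_def)
    qed
    show ?thesis
    proof
      fix q :: sec_index
      obtain i k idx where q: "q = (i, k, idx)" by (cases q)
      show "\<Psi> h0 q = f0 q"
      proof (cases "q \<in> q1 ` sec_rows n d")
        case True
        then have r: "(i, k) \<in> sec_rows n d" and qq: "q = q1 (i, k)" by (auto simp: q q1)
        have "sec_eval n d f0 (origin n) i k = (\<Sum>c\<in>origin_cols n d. A (i, k) c * origin n (fst c) (snd c)) +
          B (i, k) * (origin n (fst (0, 1 :: nat)) (snd (0 :: nat, 1)) * origin n (fst c1) (snd c1))"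
          unfolding f0_def by (rule sec_eval_model_section[where A = A and B = B, OF d2 x0 r]) (use Ac[OF r] Bc in auto)
        also have "\<dots> = 0" using o0 c1 by simp
        finally have "f0 (q1 (i, k)) + (\<Sum>idx\<in>multi_idx n d i - {\<lambda>_. 0}. f0 (i, k, idx) * mono_at n i (origin n) idx) = 0"
          unfolding sec_eval_pivot[OF o x0] q1_def pivot_idx_origin .
        moreover have "\<Psi> h0 q = - (\<Sum>idx\<in>multi_idx n d i - {\<lambda>_. 0}. f0 (i, k, idx) * mono_at n i (origin n) idx)"
          unfolding qq \<Psi>1[OF r] by (simp add: G1_def Xh0 second)
        ultimately show ?thesis unfolding qq by (simp add: neg_eq_iff_add_eq_0 add.commute)
      next
        case False
        show ?thesis
        proof (cases "idx = (\<lambda>_. 0)")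
          case True
          have "q \<notin> q2 ` sec_rows n d" using q2_ne by (simp add: q True)
          moreover have "q \<noteq> p" using calculation row00 by (auto simp: p_def)
          ultimately show ?thesis using False by (simp add: \<Psi>_def f2_def h0_def)
        next
          case idx: False
          then show ?thesis using second[OF idx] \<Psi>2[OF idx] by (simp add: q)
        qed
      qed
    qed
  qed
  have quad_in: "quad \<in> sec_idx n d"
    using r0 idx2_in[OF c0 c1, of "fst r0"] ne d2 by (auto simp: quad_def sec_idx_def sec_rows_def c0_def)
  have "f0 quad = 1"
    using quad_in A(2)[rule_format] by (simp add: f0_def model_section_def quad_def B_def c0_def)
  then have h0N: "h0 \<in> N" using W(2) h0D by (simp add: N_def W'_def \<Psi>h0 Xh0 Vh0 datum_def)
  have f0s: "f0 \<in> sections n d" unfolding f0_def by (rule model_section_in_sections)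
  have h0J: "h0 \<in> supported J"
    using f0s q1_in q2_in by (auto simp: h0_def supported_def J_def sections_def)
  have f0R: "f0 q \<in> \<real>" for q
    using real(1) by (auto simp: f0_def model_section_def B_def split: prod.split intro!: Reals_add Reals_mult sum_in_Reals)
  have h0R: "h0 q \<in> \<real>" for q using f0R real(2) by (simp add: h0_def)
  \<comment> \<open>Only sums, products and quotients of the entries of \<open>h\<close> occur, so
    the same map sends real arguments to real sections.\<close>
  have \<Psi>R: "\<Psi> h q \<in> \<real>" if h: "\<forall>q. h q \<in> \<real>" for h q
  proof -
    have hR: "h q \<in> \<real>" for q using h by blast
    have XR: "X h j b \<in> \<real>" for j b by (simp add: X_def hR)
    have VR: "V h j b \<in> \<real>" for j b by (simp add: V_def hR)
    have G2R: "G2 h r \<in> \<real>" for r unfolding G2_def dmono_at_def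
      using hR XR VR by (intro Reals_divide Reals_minus sum_in_Reals Reals_mult prod_in_Reals) auto
    have f2R: "f2 h q \<in> \<real>" for q by (simp add: f2_def hR G2R)
    have G1R: "G1 h r \<in> \<real>" for r unfolding G1_def mono_at_def
      using f2R XR by (intro Reals_minus sum_in_Reals Reals_mult prod_in_Reals) auto
    show ?thesis by (simp add: \<Psi>_def f2R G1R)
  qed
  show ?thesis
    by (rule bexI[OF _ p], rule exI[of _ N], rule exI[of _ \<Psi>], rule exI[of _ h0])
       (use oN h0N h0J h0R continuous_on_subset[OF c\<Psi> ND] inj maps \<Psi>R in \<open>auto simp: J_def\<close>)
qed

subsection \<open>The dimension of the discriminant\<close>

lemma contains_cell_mono: "contains_cell k S \<Longrightarrow> S \<subseteq> T \<Longrightarrow> contains_cell k T"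
  unfolding contains_cell_def by (meson subset_trans)

text \<open>Dimensions are those of the affine cones over the reals: the space of sections has real
  dimension \<open>card (sec_idx n d)\<close> over real coefficients and twice that over complex
  ones, so both values express codimension one.\<close>

theorem theorem3p7:
  fixes n :: nat and d :: "nat \<Rightarrow> nat"
  assumes "n \<ge> 3"
    and "\<forall>i<n. 2 \<le> d i"
    and "\<forall>i j. i \<le> j \<and> j < n \<longrightarrow> d i \<le> d j"
    and "d (n - 1) - 1 \<le> (\<Sum>i<n - 1. d i - 1)"
  shows "has_dim (real_discr_cone n d) (card (sec_idx n d) - 1) \<and>
         has_dim (discr_cone n d) (2 * card (sec_idx n d) - 2)"
proof -
  let ?I = "sec_idx n d"
  have d2: "2 \<le> d i" if "i < n" for i using assms(2) that by blast
  have mono: "d i \<le> d j" if "i \<le> j" "j < n" for i j using assms(3) that by blast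
  \<comment> \<open>Adding the largest term to both sides of the hypothesis makes it symmetric;
    monotonicity of \<open>d\<close> passes it on to every \<open>i\<close>.\<close>
  have bal: "2 * (d i - 1) \<le> (\<Sum>j<n. d j - 1)" if "i < n" for i
  proof -
    have "d i - 1 \<le> d (n - 1) - 1" using mono[of i "n - 1"] that by (simp add: diff_le_mono)
    moreover have "(\<Sum>j<n. d j - 1) = (\<Sum>j<n - 1. d j - 1) + (d (n - 1) - 1)"
      using sum.lessThan_Suc[of "\<lambda>j. d j - 1" "n - 1"] that by simp
    ultimately show ?thesis using assms(4) by linarith
  qed
  have "\<exists>P. polynomial_fn ?I P \<and> (\<exists>x. P x \<noteq> 0) \<and> (\<forall>f\<in>degenerate n d. P f = 0)"
    using d2 bal by (rule degenerate_in_hypersurface)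
  then obtain P x where P: "polynomial_fn ?I P" and x: "P x \<noteq> 0" and P0: "\<forall>f\<in>degenerate n d. P f = 0"
    by (elim exE conjE)
  have discr: "f \<in> supported ?I \<and> P f = 0" if f: "f \<in> discr_cone n d" for f
  proof -
    have fs: "f \<in> sections n d" and nr: "\<not> reduced_dim0 n d f" using f by (auto simp: discr_cone_def)
    \<comment> \<open>Of the three ways to fail \<open>reduced_dim0\<close>, the empty zero set is
      impossible and an infinite one implies degeneracy.\<close>
    have "zero_set n d f \<noteq> {}" by (rule zero_set_nonempty[OF _ _ fs]) (use d2 bal in auto)
    then have "f \<in> degenerate n d"
      using nr finite_zeros_nondegenerate[of f n d] unfolding reduced_dim0_def degenerate_def by blast
    then show ?thesis using P0 fs by (simp add: sections_eq_supported)
  qed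
  have "\<exists>p\<in>?I. \<exists>N \<Psi> h0. open N \<and> h0 \<in> N \<inter> supported (?I - {p}) \<and> (\<forall>q. (h0 q :: complex) \<in> \<real>) \<and>
    continuous_on N \<Psi> \<and> inj_on \<Psi> (N \<inter> supported (?I - {p})) \<and>
    \<Psi> ` (N \<inter> supported (?I - {p})) \<subseteq> discr_cone n d \<and> (\<forall>h. (\<forall>q. h q \<in> \<real>) \<longrightarrow> (\<forall>q. \<Psi> h q \<in> \<real>))"
    by (rule degenerate_cell) (use assms(1) d2 mono bal in auto)
  then obtain p N \<Psi> and h0 :: "sec_index \<Rightarrow> complex" where p: "p \<in> ?I" and N: "open N" "h0 \<in> N \<inter> supported (?I - {p})" and h0: "\<forall>q. h0 q \<in> \<real>"
    and c\<Psi>: "continuous_on N \<Psi>" and inj\<Psi>: "inj_on \<Psi> (N \<inter> supported (?I - {p}))"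
    and \<Psi>: "\<Psi> ` (N \<inter> supported (?I - {p})) \<subseteq> discr_cone n d"
    and \<Psi>R: "\<forall>h. (\<forall>q. h q \<in> \<real>) \<longrightarrow> (\<forall>q. \<Psi> h q \<in> \<real>)" by (elim bexE exE conjE)
  define J where "J = ?I - {p}"
  have finJ: "finite J" and cardJ: "card J = card ?I - 1"
    using p finite_sec_idx by (auto simp: J_def)
  have pos: "card ?I \<ge> 1" using p finite_sec_idx[of n d] by (metis One_nat_def Suc_leI card_gt_0_iff empty_iff)
  have "contains_cell (2 * card J) (discr_cone n d)"
    by (rule contains_cellI[OF euclidean_coords_complex[OF finJ] N(1)])
       (use N(2) inj\<Psi> \<Psi> continuous_on_subset[OF c\<Psi>, of "N \<inter> supported J"] in \<open>auto simp: J_def\<close>)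
  moreover have "\<not> contains_cell (Suc (2 * card ?I - 2)) (discr_cone n d)"
  proof
    assume "contains_cell (Suc (2 * card ?I - 2)) (discr_cone n d)"
    then have "contains_cell (Suc (2 * card ?I - 2)) {z \<in> supported ?I. P z = 0}"
      by (rule contains_cell_mono) (use discr in auto)
    from cell_in_hypersurface_dim[OF finite_sec_idx P x this] show False using pos by linarith
  qed
  ultimately have complex: "has_dim (discr_cone n d) (2 * card ?I - 2)"
    unfolding has_dim_def cardJ by (simp add: diff_mult_distrib2)
  define cx :: "(sec_index \<Rightarrow> real) \<Rightarrow> sec_index \<Rightarrow> complex" where "cx h = (\<lambda>q. complex_of_real (h q))" for h
  have ccx: "continuous_on UNIV cx" unfolding cx_def
    by (intro continuous_on_coordinatewise_then_product continuous_on_of_real continuous_on_coordinate)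
  have cxR: "cx h q \<in> \<real>" for h q by (simp add: cx_def)
  have cxs: "cx h \<in> supported K \<longleftrightarrow> h \<in> supported K" for h K by (simp add: cx_def supported_def)
  \<comment> \<open>Taking real parts loses nothing here, because \<open>\<Psi>\<close> is real on
    real arguments.\<close>
  define g where "g h = (\<lambda>q. Re (\<Psi> (cx h) q))" for h
  have cxg: "cx (g h) = \<Psi> (cx h)" for h
    using \<Psi>R cxR by (auto simp: cx_def g_def fun_eq_iff)
  have "contains_cell (card J) (real_discr_cone n d)"
  proof (rule contains_cellI[OF euclidean_coords_real[OF finJ] open_vimage[OF N(1) ccx]])
    have "cx (\<lambda>q. Re (h0 q)) = h0" using h0 by (simp add: cx_def fun_eq_iff)
    then show "cx -` N \<inter> supported J \<noteq> {}" using N(2) cxs[of "\<lambda>q. Re (h0 q)" J] unfolding J_def by auto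
    have "continuous_on (cx -` N) (\<lambda>h. \<Psi> (cx h))"
      by (rule continuous_on_compose2[OF c\<Psi> continuous_on_subset[OF ccx]]) auto
    then have "continuous_on (cx -` N) (\<lambda>h. g h q)" for q
      unfolding g_def by (intro continuous_on_Re continuous_on_product_then_coordinatewise[where f = "\<lambda>h. \<Psi> (cx h)"])
    then have "continuous_on (cx -` N) g" by (rule continuous_on_coordinatewise_then_product)
    then show "continuous_on (cx -` N \<inter> supported J) g" by (rule continuous_on_subset) auto
    show "inj_on g (cx -` N \<inter> supported J)"
    proof (rule inj_onI)
      fix h h' assume h: "h \<in> cx -` N \<inter> supported J" "h' \<in> cx -` N \<inter> supported J" "g h = g h'"
      then have "\<Psi> (cx h) = \<Psi> (cx h')" by (metis cxg)
      then have "cx h = cx h'" using h inj\<Psi> by (auto simp: inj_on_def J_def cxs)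
      then show "h = h'" by (simp add: cx_def fun_eq_iff)
    qed
    show "g ` (cx -` N \<inter> supported J) \<subseteq> real_discr_cone n d"
    proof clarify
      fix h assume h: "cx h \<in> N" "h \<in> supported J"
      then have "cx (g h) \<in> discr_cone n d" unfolding cxg using \<Psi> by (auto simp: J_def cxs)
      moreover from this have "g h \<in> sections n d" using cxs[of "g h" ?I] by (simp add: discr_cone_def sections_eq_supported)
      ultimately show "g h \<in> real_discr_cone n d" by (simp add: real_discr_cone_def cx_def)
    qed
  qed
  moreover have "\<not> contains_cell (card ?I) (real_discr_cone n d)"
  proof
    assume cell: "contains_cell (card ?I) (real_discr_cone n d)"
    have "real_discr_cone n d \<subseteq> supported ?I" by (auto simp: real_discr_cone_def sections_eq_supported)
    from contains_cell_top_dim[OF cell this euclidean_coords_real[OF finite_sec_idx]]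
    obtain U where U: "open U" "U \<inter> supported ?I \<noteq> {}" "U \<inter> supported ?I \<subseteq> real_discr_cone n d" by (elim exE conjE)
    then obtain z where z: "z \<in> U" "z \<in> supported ?I" by blast
    \<comment> \<open>\<open>P\<close> need not have real coefficients, so a real point outside its
      zero set has to be produced; the real line towards it then meets every open set of real
      sections off the zero set.\<close>
    obtain w where "P (\<lambda>i. complex_of_real (w i)) \<noteq> 0" using polynomial_fn_nonzero_real[OF finite_sec_idx P x] by blast
    define y where "y i = (if i \<in> ?I then w i else 0)" for i
    obtain m where "polyfn ?I m P" using P by (auto simp: polynomial_fn_def)
    then have "P (cx y) = P (\<lambda>i. complex_of_real (w i))" by (rule polyfn_cong_supp) (simp add: cx_def y_def)
    then have Py: "P (cx y) \<noteq> 0" using \<open>P (\<lambda>i. complex_of_real (w i)) \<noteq> 0\<close> by simp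
    define re where "re h = (\<lambda>q. Re (h q))" for h :: "sec_index \<Rightarrow> complex"
    have "continuous_on UNIV re" unfolding re_def
      by (intro continuous_on_coordinatewise_then_product continuous_on_Re continuous_on_coordinate)
    then have oU: "open (re -` U)" by (rule open_vimage[OF U(1)])
    have zU: "cx z \<in> re -` U" using z by (simp add: re_def cx_def)
    from polynomial_fn_nonzero_nearby[OF P Py oU zU] obtain t :: real where t: "(\<lambda>i. cx z i + of_real t * (cx y i - cx z i)) \<in> re -` U"
      "P (\<lambda>i. cx z i + of_real t * (cx y i - cx z i)) \<noteq> 0" by (elim exE conjE)
    define u where "u i = z i + t * (y i - z i)" for i
    have cu: "(\<lambda>i. cx z i + of_real t * (cx y i - cx z i)) = cx u" by (simp add: cx_def u_def)
    have "u \<in> U" using t(1) unfolding cu by (simp add: re_def cx_def)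
    moreover have "u \<in> supported ?I" using z by (simp add: u_def y_def supported_def)
    ultimately have "cx u \<in> discr_cone n d" using U(3) by (auto simp: real_discr_cone_def cx_def)
    then show False using discr t(2) unfolding cu by blast
  qed
  ultimately have "has_dim (real_discr_cone n d) (card ?I - 1)"
    unfolding has_dim_def cardJ using pos by simp
  then show ?thesis using complex by blast
qed

end
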